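(* Let $(\mathcal{F},\mathcal{E})$ be a Frobenius category, and let $\mathcal{M}_{\mathcal{F}}=(\mathcal{C}of(\mathcal{F}),\mathcal{F}ib(\mathcal{F}),\mathcal{W}e(\mathcal{F}))$, where $\mathcal{C}of(\mathcal{F})$ is the class of inflations of $\mathcal{F}$, $\mathcal{F}ib(\mathcal{F})$ is the class of deflations of $\mathcal{F}$, and $\mathcal{W}e(\mathcal{F})$ is the class of stable equivalences of $\mathcal{F}$. Then $\mathcal{M}_{\mathcal{F}}$ is a classical model structure on $\mathcal{F}$, and the associated homotopy category $\mathrm{Ho}(\mathcal{M}_{\mathcal{F}})$, with the triangulated structure constructed by Quillen, is equivalent as a triangulated category to the stable category $\underline{\mathcal{F}}$, with the triangulated structure constructed by Happel.
   Context: **Exact and Frobenius categories.** An exact category (in the sense of Quillen) is a pair $(\mathcal{A},\mathcal{E})$ where $\mathcal{A}$ is an additive category and $\mathcal{E}$ is a class, closed under isomorphism, of kernel-cokernel sequences $X\xrightarrow{f}Y\xrightarrow{g}Z$ (i.e. $f=\ker g$ and $g=\mathrm{cok} f$) satisfying Quillen's axioms. For a sequence in $\mathcal{E}$ (a conflation), $f$ is called an inflation and $g$ a deflation. The axioms say: identities are inflations and deflations; inflations (resp. deflations) are closed under composition; pushouts of inflations along arbitrary morphisms exist and are inflations; pullbacks of deflations along arbitrary morphisms exist and are deflations. No idempotent completeness is assumed. A Frobenius category is an exact category $(\mathcal{F},\mathcal{E})$ that has enough projective objects and enough injective objects (both relative to $\mathcal{E}$) and in which the projective objects coincide with the injective ones.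 Let $\mathcal{I}$ be the full subcategory of projective-injective objects. **Stable category.** Two morphisms $f,g:X\to Y$ in $\mathcal{F}$ are stably equivalent if $f-g$ factors through an object of $\mathcal{I}$. The stable category $\underline{\mathcal{F}}$ has the same objects as $\mathcal{F}$, and its morphisms are the stable equivalence classes of morphisms; write $\underline{f}$ for the class of $f$. A morphism of $\mathcal{F}$ is a stable equivalence if its class is an isomorphism in $\underline{\mathcal{F}}$. **Happel's triangulated structure on $\underline{\mathcal{F}}$.** For each $X$ choose a conflation $X\xrightarrow{\mu_X}I(X)\xrightarrow{\pi_X}TX$ with $I(X)\in\mathcal{I}$. The shift $T$ sends $X$ to $TX$ and $\underline{f}$ to the class of the morphism $TX\to TY$ induced by an extension $I(X)\to I(Y)$ of $f$. For $u:X\to Y$ let $C_u$ be the pushout of $\mu_X$ and $u$, with maps $v:Y\to C_u$ and $\bar u:I(X)\to C_u$, and let $w:C_u\to TX$ be the morphism with $wv=0$ and $w\bar u=\pi_X$. The distinguished triangles are those isomorphic in $\underline{\mathcal{F}}$ to $X\xrightarrow{\underline{u}}Y\xrightarrow{\underline{v}}C_u\xrightarrow{\underline{w}}TX$ for some $u$. **Classical model structure.** A classical (Quillen) model structure on an exact category $\mathcal{A}$ consists of three classes of morphisms, called cofibrations, fibrations and weak equivalences, with the following properties. (A trivial cofibration, resp. trivial fibration, is a cofibration, resp. fibration, that is also a weak equivalence.) - (M1) Given a commutative square $pf=gi$ with $f:A\to X$, $i:A\to B$, $p:X\to Y$, $g:B\to Y$, if either $i$ is a cofibration and $p$ is a trivial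 fibration, or $i$ is a trivial cofibration and $p$ is a fibration, then there is $h:B\to X$ with $hi=f$ and $ph=g$. - (M2) Fibrations are deflations and are closed under composition and pullback. Cofibrations are inflations and are closed under composition and pushout. The pullback of a trivial fibration is a weak equivalence, and the pushout of a trivial cofibration is a weak equivalence. - (M3) Any morphism $f$ factors as $f=pi$ with $i$ a cofibration and $p$ a trivial fibration, and also as $f=pi$ with $i$ a trivial cofibration and $p$ a fibration. - (M4) If $f,g$ are composable and two of $f,g,gf$ are weak equivalences, so is the third. (Closure of the three classes under retracts is not required.) **Homotopy category.** $\mathrm{Ho}(\mathcal{M}_{\mathcal{F}})$ is the (Gabriel-Zisman) localization of $\mathcal{F}$ with respect to the class of weak equivalences. **Quillen's triangulated structure on $\mathrm{Ho}(\mathcal{M}_{\mathcal{F}})$.** In $\mathcal{M}_{\mathcal{F}}$ every object $A$ is bifibrant ($0\to A$ is a cofibration and $A\to 0$ is a fibration). A path object for $B$ is an object $B^I$ with a factorization $B\xrightarrow{s}B^I\xrightarrow{(p_0,p_1)}B\times B$ of the diagonal, where $s$ is a trivial cofibration and $(p_0,p_1)$ is a fibration. The loop functor $\Omega$ on $\mathrm{Ho}(\mathcal{M}_{\mathcal{F}})$ sends $B$ to $\Omega B=\ker\big((p_0,p_1):B^I\to B\times B\big)$ for a chosen path object; a morphism $f:B\to B'$ of $\mathcal{F}$ lifts to $f^I:B^I\to B'^I$ compatible with $s,p_0,p_1$, and $\Omega f$ is the class of the induced morphism on kernels. Let $p:E\to B$ be a fibration with kernel $i:F\to E$. Factor the morphism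 $(1_E,sp,1_E):E\to E\times_B B^I\times_B E$ (fibre products formed using $p,p_0$ on the left and $p_1,p$ on the right) as a trivial cofibration $E\to E^I$ followed by a fibration $(d_0,p^I,d_1):E^I\to E\times_B B^I\times_B E$. The morphism $\pi:F\times_E E^I\times_E F\to F\times\Omega B$ induced by $d_0$ and $p^I$ (fibre products via $i,d_0$ on the left and $d_1,i$ on the right) is a trivial fibration, and Quillen's action $m:F\times\Omega B\to F$ in $\mathrm{Ho}(\mathcal{M}_{\mathcal{F}})$ is $\pi^{-1}$ followed by the projection to the right-hand factor $F$. Put $\partial=m\circ(0,1):\Omega B\to F$; since the category is additive, $\partial$ determines the action. The left triangles are the diagrams isomorphic in $\mathrm{Ho}(\mathcal{M}_{\mathcal{F}})$ to $\Omega B\xrightarrow{\partial}F\xrightarrow{i}E\xrightarrow{p}B$ for some fibration $p$. Here $\Omega$ is an autoequivalence; the shift functor is a quasi-inverse $\Sigma$ of $\Omega$, and the distinguished triangles are the diagrams $X\to Y\to Z\to\Sigma X$ obtained from left triangles $\Omega Z\xrightarrow{\partial}X\to Y\to Z$ by taking as last morphism the composite $Z\cong\Sigma\Omega Z\xrightarrow{\Sigma\partial}\Sigma X$. (Replacing the last morphism by its negative gives an equivalent triangulated category.) **Equivalence of triangulated categories.** This means an equivalence of categories $\Phi$, together with a natural isomorphism commuting $\Phi$ with the shift functors, under which distinguished triangles are sent to distinguished triangles. *)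

theory Defs
  imports "HOL-Algebra.Group"
begin

section \<open>Categories, functors, limits\<close>

record ('o, 'm) cat =
  Obj :: "'o set"
  Arr :: "'m set"
  Src :: "'m \<Rightarrow> 'o"
  Tgt :: "'m \<Rightarrow> 'o"
  Idn :: "'o \<Rightarrow> 'm"
  Cmp :: "'m \<Rightarrow> 'm \<Rightarrow> 'm"  (infixr "\<cdot>\<index>" 70)

definition Hom :: "('o, 'm, 'z) cat_scheme \<Rightarrow> 'o \<Rightarrow> 'o \<Rightarrow> 'm set" where
  "Hom C X Y = {f \<in> Arr C. Src C f = X \<and> Tgt C f = Y}"

locale category =
  fixes C :: "('o, 'm, 'z) cat_scheme" (structure)
  assumes Src_closed: "f \<in> Arr C \<Longrightarrow> Src C f \<in> Obj C"
    and Tgt_closed: "f \<in> Arr C \<Longrightarrow> Tgt C f \<in> Obj C"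
    and Idn_closed: "X \<in> Obj C \<Longrightarrow> Idn C X \<in> Hom C X X"
    and Cmp_closed: "\<lbrakk>f \<in> Hom C X Y; g \<in> Hom C Y Z\<rbrakk> \<Longrightarrow> g \<cdot> f \<in> Hom C X Z"
    and Cmp_Idn: "f \<in> Arr C \<Longrightarrow> f \<cdot> Idn C (Src C f) = f"
    and Idn_Cmp: "f \<in> Arr C \<Longrightarrow> Idn C (Tgt C f) \<cdot> f = f"
    and Cmp_assoc: "\<lbrakk>f \<in> Hom C W X; g \<in> Hom C X Y; h \<in> Hom C Y Z\<rbrakk>
                      \<Longrightarrow> (h \<cdot> g) \<cdot> f = h \<cdot> (g \<cdot> f)"

definition inverse_arrows :: "('o, 'm, 'z) cat_scheme \<Rightarrow> 'm \<Rightarrow> 'm \<Rightarrow> bool" where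
  "inverse_arrows C f g \<longleftrightarrow>
     f \<in> Arr C \<and> g \<in> Hom C (Tgt C f) (Src C f) \<and>
     g \<cdot>\<^bsub>C\<^esub> f = Idn C (Src C f) \<and> f \<cdot>\<^bsub>C\<^esub> g = Idn C (Tgt C f)"

definition is_iso :: "('o, 'm, 'z) cat_scheme \<Rightarrow> 'm \<Rightarrow> bool" where
  "is_iso C f \<longleftrightarrow> (\<exists>g. inverse_arrows C f g)"

record ('o, 'm, 'p, 'n) ftr =
  OMap :: "'o \<Rightarrow> 'p"
  AMap :: "'m \<Rightarrow> 'n"

definition is_functor ::
  "('o, 'm, 'y) cat_scheme \<Rightarrow> ('p, 'n, 'z) cat_scheme \<Rightarrow> ('o, 'm, 'p, 'n) ftr \<Rightarrow> bool" where
  "is_functor C D F \<longleftrightarrow> category C \<and> category D \<and>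
     (\<forall>X\<in>Obj C. OMap F X \<in> Obj D) \<and>
     (\<forall>f\<in>Arr C. AMap F f \<in> Hom D (OMap F (Src C f)) (OMap F (Tgt C f))) \<and>
     (\<forall>X\<in>Obj C. AMap F (Idn C X) = Idn D (OMap F X)) \<and>
     (\<forall>f\<in>Arr C. \<forall>g\<in>Arr C. Tgt C f = Src C g \<longrightarrow>
        AMap F (g \<cdot>\<^bsub>C\<^esub> f) = AMap F g \<cdot>\<^bsub>D\<^esub> AMap F f)"

definition id_ftr :: "('o, 'm, 'o, 'm) ftr" where
  "id_ftr = \<lparr>OMap = \<lambda>X. X, AMap = \<lambda>f. f\<rparr>"

definition comp_ftr ::
  "('p, 'n, 'q, 'k) ftr \<Rightarrow> ('o, 'm, 'p, 'n) ftr \<Rightarrow> ('o, 'm, 'q, 'k) ftr" where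
  "comp_ftr G F = \<lparr>OMap = \<lambda>X. OMap G (OMap F X), AMap = \<lambda>f. AMap G (AMap F f)\<rparr>"

definition natural_iso ::
  "('o, 'm, 'y) cat_scheme \<Rightarrow> ('p, 'n, 'z) cat_scheme \<Rightarrow>
   ('o, 'm, 'p, 'n) ftr \<Rightarrow> ('o, 'm, 'p, 'n) ftr \<Rightarrow> ('o \<Rightarrow> 'n) \<Rightarrow> bool" where
  "natural_iso C D F G \<eta> \<longleftrightarrow> is_functor C D F \<and> is_functor C D G \<and>
     (\<forall>X\<in>Obj C. \<eta> X \<in> Hom D (OMap F X) (OMap G X) \<and> is_iso D (\<eta> X)) \<and>
     (\<forall>f\<in>Arr C. \<eta> (Tgt C f) \<cdot>\<^bsub>D\<^esub> AMap F f = AMap G f \<cdot>\<^bsub>D\<^esub> \<eta> (Src C f))"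

definition quasi_inverse ::
  "('o, 'm, 'y) cat_scheme \<Rightarrow> ('p, 'n, 'z) cat_scheme \<Rightarrow>
   ('o, 'm, 'p, 'n) ftr \<Rightarrow> ('p, 'n, 'o, 'm) ftr \<Rightarrow> ('o \<Rightarrow> 'm) \<Rightarrow> ('p \<Rightarrow> 'n) \<Rightarrow> bool" where
  "quasi_inverse C D F G \<eta> \<epsilon> \<longleftrightarrow> is_functor C D F \<and> is_functor D C G \<and>
     natural_iso C C id_ftr (comp_ftr G F) \<eta> \<and>
     natural_iso D D (comp_ftr F G) id_ftr \<epsilon>"

definition is_equivalence ::
  "('o, 'm, 'y) cat_scheme \<Rightarrow> ('p, 'n, 'z) cat_scheme \<Rightarrow> ('o, 'm, 'p, 'n) ftr \<Rightarrow> bool" where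
  "is_equivalence C D F \<longleftrightarrow> (\<exists>G \<eta> \<epsilon>. quasi_inverse C D F G \<eta> \<epsilon>)"

definition is_zero_object :: "('o, 'm, 'z) cat_scheme \<Rightarrow> 'o \<Rightarrow> bool" where
  "is_zero_object C Z \<longleftrightarrow> Z \<in> Obj C \<and>
     (\<forall>X\<in>Obj C. (\<exists>!f. f \<in> Hom C X Z) \<and> (\<exists>!f. f \<in> Hom C Z X))"

definition is_product :: "('o, 'm, 'z) cat_scheme \<Rightarrow> 'm \<Rightarrow> 'm \<Rightarrow> bool" where
  "is_product C a b \<longleftrightarrow> a \<in> Arr C \<and> b \<in> Arr C \<and> Src C a = Src C b \<and>
     (\<forall>W. \<forall>x\<in>Hom C W (Tgt C a). \<forall>y\<in>Hom C W (Tgt C b).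
        \<exists>!h. h \<in> Hom C W (Src C a) \<and> a \<cdot>\<^bsub>C\<^esub> h = x \<and> b \<cdot>\<^bsub>C\<^esub> h = y)"

text \<open>The square \<open>f \<cdot> a = g \<cdot> b\<close> is a pullback; thus \<open>b\<close> is the pullback of \<open>f\<close> along \<open>g\<close>.\<close>

definition is_pullback :: "('o, 'm, 'z) cat_scheme \<Rightarrow> 'm \<Rightarrow> 'm \<Rightarrow> 'm \<Rightarrow> 'm \<Rightarrow> bool" where
  "is_pullback C f g a b \<longleftrightarrow> f \<in> Arr C \<and> g \<in> Arr C \<and> Tgt C f = Tgt C g \<and>
     a \<in> Arr C \<and> b \<in> Arr C \<and> Src C a = Src C b \<and> Tgt C a = Src C f \<and> Tgt C b = Src C g \<and>
     f \<cdot>\<^bsub>C\<^esub> a = g \<cdot>\<^bsub>C\<^esub> b \<and>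
     (\<forall>W. \<forall>x\<in>Hom C W (Src C f). \<forall>y\<in>Hom C W (Src C g). f \<cdot>\<^bsub>C\<^esub> x = g \<cdot>\<^bsub>C\<^esub> y \<longrightarrow>
        (\<exists>!h. h \<in> Hom C W (Src C a) \<and> a \<cdot>\<^bsub>C\<^esub> h = x \<and> b \<cdot>\<^bsub>C\<^esub> h = y))"

text \<open>The square \<open>a \<cdot> f = b \<cdot> g\<close> is a pushout; thus \<open>b\<close> is the pushout of \<open>f\<close> along \<open>g\<close>.\<close>

definition is_pushout :: "('o, 'm, 'z) cat_scheme \<Rightarrow> 'm \<Rightarrow> 'm \<Rightarrow> 'm \<Rightarrow> 'm \<Rightarrow> bool" where
  "is_pushout C f g a b \<longleftrightarrow> f \<in> Arr C \<and> g \<in> Arr C \<and> Src C f = Src C g \<and>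
     a \<in> Arr C \<and> b \<in> Arr C \<and> Tgt C a = Tgt C b \<and> Src C a = Tgt C f \<and> Src C b = Tgt C g \<and>
     a \<cdot>\<^bsub>C\<^esub> f = b \<cdot>\<^bsub>C\<^esub> g \<and>
     (\<forall>W. \<forall>x\<in>Hom C (Tgt C f) W. \<forall>y\<in>Hom C (Tgt C g) W. x \<cdot>\<^bsub>C\<^esub> f = y \<cdot>\<^bsub>C\<^esub> g \<longrightarrow>
        (\<exists>!h. h \<in> Hom C (Tgt C a) W \<and> h \<cdot>\<^bsub>C\<^esub> a = x \<and> h \<cdot>\<^bsub>C\<^esub> b = y))"

text \<open>The fibre product \<open>X \<times>\<^bsub>U\<^esub> Y \<times>\<^bsub>V\<^esub> W\<close>, with projections \<open>a, b, c\<close>, of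
  \<open>f : X \<rightarrow> U\<close>, \<open>g : Y \<rightarrow> U\<close>, \<open>h : Y \<rightarrow> V\<close> and \<open>k : W \<rightarrow> V\<close>.\<close>

definition is_double_pullback ::
  "('o, 'm, 'z) cat_scheme \<Rightarrow> 'm \<Rightarrow> 'm \<Rightarrow> 'm \<Rightarrow> 'm \<Rightarrow> 'm \<Rightarrow> 'm \<Rightarrow> 'm \<Rightarrow> bool" where
  "is_double_pullback C f g h k a b c \<longleftrightarrow>
     f \<in> Arr C \<and> g \<in> Arr C \<and> h \<in> Arr C \<and> k \<in> Arr C \<and>
     Tgt C f = Tgt C g \<and> Src C g = Src C h \<and> Tgt C h = Tgt C k \<and>
     a \<in> Arr C \<and> b \<in> Arr C \<and> c \<in> Arr C \<and> Src C a = Src C b \<and> Src C b = Src C c \<and>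
     Tgt C a = Src C f \<and> Tgt C b = Src C g \<and> Tgt C c = Src C k \<and>
     f \<cdot>\<^bsub>C\<^esub> a = g \<cdot>\<^bsub>C\<^esub> b \<and> h \<cdot>\<^bsub>C\<^esub> b = k \<cdot>\<^bsub>C\<^esub> c \<and>
     (\<forall>T. \<forall>x\<in>Hom C T (Src C f). \<forall>y\<in>Hom C T (Src C g). \<forall>z\<in>Hom C T (Src C k).
        f \<cdot>\<^bsub>C\<^esub> x = g \<cdot>\<^bsub>C\<^esub> y \<and> h \<cdot>\<^bsub>C\<^esub> y = k \<cdot>\<^bsub>C\<^esub> z \<longrightarrow>
        (\<exists>!t. t \<in> Hom C T (Src C a) \<and>
              a \<cdot>\<^bsub>C\<^esub> t = x \<and> b \<cdot>\<^bsub>C\<^esub> t = y \<and> c \<cdot>\<^bsub>C\<^esub> t = z))"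

text \<open>Meaningful when \<open>R\<close> is a congruence on \<open>C\<close>: arrows are then nonempty classes of
  parallel arrows, and the union in the composition is over copies of a single class.\<close>

definition quotient_cat ::
  "('o, 'm, 'z) cat_scheme \<Rightarrow> ('m \<times> 'm) set \<Rightarrow> ('o, 'm set) cat" where
  "quotient_cat C R =
     \<lparr>Obj = Obj C,
      Arr = Arr C // R,
      Src = \<lambda>S. the_elem (Src C ` S),
      Tgt = \<lambda>S. the_elem (Tgt C ` S),
      Idn = \<lambda>X. R `` {Idn C X},
      Cmp = \<lambda>T S. \<Union>g\<in>T. \<Union>f\<in>S. R `` {g \<cdot>\<^bsub>C\<^esub> f}\<rparr>"

section \<open>Additive, exact and Frobenius categories\<close>

record ('o, 'm) addcat = "('o, 'm) cat" +
  Zero :: "'o \<Rightarrow> 'o \<Rightarrow> 'm"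
  Add :: "'m \<Rightarrow> 'm \<Rightarrow> 'm"

definition hom_group :: "('o, 'm, 'z) addcat_scheme \<Rightarrow> 'o \<Rightarrow> 'o \<Rightarrow> 'm monoid" where
  "hom_group C X Y = \<lparr>carrier = Hom C X Y, monoid.mult = Add C, one = Zero C X Y\<rparr>"

definition diff :: "('o, 'm, 'z) addcat_scheme \<Rightarrow> 'm \<Rightarrow> 'm \<Rightarrow> 'm" where
  "diff C f g = Add C f (inv\<^bsub>hom_group C (Src C f) (Tgt C f)\<^esub> g)"

locale additive_category = category C
  for C :: "('o, 'm, 'z) addcat_scheme" (structure) +
  assumes hom_comm_group: "\<lbrakk>X \<in> Obj C; Y \<in> Obj C\<rbrakk> \<Longrightarrow> comm_group (hom_group C X Y)"
    and Cmp_Add: "\<lbrakk>f \<in> Hom C X Y; f' \<in> Hom C X Y; g \<in> Hom C Y Z\<rbrakk>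
                    \<Longrightarrow> g \<cdot> Add C f f' = Add C (g \<cdot> f) (g \<cdot> f')"
    and Add_Cmp: "\<lbrakk>f \<in> Hom C X Y; g \<in> Hom C Y Z; g' \<in> Hom C Y Z\<rbrakk>
                    \<Longrightarrow> Add C g g' \<cdot> f = Add C (g \<cdot> f) (g' \<cdot> f)"
    and zero_object_exists: "\<exists>Z. is_zero_object C Z"
    and product_exists: "\<lbrakk>X \<in> Obj C; Y \<in> Obj C\<rbrakk>
                           \<Longrightarrow> \<exists>a b. is_product C a b \<and> Tgt C a = X \<and> Tgt C b = Y"

definition is_kernel :: "('o, 'm, 'z) addcat_scheme \<Rightarrow> 'm \<Rightarrow> 'm \<Rightarrow> bool" where
  "is_kernel C f g \<longleftrightarrow> f \<in> Arr C \<and> g \<in> Arr C \<and> Tgt C f = Src C g \<and>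
     g \<cdot>\<^bsub>C\<^esub> f = Zero C (Src C f) (Tgt C g) \<and>
     (\<forall>W. \<forall>x\<in>Hom C W (Src C g). g \<cdot>\<^bsub>C\<^esub> x = Zero C W (Tgt C g) \<longrightarrow>
        (\<exists>!h. h \<in> Hom C W (Src C f) \<and> f \<cdot>\<^bsub>C\<^esub> h = x))"

definition is_cokernel :: "('o, 'm, 'z) addcat_scheme \<Rightarrow> 'm \<Rightarrow> 'm \<Rightarrow> bool" where
  "is_cokernel C g f \<longleftrightarrow> f \<in> Arr C \<and> g \<in> Arr C \<and> Tgt C f = Src C g \<and>
     g \<cdot>\<^bsub>C\<^esub> f = Zero C (Src C f) (Tgt C g) \<and>
     (\<forall>W. \<forall>x\<in>Hom C (Tgt C f) W. x \<cdot>\<^bsub>C\<^esub> f = Zero C (Src C f) W \<longrightarrow>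
        (\<exists>!h. h \<in> Hom C (Tgt C g) W \<and> h \<cdot>\<^bsub>C\<^esub> g = x))"

definition inflation :: "('m \<times> 'm) set \<Rightarrow> 'm \<Rightarrow> bool" where
  "inflation E f \<longleftrightarrow> (\<exists>g. (f, g) \<in> E)"

definition deflation :: "('m \<times> 'm) set \<Rightarrow> 'm \<Rightarrow> bool" where
  "deflation E g \<longleftrightarrow> (\<exists>f. (f, g) \<in> E)"

locale exact_category = additive_category C
  for C :: "('o, 'm, 'z) addcat_scheme" (structure) +
  fixes E :: "('m \<times> 'm) set"
  assumes conflation: "(f, g) \<in> E \<Longrightarrow> is_kernel C f g \<and> is_cokernel C g f"
    and conflation_iso:
      "\<lbrakk>(f, g) \<in> E; is_iso C a; is_iso C b; is_iso C c;
        Src C a = Src C f; Src C b = Tgt C f; Src C c = Tgt C g;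
        f' \<in> Hom C (Tgt C a) (Tgt C b); g' \<in> Hom C (Tgt C b) (Tgt C c);
        f' \<cdot> a = b \<cdot> f; g' \<cdot> b = c \<cdot> g\<rbrakk> \<Longrightarrow> (f', g') \<in> E"
    and inflation_Idn: "X \<in> Obj C \<Longrightarrow> inflation E (Idn C X)"
    and deflation_Idn: "X \<in> Obj C \<Longrightarrow> deflation E (Idn C X)"
    and inflation_Cmp: "\<lbrakk>inflation E f; inflation E g; Tgt C f = Src C g\<rbrakk> \<Longrightarrow> inflation E (g \<cdot> f)"
    and deflation_Cmp: "\<lbrakk>deflation E f; deflation E g; Tgt C f = Src C g\<rbrakk> \<Longrightarrow> deflation E (g \<cdot> f)"
    and pushout_exists: "\<lbrakk>inflation E i; f \<in> Arr C; Src C f = Src C i\<rbrakk> \<Longrightarrow> \<exists>a b. is_pushout C i f a b"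
    and inflation_pushout: "\<lbrakk>inflation E i; is_pushout C i f a b\<rbrakk> \<Longrightarrow> inflation E b"
    and pullback_exists: "\<lbrakk>deflation E p; f \<in> Arr C; Tgt C f = Tgt C p\<rbrakk> \<Longrightarrow> \<exists>a b. is_pullback C p f a b"
    and deflation_pullback: "\<lbrakk>deflation E p; is_pullback C p f a b\<rbrakk> \<Longrightarrow> deflation E b"

definition projective :: "('o, 'm, 'z) addcat_scheme \<Rightarrow> ('m \<times> 'm) set \<Rightarrow> 'o \<Rightarrow> bool" where
  "projective C E P \<longleftrightarrow> P \<in> Obj C \<and>
     (\<forall>g h. deflation E g \<and> h \<in> Hom C P (Tgt C g) \<longrightarrow> (\<exists>k\<in>Hom C P (Src C g). g \<cdot>\<^bsub>C\<^esub> k = h))"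

definition injective :: "('o, 'm, 'z) addcat_scheme \<Rightarrow> ('m \<times> 'm) set \<Rightarrow> 'o \<Rightarrow> bool" where
  "injective C E J \<longleftrightarrow> J \<in> Obj C \<and>
     (\<forall>f h. inflation E f \<and> h \<in> Hom C (Src C f) J \<longrightarrow> (\<exists>k\<in>Hom C (Tgt C f) J. k \<cdot>\<^bsub>C\<^esub> f = h))"

definition proj_inj :: "('o, 'm, 'z) addcat_scheme \<Rightarrow> ('m \<times> 'm) set \<Rightarrow> 'o \<Rightarrow> bool" where
  "proj_inj C E J \<longleftrightarrow> projective C E J \<and> injective C E J"

locale frobenius_category = exact_category C E
  for C :: "('o, 'm, 'z) addcat_scheme" (structure) and E :: "('m \<times> 'm) set" +
  assumes enough_projectives:
      "X \<in> Obj C \<Longrightarrow> \<exists>g. deflation E g \<and> Tgt C g = X \<and> projective C E (Src C g)"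
    and enough_injectives:
      "X \<in> Obj C \<Longrightarrow> \<exists>f. inflation E f \<and> Src C f = X \<and> injective C E (Tgt C f)"
    and projective_iff_injective: "projective C E X \<longleftrightarrow> injective C E X"

section \<open>The stable category\<close>

definition stable_rel :: "('o, 'm, 'z) addcat_scheme \<Rightarrow> ('m \<times> 'm) set \<Rightarrow> ('m \<times> 'm) set" where
  "stable_rel C E = {(f, g). f \<in> Arr C \<and> g \<in> Hom C (Src C f) (Tgt C f) \<and>
     (\<exists>J a b. proj_inj C E J \<and> a \<in> Hom C (Src C f) J \<and> b \<in> Hom C J (Tgt C f) \<and>
        diff C f g = b \<cdot>\<^bsub>C\<^esub> a)}"

definition stable_cat :: "('o, 'm, 'z) addcat_scheme \<Rightarrow> ('m \<times> 'm) set \<Rightarrow> ('o, 'm set) cat" where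
  "stable_cat C E = quotient_cat C (stable_rel C E)"

definition stable_class :: "('o, 'm, 'z) addcat_scheme \<Rightarrow> ('m \<times> 'm) set \<Rightarrow> 'm \<Rightarrow> 'm set" where
  "stable_class C E f = stable_rel C E `` {f}"

definition stable_equivalence :: "('o, 'm, 'z) addcat_scheme \<Rightarrow> ('m \<times> 'm) set \<Rightarrow> 'm \<Rightarrow> bool" where
  "stable_equivalence C E f \<longleftrightarrow> f \<in> Arr C \<and> is_iso (stable_cat C E) (stable_class C E f)"

section \<open>Categories with shift and triangles\<close>

text \<open>A triangle \<open>X \<rightarrow> Y \<rightarrow> Z \<rightarrow> Shift X\<close> is the triple of its arrows.\<close>

record ('o, 'm) tricat = "('o, 'm) cat" +
  Shift :: "('o, 'm, 'o, 'm) ftr"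
  Tri :: "('m \<times> 'm \<times> 'm) set"

definition triangulated_equivalence ::
  "('o, 'm, 'y) tricat_scheme \<Rightarrow> ('p, 'n, 'z) tricat_scheme \<Rightarrow>
   ('o, 'm, 'p, 'n) ftr \<Rightarrow> ('o \<Rightarrow> 'n) \<Rightarrow> bool" where
  "triangulated_equivalence C D \<Phi> \<phi> \<longleftrightarrow>
     is_equivalence C D \<Phi> \<and>
     natural_iso C D (comp_ftr \<Phi> (Shift C)) (comp_ftr (Shift D) \<Phi>) \<phi> \<and>
     (\<forall>u v w. (u, v, w) \<in> Tri C \<longrightarrow>
        (AMap \<Phi> u, AMap \<Phi> v, \<phi> (Src C u) \<cdot>\<^bsub>D\<^esub> AMap \<Phi> w) \<in> Tri D)"

definition is_triangle ::
  "('o, 'm, 'z) cat_scheme \<Rightarrow> ('o, 'm, 'o, 'm) ftr \<Rightarrow> 'm \<Rightarrow> 'm \<Rightarrow> 'm \<Rightarrow> bool" where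
  "is_triangle C T u v w \<longleftrightarrow> u \<in> Arr C \<and> v \<in> Arr C \<and> Src C v = Tgt C u \<and>
     w \<in> Hom C (Tgt C v) (OMap T (Src C u))"

definition isomorphic_triangles ::
  "('o, 'm, 'z) cat_scheme \<Rightarrow> ('o, 'm, 'o, 'm) ftr \<Rightarrow> 'm \<times> 'm \<times> 'm \<Rightarrow> 'm \<times> 'm \<times> 'm \<Rightarrow> bool" where
  "isomorphic_triangles C T = (\<lambda>(u, v, w) (u', v', w').
     is_triangle C T u v w \<and> is_triangle C T u' v' w' \<and>
     (\<exists>a b c. is_iso C a \<and> is_iso C b \<and> is_iso C c \<and>
        a \<in> Hom C (Src C u) (Src C u') \<and> b \<in> Hom C (Tgt C u) (Tgt C u') \<and>
        c \<in> Hom C (Tgt C v) (Tgt C v') \<and>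
        u' \<cdot>\<^bsub>C\<^esub> a = b \<cdot>\<^bsub>C\<^esub> u \<and> v' \<cdot>\<^bsub>C\<^esub> b = c \<cdot>\<^bsub>C\<^esub> v \<and> w' \<cdot>\<^bsub>C\<^esub> c = AMap T a \<cdot>\<^bsub>C\<^esub> w))"

section \<open>Happel's triangles\<close>

definition happel_choice ::
  "('o, 'm, 'z) addcat_scheme \<Rightarrow> ('m \<times> 'm) set \<Rightarrow> ('o \<Rightarrow> 'm) \<Rightarrow> ('o \<Rightarrow> 'm) \<Rightarrow> bool" where
  "happel_choice C E \<mu> \<pi> \<longleftrightarrow>
     (\<forall>X\<in>Obj C. (\<mu> X, \<pi> X) \<in> E \<and> Src C (\<mu> X) = X \<and> proj_inj C E (Tgt C (\<mu> X)))"

text \<open>\<open>t : TX \<rightarrow> TY\<close> is induced by some extension \<open>e : I(X) \<rightarrow> I(Y)\<close> of \<open>f : X \<rightarrow> Y\<close>.\<close>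

definition happel_induced ::
  "('o, 'm, 'z) addcat_scheme \<Rightarrow> ('o \<Rightarrow> 'm) \<Rightarrow> ('o \<Rightarrow> 'm) \<Rightarrow> 'm \<Rightarrow> 'm \<Rightarrow> bool" where
  "happel_induced C \<mu> \<pi> f t \<longleftrightarrow>
     (let X = Src C f; Y = Tgt C f in
       \<exists>e\<in>Hom C (Tgt C (\<mu> X)) (Tgt C (\<mu> Y)).
         t \<in> Hom C (Tgt C (\<pi> X)) (Tgt C (\<pi> Y)) \<and>
         e \<cdot>\<^bsub>C\<^esub> \<mu> X = \<mu> Y \<cdot>\<^bsub>C\<^esub> f \<and> t \<cdot>\<^bsub>C\<^esub> \<pi> X = \<pi> Y \<cdot>\<^bsub>C\<^esub> e)"

text \<open>The stable class of the induced morphism depends neither on the representative \<open>f\<close> nor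
  on the extension, so the union below is over copies of a single class.\<close>

definition happel_shift ::
  "('o, 'm, 'z) addcat_scheme \<Rightarrow> ('m \<times> 'm) set \<Rightarrow> ('o \<Rightarrow> 'm) \<Rightarrow> ('o \<Rightarrow> 'm) \<Rightarrow>
   ('o, 'm set, 'o, 'm set) ftr" where
  "happel_shift C E \<mu> \<pi> =
     \<lparr>OMap = \<lambda>X. Tgt C (\<pi> X),
      AMap = \<lambda>S. \<Union>f\<in>S. \<Union>t\<in>{t. happel_induced C \<mu> \<pi> f t}. stable_class C E t\<rparr>"

definition happel_standard ::
  "('o, 'm, 'z) addcat_scheme \<Rightarrow> ('o \<Rightarrow> 'm) \<Rightarrow> ('o \<Rightarrow> 'm) \<Rightarrow> 'm \<Rightarrow> 'm \<Rightarrow> 'm \<Rightarrow> bool" where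
  "happel_standard C \<mu> \<pi> u v w \<longleftrightarrow> u \<in> Arr C \<and>
     (\<exists>u'. is_pushout C (\<mu> (Src C u)) u u' v \<and>
       w \<in> Hom C (Tgt C v) (Tgt C (\<pi> (Src C u))) \<and>
       w \<cdot>\<^bsub>C\<^esub> v = Zero C (Src C v) (Tgt C w) \<and> w \<cdot>\<^bsub>C\<^esub> u' = \<pi> (Src C u))"

definition happel_tricat ::
  "('o, 'm, 'z) addcat_scheme \<Rightarrow> ('m \<times> 'm) set \<Rightarrow> ('o \<Rightarrow> 'm) \<Rightarrow> ('o \<Rightarrow> 'm) \<Rightarrow>
   ('o, 'm set) tricat" where
  "happel_tricat C E \<mu> \<pi> = cat.extend (stable_cat C E) (tricat.fields
     (happel_shift C E \<mu> \<pi>)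
     {t. \<exists>u v w. happel_standard C \<mu> \<pi> u v w \<and>
         isomorphic_triangles (stable_cat C E) (happel_shift C E \<mu> \<pi>)
           (stable_class C E u, stable_class C E v, stable_class C E w) t})"

section \<open>Classical model structures\<close>

record 'm model =
  Cof :: "'m set"
  Fib :: "'m set"
  Weq :: "'m set"

locale classical_model_structure = exact_category C E
  for C :: "('o, 'm, 'z) addcat_scheme" (structure) and E :: "('m \<times> 'm) set" +
  fixes M :: "'m model"
  assumes Weq_Arr: "Weq M \<subseteq> Arr C"
    and M1:
      "\<lbrakk>f \<in> Hom C A X; i \<in> Hom C A B; p \<in> Hom C X Y; g \<in> Hom C B Y; p \<cdot> f = g \<cdot> i;
        i \<in> Cof M \<and> p \<in> Fib M \<inter> Weq M \<or> i \<in> Cof M \<inter> Weq M \<and> p \<in> Fib M\<rbrakk>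
         \<Longrightarrow> \<exists>h\<in>Hom C B X. h \<cdot> i = f \<and> p \<cdot> h = g"
    and M2_Fib_deflation: "p \<in> Fib M \<Longrightarrow> deflation E p"
    and M2_Fib_Cmp: "\<lbrakk>p \<in> Fib M; q \<in> Fib M; Tgt C p = Src C q\<rbrakk> \<Longrightarrow> q \<cdot> p \<in> Fib M"
    and M2_Fib_pullback: "\<lbrakk>p \<in> Fib M; is_pullback C p f a b\<rbrakk> \<Longrightarrow> b \<in> Fib M"
    and M2_Cof_inflation: "i \<in> Cof M \<Longrightarrow> inflation E i"
    and M2_Cof_Cmp: "\<lbrakk>i \<in> Cof M; j \<in> Cof M; Tgt C i = Src C j\<rbrakk> \<Longrightarrow> j \<cdot> i \<in> Cof M"
    and M2_Cof_pushout: "\<lbrakk>i \<in> Cof M; is_pushout C i f a b\<rbrakk> \<Longrightarrow> b \<in> Cof M"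
    and M2_trivial_Fib_pullback: "\<lbrakk>p \<in> Fib M \<inter> Weq M; is_pullback C p f a b\<rbrakk> \<Longrightarrow> b \<in> Weq M"
    and M2_trivial_Cof_pushout: "\<lbrakk>i \<in> Cof M \<inter> Weq M; is_pushout C i f a b\<rbrakk> \<Longrightarrow> b \<in> Weq M"
    and M3_Cof: "f \<in> Arr C \<Longrightarrow>
      \<exists>i p. i \<in> Cof M \<and> p \<in> Fib M \<inter> Weq M \<and> Tgt C i = Src C p \<and> f = p \<cdot> i"
    and M3_Fib: "f \<in> Arr C \<Longrightarrow>
      \<exists>i p. i \<in> Cof M \<inter> Weq M \<and> p \<in> Fib M \<and> Tgt C i = Src C p \<and> f = p \<cdot> i"
    and M4: "\<lbrakk>f \<in> Arr C; g \<in> Arr C; Tgt C f = Src C g;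
        f \<in> Weq M \<and> g \<in> Weq M \<or> f \<in> Weq M \<and> g \<cdot> f \<in> Weq M \<or> g \<in> Weq M \<and> g \<cdot> f \<in> Weq M\<rbrakk>
         \<Longrightarrow> f \<in> Weq M \<and> g \<in> Weq M \<and> g \<cdot> f \<in> Weq M"

definition frobenius_model :: "('o, 'm, 'z) addcat_scheme \<Rightarrow> ('m \<times> 'm) set \<Rightarrow> 'm model" where
  "frobenius_model C E =
     \<lparr>Cof = {f. inflation E f}, Fib = {f. deflation E f}, Weq = {f. stable_equivalence C E f}\<rparr>"

section \<open>Gabriel-Zisman localization\<close>

text \<open>\<open>Bwd w\<close> is the formal inverse of \<open>w \<in> W\<close>; zigzags are listed in the order in which they
  are traversed.\<close>

datatype 'm step = Fwd 'm | Bwd 'm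

fun zigzag :: "('o, 'm, 'z) cat_scheme \<Rightarrow> 'm set \<Rightarrow> 'o \<Rightarrow> 'm step list \<Rightarrow> 'o \<Rightarrow> bool" where
  "zigzag C W X [] Y \<longleftrightarrow> X \<in> Obj C \<and> X = Y"
| "zigzag C W X (Fwd f # s) Y \<longleftrightarrow> f \<in> Arr C \<and> Src C f = X \<and> zigzag C W (Tgt C f) s Y"
| "zigzag C W X (Bwd w # s) Y \<longleftrightarrow> w \<in> W \<and> Tgt C w = X \<and> zigzag C W (Src C w) s Y"

definition zigzag_cat ::
  "('o, 'm, 'z) cat_scheme \<Rightarrow> 'm set \<Rightarrow> ('o, 'o \<times> 'm step list \<times> 'o) cat" where
  "zigzag_cat C W =
     \<lparr>Obj = Obj C,
      Arr = {(X, s, Y). zigzag C W X s Y},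
      Src = \<lambda>(X, s, Y). X,
      Tgt = \<lambda>(X, s, Y). Y,
      Idn = \<lambda>X. (X, [], X),
      Cmp = \<lambda>(Y', t, Z) (X, s, Y). (X, s @ t, Z)\<rparr>"

inductive gz_eq ::
  "('o, 'm, 'z) cat_scheme \<Rightarrow> 'm set \<Rightarrow>
   'o \<times> 'm step list \<times> 'o \<Rightarrow> 'o \<times> 'm step list \<times> 'o \<Rightarrow> bool"
  for C :: "('o, 'm, 'z) cat_scheme" and W :: "'m set" where
  refl: "a \<in> Arr (zigzag_cat C W) \<Longrightarrow> gz_eq C W a a"
| sym: "gz_eq C W a b \<Longrightarrow> gz_eq C W b a"
| trans: "gz_eq C W a b \<Longrightarrow> gz_eq C W b c \<Longrightarrow> gz_eq C W a c"
| cong: "gz_eq C W a a' \<Longrightarrow> gz_eq C W b b' \<Longrightarrow>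
    Tgt (zigzag_cat C W) a = Src (zigzag_cat C W) b \<Longrightarrow>
    gz_eq C W (b \<cdot>\<^bsub>zigzag_cat C W\<^esub> a) (b' \<cdot>\<^bsub>zigzag_cat C W\<^esub> a')"
| Fwd_Idn: "X \<in> Obj C \<Longrightarrow> gz_eq C W (X, [Fwd (Idn C X)], X) (X, [], X)"
| Fwd_Cmp: "f \<in> Arr C \<Longrightarrow> g \<in> Arr C \<Longrightarrow> Tgt C f = Src C g \<Longrightarrow>
    gz_eq C W (Src C f, [Fwd f, Fwd g], Tgt C g) (Src C f, [Fwd (g \<cdot>\<^bsub>C\<^esub> f)], Tgt C g)"
| Fwd_Bwd: "w \<in> W \<Longrightarrow> gz_eq C W (Src C w, [Fwd w, Bwd w], Src C w) (Src C w, [], Src C w)"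
| Bwd_Fwd: "w \<in> W \<Longrightarrow> gz_eq C W (Tgt C w, [Bwd w, Fwd w], Tgt C w) (Tgt C w, [], Tgt C w)"

definition gz_rel ::
  "('o, 'm, 'z) cat_scheme \<Rightarrow> 'm set \<Rightarrow>
   (('o \<times> 'm step list \<times> 'o) \<times> ('o \<times> 'm step list \<times> 'o)) set" where
  "gz_rel C W = {(a, b). gz_eq C W a b}"

type_synonym ('o, 'm) ho_arr = "('o \<times> 'm step list \<times> 'o) set"

definition ho_cat :: "('o, 'm, 'z) cat_scheme \<Rightarrow> 'm model \<Rightarrow> ('o, ('o, 'm) ho_arr) cat" where
  "ho_cat C M = quotient_cat (zigzag_cat C (Weq M)) (gz_rel C (Weq M))"

definition ho_class :: "('o, 'm, 'z) cat_scheme \<Rightarrow> 'm model \<Rightarrow> 'm \<Rightarrow> ('o, 'm) ho_arr" where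
  "ho_class C M f = gz_rel C (Weq M) `` {(Src C f, [Fwd f], Tgt C f)}"

section \<open>Quillen's triangles\<close>

text \<open>A path object \<open>B\<^sup>I\<close> for \<open>B\<close>: the map \<open>po_s : B \<rightarrow> B\<^sup>I\<close>, the projections \<open>po_q0, po_q1\<close> of
  the product \<open>B \<times> B\<close>, the map \<open>po_p = (p\<^sub>0, p\<^sub>1) : B\<^sup>I \<rightarrow> B \<times> B\<close>, and a kernel \<open>po_k : \<Omega>B \<rightarrow> B\<^sup>I\<close>
  of \<open>po_p\<close>.\<close>

record 'm path_object =
  po_s :: 'm
  po_q0 :: 'm
  po_q1 :: 'm
  po_p :: 'm
  po_k :: 'm

definition po_p0 :: "('o, 'm, 'z) cat_scheme \<Rightarrow> 'm path_object \<Rightarrow> 'm" where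
  "po_p0 C P = po_q0 P \<cdot>\<^bsub>C\<^esub> po_p P"

definition po_p1 :: "('o, 'm, 'z) cat_scheme \<Rightarrow> 'm path_object \<Rightarrow> 'm" where
  "po_p1 C P = po_q1 P \<cdot>\<^bsub>C\<^esub> po_p P"

definition is_path_object ::
  "('o, 'm, 'z) addcat_scheme \<Rightarrow> 'm model \<Rightarrow> 'o \<Rightarrow> 'm path_object \<Rightarrow> bool" where
  "is_path_object C M B P \<longleftrightarrow>
     is_product C (po_q0 P) (po_q1 P) \<and> Tgt C (po_q0 P) = B \<and> Tgt C (po_q1 P) = B \<and>
     po_s P \<in> Hom C B (Src C (po_p P)) \<and> po_p P \<in> Hom C (Tgt C (po_s P)) (Src C (po_q0 P)) \<and>
     po_s P \<in> Cof M \<inter> Weq M \<and> po_p P \<in> Fib M \<and>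
     po_p0 C P \<cdot>\<^bsub>C\<^esub> po_s P = Idn C B \<and> po_p1 C P \<cdot>\<^bsub>C\<^esub> po_s P = Idn C B \<and>
     is_kernel C (po_k P) (po_p P)"

definition path_object_choice ::
  "('o, 'm, 'z) addcat_scheme \<Rightarrow> 'm model \<Rightarrow> ('o \<Rightarrow> 'm path_object) \<Rightarrow> bool" where
  "path_object_choice C M P \<longleftrightarrow> (\<forall>B\<in>Obj C. is_path_object C M B (P B))"

text \<open>\<open>t : \<Omega>B \<rightarrow> \<Omega>B'\<close> is induced by some lift \<open>g : B\<^sup>I \<rightarrow> B'\<^sup>I\<close> of \<open>f : B \<rightarrow> B'\<close>.\<close>

definition loop_induced ::
  "('o, 'm, 'z) addcat_scheme \<Rightarrow> ('o \<Rightarrow> 'm path_object) \<Rightarrow> 'm \<Rightarrow> 'm \<Rightarrow> bool" where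
  "loop_induced C P f t \<longleftrightarrow>
     (let Q = P (Src C f); R = P (Tgt C f) in
       \<exists>g\<in>Hom C (Tgt C (po_s Q)) (Tgt C (po_s R)).
         g \<cdot>\<^bsub>C\<^esub> po_s Q = po_s R \<cdot>\<^bsub>C\<^esub> f \<and>
         po_p0 C R \<cdot>\<^bsub>C\<^esub> g = f \<cdot>\<^bsub>C\<^esub> po_p0 C Q \<and>
         po_p1 C R \<cdot>\<^bsub>C\<^esub> g = f \<cdot>\<^bsub>C\<^esub> po_p1 C Q \<and>
         t \<in> Hom C (Src C (po_k Q)) (Src C (po_k R)) \<and>
         po_k R \<cdot>\<^bsub>C\<^esub> t = g \<cdot>\<^bsub>C\<^esub> po_k Q)"

text \<open>When all objects are bifibrant, every arrow of the homotopy category is the class of some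
  arrow of \<open>C\<close>, and the union below is over copies of a single class.\<close>

definition loop_functor ::
  "('o, 'm, 'z) addcat_scheme \<Rightarrow> 'm model \<Rightarrow> ('o \<Rightarrow> 'm path_object) \<Rightarrow>
   ('o, ('o, 'm) ho_arr, 'o, ('o, 'm) ho_arr) ftr" where
  "loop_functor C M P =
     \<lparr>OMap = \<lambda>B. Src C (po_k (P B)),
      AMap = \<lambda>\<alpha>. \<Union>f\<in>{f \<in> Arr C. ho_class C M f = \<alpha>}.
                  \<Union>t\<in>{t. loop_induced C P f t}. ho_class C M t\<rparr>"

text \<open>\<open>m : F \<times> \<Omega>B \<rightarrow> F\<close> is Quillen's action for the fibration \<open>p : E \<rightarrow> B\<close> with kernel
  \<open>i : F \<rightarrow> E\<close>, where \<open>n0, n1\<close> are the projections of \<open>F \<times> \<Omega>B\<close>. Below, \<open>l0, l1, l2\<close> are the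
  projections of \<open>E \<times>\<^bsub>B\<^esub> B\<^sup>I \<times>\<^bsub>B\<^esub> E\<close>, the maps \<open>j : E \<rightarrow> E\<^sup>I\<close> and \<open>q = (d\<^sub>0, p\<^sup>I, d\<^sub>1)\<close> factor
  \<open>(1, sp, 1)\<close>, and \<open>m0, m1, m2\<close> are the projections of \<open>F \<times>\<^bsub>E\<^esub> E\<^sup>I \<times>\<^bsub>E\<^esub> F\<close>.\<close>

definition quillen_action ::
  "('o, 'm, 'z) addcat_scheme \<Rightarrow> 'm model \<Rightarrow> ('o \<Rightarrow> 'm path_object) \<Rightarrow>
   'm \<Rightarrow> 'm \<Rightarrow> 'm \<Rightarrow> 'm \<Rightarrow> ('o, 'm) ho_arr \<Rightarrow> bool" where
  "quillen_action C M P p i n0 n1 m \<longleftrightarrow>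
     p \<in> Fib M \<and> is_kernel C i p \<and>
     (let B = Tgt C p; PB = P B in
       is_product C n0 n1 \<and> Tgt C n0 = Src C i \<and> Tgt C n1 = Src C (po_k PB) \<and>
       (\<exists>l0 l1 l2 j q m0 m1 m2 \<pi> r.
          is_double_pullback C p (po_p0 C PB) (po_p1 C PB) p l0 l1 l2 \<and>
          j \<in> Cof M \<inter> Weq M \<and> q \<in> Fib M \<and>
          j \<in> Hom C (Src C p) (Src C q) \<and> q \<in> Hom C (Tgt C j) (Src C l0) \<and>
          l0 \<cdot>\<^bsub>C\<^esub> q \<cdot>\<^bsub>C\<^esub> j = Idn C (Src C p) \<and>
          l1 \<cdot>\<^bsub>C\<^esub> q \<cdot>\<^bsub>C\<^esub> j = po_s PB \<cdot>\<^bsub>C\<^esub> p \<and>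
          l2 \<cdot>\<^bsub>C\<^esub> q \<cdot>\<^bsub>C\<^esub> j = Idn C (Src C p) \<and>
          is_double_pullback C i (l0 \<cdot>\<^bsub>C\<^esub> q) (l2 \<cdot>\<^bsub>C\<^esub> q) i m0 m1 m2 \<and>
          \<pi> \<in> Hom C (Src C m0) (Src C n0) \<and>
          n0 \<cdot>\<^bsub>C\<^esub> \<pi> = m0 \<and>
          po_k PB \<cdot>\<^bsub>C\<^esub> n1 \<cdot>\<^bsub>C\<^esub> \<pi> = (l1 \<cdot>\<^bsub>C\<^esub> q) \<cdot>\<^bsub>C\<^esub> m1 \<and>
          inverse_arrows (ho_cat C M) (ho_class C M \<pi>) r \<and>
          m = ho_class C M m2 \<cdot>\<^bsub>ho_cat C M\<^esub> r))"

definition quillen_boundary ::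
  "('o, 'm, 'z) addcat_scheme \<Rightarrow> 'm model \<Rightarrow> ('o \<Rightarrow> 'm path_object) \<Rightarrow>
   'm \<Rightarrow> 'm \<Rightarrow> ('o, 'm) ho_arr \<Rightarrow> bool" where
  "quillen_boundary C M P p i d \<longleftrightarrow>
     (\<exists>n0 n1 m z. quillen_action C M P p i n0 n1 m \<and>
        z \<in> Hom C (Tgt C n1) (Src C n0) \<and>
        n0 \<cdot>\<^bsub>C\<^esub> z = Zero C (Tgt C n1) (Tgt C n0) \<and> n1 \<cdot>\<^bsub>C\<^esub> z = Idn C (Tgt C n1) \<and>
        d = m \<cdot>\<^bsub>ho_cat C M\<^esub> ho_class C M z)"

text \<open>A left triangle \<open>\<Omega>Z \<rightarrow> X \<rightarrow> Y \<rightarrow> Z\<close> is the triple \<open>(d, u, v)\<close> of its arrows.\<close>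

definition left_triangles ::
  "('o, 'm, 'z) addcat_scheme \<Rightarrow> 'm model \<Rightarrow> ('o \<Rightarrow> 'm path_object) \<Rightarrow>
   (('o, 'm) ho_arr \<times> ('o, 'm) ho_arr \<times> ('o, 'm) ho_arr) set" where
  "left_triangles C M P =
     (let H = ho_cat C M; \<Omega> = loop_functor C M P in
       {(d, u, v). u \<in> Arr H \<and> v \<in> Arr H \<and> Src H v = Tgt H u \<and>
          d \<in> Hom H (OMap \<Omega> (Tgt H v)) (Src H u) \<and>
          (\<exists>p i d0 a b c. quillen_boundary C M P p i d0 \<and>
             is_iso H a \<and> is_iso H b \<and> is_iso H c \<and>
             a \<in> Hom H (Src C i) (Src H u) \<and> b \<in> Hom H (Src C p) (Tgt H u) \<and>
             c \<in> Hom H (Tgt C p) (Tgt H v) \<and>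
             d \<cdot>\<^bsub>H\<^esub> AMap \<Omega> c = a \<cdot>\<^bsub>H\<^esub> d0 \<and>
             u \<cdot>\<^bsub>H\<^esub> a = b \<cdot>\<^bsub>H\<^esub> ho_class C M i \<and>
             v \<cdot>\<^bsub>H\<^esub> b = c \<cdot>\<^bsub>H\<^esub> ho_class C M p)})"

text \<open>\<open>\<Sigma>\<close> is a quasi-inverse of the loop functor and \<open>\<eta> : 1 \<cong> \<Sigma>\<Omega>\<close>.\<close>

definition quillen_tricat ::
  "('o, 'm, 'z) addcat_scheme \<Rightarrow> 'm model \<Rightarrow> ('o \<Rightarrow> 'm path_object) \<Rightarrow>
   ('o, ('o, 'm) ho_arr, 'o, ('o, 'm) ho_arr) ftr \<Rightarrow> ('o \<Rightarrow> ('o, 'm) ho_arr) \<Rightarrow>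
   ('o, ('o, 'm) ho_arr) tricat" where
  "quillen_tricat C M P \<Sigma> \<eta> = cat.extend (ho_cat C M) (tricat.fields \<Sigma>
     {(u, v, w). \<exists>d. (d, u, v) \<in> left_triangles C M P \<and>
        w = AMap \<Sigma> d \<cdot>\<^bsub>ho_cat C M\<^esub> \<eta> (Tgt (ho_cat C M) v)})"

end

(*
In a Frobenius category a deflation is a stable equivalence iff it has a section s with 1 - sp
factoring through a projective-injective object, and dually for inflations; this gives the lifting
and base change axioms, and Y x I(X) and X x P(Y) give the factorizations.  Stably equal morphisms
f = g + b a become equal in Ho, because (1,0), (1,b) : Y + J -> Y share a section that is inverted,
so Ho and the stable category have the same morphisms.

Everything triangulated is read off morphisms between "covers", conflations A -> J -> B with J
projective-injective: such a morphism (t, e, f) determines the stable classes of t and f from each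
other.  Happel's shift passes from t to f and the loop functor from f to t, since
Omega B -> ker p0 -> B is a cover.  Lifting through p the deflation ker p0 -> B computes
Quillen's boundary of a fibration p as the morphism of kernels, and comparing with the cover
F -> I(F) -> TF shows that F -> E -> B is a Happel triangle up to the sign of its last morphism.
This sign is absorbed in the isomorphism between the two shifts.
*)
theory Submission
  imports Defs
begin

section \<open>Categories, functors and quotient categories\<close>

text \<open>Idempotents need not split, so trivial fibrations are handled by equations: a section
  \<open>s\<close> and a factorization \<open>1 - s p = b a\<close> with \<open>p b = 0\<close> are
  carried into lifts and along pullbacks by hand.

  The boundary can be computed because the kernel of \<open>p0\<close> is projective: the morphism
  (0, j, e) from it to the fibre product of E, the path object and E lifts through the fibration
  onto that product, and restricting the lift to the loop object gives an explicit preimage of (0,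
  1) under the trivial fibration \<open>\<pi>\<close> that Quillen's action inverts.

  The shift \<open>\<Sigma>\<close> is an arbitrary quasi-inverse of the loop functor. Its triangles
  involve only the unit \<open>\<eta>\<close>, while the isomorphism of shifts is built from a
  counit, and the given counit need not satisfy a triangle identity with \<open>\<eta>\<close>. It
  is therefore corrected first; only then is the last morphism, \<open>\<Sigma> d\<close> after
  \<open>\<eta> Z\<close>, sent to \<open>T d\<close> after
  \<open>\<psi> Z : Z -> T \<Omega> Z\<close>. The sign sits in \<open>\<psi> Z\<close>, which is
  induced by -1 on the loop object.\<close>

lemma mem_Hom: "f \<in> Hom C X Y \<longleftrightarrow> f \<in> Arr C \<and> Src C f = X \<and> Tgt C f = Y"
  by (auto simp: Hom_def)

context category
begin

abbreviation "arr f \<equiv> f \<in> Arr C"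
abbreviation "src \<equiv> Src C"
abbreviation "tgt \<equiv> Tgt C"

lemma Src_Obj [simp]: "arr f \<Longrightarrow> src f \<in> Obj C"
  and Tgt_Obj [simp]: "arr f \<Longrightarrow> tgt f \<in> Obj C"
  by (auto intro: Src_closed Tgt_closed)

lemma Idn_simps [simp]:
  assumes "X \<in> Obj C"
  shows "Idn C X \<in> Arr C" "src (Idn C X) = X" "tgt (Idn C X) = X"
  using Idn_closed[OF assms] by (auto simp: mem_Hom)

lemma Cmp_simps [simp]:
  assumes "arr f" "arr g" "tgt f = src g"
  shows "g \<cdot> f \<in> Arr C" "src (g \<cdot> f) = src f" "tgt (g \<cdot> f) = tgt g"
  using Cmp_closed[of f "src f" "tgt f" g "tgt g"] assms by (auto simp: mem_Hom)

lemma Cmp_Idn_simp [simp]: "\<lbrakk>arr f; src f = X\<rbrakk> \<Longrightarrow> f \<cdot> Idn C X = f"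
  and Idn_Cmp_simp [simp]: "\<lbrakk>arr f; tgt f = X\<rbrakk> \<Longrightarrow> Idn C X \<cdot> f = f"
  using Cmp_Idn Idn_Cmp by auto

lemma Cmp_assoc_simp [simp]:
  "\<lbrakk>arr f; arr g; arr h; tgt f = src g; tgt g = src h\<rbrakk>
    \<Longrightarrow> (h \<cdot> g) \<cdot> f = h \<cdot> (g \<cdot> f)"
  using Cmp_assoc[of f "src f" "tgt f" g "tgt g" h "tgt h"] by (auto simp: mem_Hom)

text \<open>Simplification brackets composites to the right, so an equation \<open>h g = k\<close>
  no longer matches inside \<open>h (g f)\<close>; this form rewrites it there.\<close>

lemma Cmp_eq_Cmp:
  "\<lbrakk>h \<cdot> g = k; arr f; arr g; arr h; tgt f = src g; tgt g = src h\<rbrakk>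
    \<Longrightarrow> h \<cdot> (g \<cdot> f) = k \<cdot> f"
  by (metis Cmp_assoc_simp)

lemma inverse_arrowsD:
  assumes "inverse_arrows C f g"
  shows "arr f" "arr g" "src g = tgt f" "tgt g = src f"
    "g \<cdot> f = Idn C (src f)" "f \<cdot> g = Idn C (tgt f)"
  using assms by (auto simp: inverse_arrows_def mem_Hom)

lemma inverse_arrowsI:
  "\<lbrakk>arr f; arr g; src g = tgt f; tgt g = src f;
    g \<cdot> f = Idn C (src f); f \<cdot> g = Idn C (tgt f)\<rbrakk> \<Longrightarrow> inverse_arrows C f g"
  by (auto simp: inverse_arrows_def mem_Hom)

lemma is_isoI:
  "\<lbrakk>arr f; arr g; src g = tgt f; tgt g = src f;
    g \<cdot> f = Idn C (src f); f \<cdot> g = Idn C (tgt f)\<rbrakk> \<Longrightarrow> is_iso C f"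
  unfolding is_iso_def using inverse_arrowsI by blast

lemma is_isoE:
  assumes "is_iso C f"
  obtains g where "arr f" "arr g" "src g = tgt f" "tgt g = src f"
    "g \<cdot> f = Idn C (src f)" "f \<cdot> g = Idn C (tgt f)"
proof -
  from assms obtain g where "inverse_arrows C f g" by (auto simp: is_iso_def)
  from inverse_arrowsD[OF this] that show thesis by blast
qed

lemma inverse_arrows_is_iso:
  "inverse_arrows C f g \<Longrightarrow> is_iso C f" "inverse_arrows C f g \<Longrightarrow> is_iso C g"
  by (auto simp: is_iso_def inverse_arrows_def mem_Hom)

lemma inverse_arrows_unique:
  assumes "inverse_arrows C f g" "inverse_arrows C f h"
  shows "g = h"
proof -
  note G = inverse_arrowsD[OF assms(1)] and H = inverse_arrowsD[OF assms(2)]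
  have "g = g \<cdot> (f \<cdot> h)" using G H by simp
  also have "\<dots> = Idn C (src f) \<cdot> h" using G H by (intro Cmp_eq_Cmp) simp_all
  also have "\<dots> = h" using G H by simp
  finally show ?thesis .
qed

lemma inverse_arrows_Cmp:
  assumes "inverse_arrows C f f'" "inverse_arrows C g g'" "tgt f = src g"
  shows "inverse_arrows C (g \<cdot> f) (f' \<cdot> g')"
proof (rule inverse_arrowsI)
  note F = inverse_arrowsD[OF assms(1)] and G = inverse_arrowsD[OF assms(2)]
  show "(f' \<cdot> g') \<cdot> (g \<cdot> f) = Idn C (src (g \<cdot> f))"
    using F G assms(3) Cmp_eq_Cmp[of g' g "Idn C (src g)" f] by simp
  show "(g \<cdot> f) \<cdot> (f' \<cdot> g') = Idn C (tgt (g \<cdot> f))"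
    using F G assms(3) Cmp_eq_Cmp[of f f' "Idn C (tgt f)" g'] by simp
qed (use inverse_arrowsD[OF assms(1)] inverse_arrowsD[OF assms(2)] assms(3) in simp_all)

lemma is_iso_Cmp: "\<lbrakk>is_iso C f; is_iso C g; tgt f = src g\<rbrakk> \<Longrightarrow> is_iso C (g \<cdot> f)"
  unfolding is_iso_def using inverse_arrows_Cmp by blast

lemma is_iso_Idn: "X \<in> Obj C \<Longrightarrow> is_iso C (Idn C X)"
  by (rule is_isoI[where g = "Idn C X"]) simp_all

lemma iso_cancel_left:
  assumes "is_iso C f" "arr g" "arr h" "tgt g = src f" "tgt h = src f" "f \<cdot> g = f \<cdot> h"
  shows "g = h"
proof -
  obtain k where k: "arr f" "arr k" "src k = tgt f" "tgt k = src f"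
    "k \<cdot> f = Idn C (src f)"
    using assms(1) is_isoE by metis
  have "k \<cdot> (f \<cdot> g) = k \<cdot> (f \<cdot> h)" using assms by simp
  then show ?thesis using k assms(2-5) by (simp add: Cmp_eq_Cmp[OF k(5)])
qed

lemma iso_cancel_right:
  assumes "is_iso C f" "arr g" "arr h" "src g = tgt f" "src h = tgt f" "g \<cdot> f = h \<cdot> f"
  shows "g = h"
proof -
  obtain k where k: "arr f" "arr k" "src k = tgt f" "tgt k = src f"
    "f \<cdot> k = Idn C (tgt f)"
    using assms(1) is_isoE by metis
  have "(g \<cdot> f) \<cdot> k = (h \<cdot> f) \<cdot> k" using assms by simp
  then show ?thesis using k assms(2-5) by simp
qed

lemma is_iso_Cmp_cancel_left:
  assumes "is_iso C (g \<cdot> f)" "is_iso C g" "arr f" "tgt f = src g"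
  shows "is_iso C f"
proof -
  obtain k where k: "inverse_arrows C g k" using assms(2) by (auto simp: is_iso_def)
  note K = inverse_arrowsD[OF k]
  have "is_iso C k" using k by (rule inverse_arrows_is_iso)
  then have "is_iso C (k \<cdot> (g \<cdot> f))" using is_iso_Cmp assms K by simp
  then show ?thesis using K assms by (simp add: Cmp_eq_Cmp[OF K(5)])
qed

lemma is_iso_Cmp_cancel_right:
  assumes "is_iso C (g \<cdot> f)" "is_iso C f" "arr g" "tgt f = src g"
  shows "is_iso C g"
proof -
  obtain k where k: "inverse_arrows C f k" using assms(2) by (auto simp: is_iso_def)
  note K = inverse_arrowsD[OF k]
  have "is_iso C k" using k by (rule inverse_arrows_is_iso)
  then have "is_iso C ((g \<cdot> f) \<cdot> k)" using is_iso_Cmp[of k "g \<cdot> f"] assms K by simp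
  then show ?thesis using K assms by simp
qed

end

section \<open>Functors, natural isomorphisms and quasi-inverses\<close>

lemma is_functorD:
  assumes "is_functor C D F"
  shows "category C" "category D" "X \<in> Obj C \<Longrightarrow> OMap F X \<in> Obj D"
    "f \<in> Arr C \<Longrightarrow> AMap F f \<in> Arr D"
    "f \<in> Arr C \<Longrightarrow> Src D (AMap F f) = OMap F (Src C f)"
    "f \<in> Arr C \<Longrightarrow> Tgt D (AMap F f) = OMap F (Tgt C f)"
    "X \<in> Obj C \<Longrightarrow> AMap F (Idn C X) = Idn D (OMap F X)"
    "\<lbrakk>f \<in> Arr C; g \<in> Arr C; Tgt C f = Src C g\<rbrakk> \<Longrightarrow> AMap F (g \<cdot>\<^bsub>C\<^esub> f) = AMap F g \<cdot>\<^bsub>D\<^esub> AMap F f"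
  using assms by (auto simp: is_functor_def mem_Hom)

lemma is_functorI:
  assumes "category C" "category D" "\<And>X. X \<in> Obj C \<Longrightarrow> OMap F X \<in> Obj D"
    "\<And>f. f \<in> Arr C \<Longrightarrow> AMap F f \<in> Arr D"
    "\<And>f. f \<in> Arr C \<Longrightarrow> Src D (AMap F f) = OMap F (Src C f)"
    "\<And>f. f \<in> Arr C \<Longrightarrow> Tgt D (AMap F f) = OMap F (Tgt C f)"
    "\<And>X. X \<in> Obj C \<Longrightarrow> AMap F (Idn C X) = Idn D (OMap F X)"
    "\<And>f g. \<lbrakk>f \<in> Arr C; g \<in> Arr C; Tgt C f = Src C g\<rbrakk>
        \<Longrightarrow> AMap F (g \<cdot>\<^bsub>C\<^esub> f) = AMap F g \<cdot>\<^bsub>D\<^esub> AMap F f"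
  shows "is_functor C D F"
  using assms by (auto simp: is_functor_def mem_Hom)

lemma functor_inverse_arrows:
  assumes F: "is_functor C D F" and fg: "inverse_arrows C f g"
  shows "inverse_arrows D (AMap F f) (AMap F g)"
proof -
  interpret C: category C by (rule is_functorD(1)[OF F])
  interpret D: category D by (rule is_functorD(2)[OF F])
  note fg = C.inverse_arrowsD[OF fg] and F = is_functorD(3-)[OF F]
  show ?thesis
    using fg F by (intro D.inverse_arrowsI) (simp_all flip: F(6))
qed

lemma functor_is_iso: "\<lbrakk>is_functor C D F; is_iso C f\<rbrakk> \<Longrightarrow> is_iso D (AMap F f)"
  unfolding is_iso_def by (meson functor_inverse_arrows)

lemma is_functor_id_ftr: "category C \<Longrightarrow> is_functor C C id_ftr"
  by (rule is_functorI) (simp_all add: id_ftr_def)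

lemma is_functor_comp_ftr:
  assumes "is_functor C D F" "is_functor D B G"
  shows "is_functor C B (comp_ftr G F)"
  using is_functorD[OF assms(1)] is_functorD[OF assms(2)]
  by (intro is_functorI) (simp_all add: comp_ftr_def)

lemma comp_ftr_simps [simp]:
  "OMap (comp_ftr G F) X = OMap G (OMap F X)" "AMap (comp_ftr G F) f = AMap G (AMap F f)"
  by (simp_all add: comp_ftr_def)

lemma id_ftr_simps [simp]: "OMap id_ftr X = X" "AMap id_ftr f = f"
  by (simp_all add: id_ftr_def)

lemma natural_isoD:
  assumes "natural_iso C D F G \<eta>"
  shows "is_functor C D F" "is_functor C D G"
    "X \<in> Obj C \<Longrightarrow> \<eta> X \<in> Arr D" "X \<in> Obj C \<Longrightarrow> Src D (\<eta> X) = OMap F X"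
    "X \<in> Obj C \<Longrightarrow> Tgt D (\<eta> X) = OMap G X" "X \<in> Obj C \<Longrightarrow> is_iso D (\<eta> X)"
    "f \<in> Arr C \<Longrightarrow> \<eta> (Tgt C f) \<cdot>\<^bsub>D\<^esub> AMap F f = AMap G f \<cdot>\<^bsub>D\<^esub> \<eta> (Src C f)"
  using assms by (auto simp: natural_iso_def mem_Hom)

lemma natural_isoI:
  assumes "is_functor C D F" "is_functor C D G"
    "\<And>X. X \<in> Obj C \<Longrightarrow> \<eta> X \<in> Arr D" "\<And>X. X \<in> Obj C \<Longrightarrow> Src D (\<eta> X) = OMap F X"
    "\<And>X. X \<in> Obj C \<Longrightarrow> Tgt D (\<eta> X) = OMap G X" "\<And>X. X \<in> Obj C \<Longrightarrow> is_iso D (\<eta> X)"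
    "\<And>f. f \<in> Arr C \<Longrightarrow> \<eta> (Tgt C f) \<cdot>\<^bsub>D\<^esub> AMap F f = AMap G f \<cdot>\<^bsub>D\<^esub> \<eta> (Src C f)"
  shows "natural_iso C D F G \<eta>"
  using assms by (auto simp: natural_iso_def mem_Hom)

text \<open>The quasi-inverse on arrows is the preimage of the conjugate \<open>e' h e\<close>, the
  unit is the preimage of \<open>e'\<close>, and the counit is \<open>e\<close>. Faithfulness
  reduces each equation in \<open>C\<close> to its image under \<open>F\<close>.\<close>

lemma is_equivalenceI:
  assumes F: "is_functor C D F"
    and faithful: "\<And>f g. \<lbrakk>f \<in> Arr C; g \<in> Arr C; Src C f = Src C g; Tgt C f = Tgt C g;
        AMap F f = AMap F g\<rbrakk> \<Longrightarrow> f = g"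
    and full: "\<And>X Y h. \<lbrakk>X \<in> Obj C; Y \<in> Obj C; h \<in> Hom D (OMap F X) (OMap F Y)\<rbrakk>
        \<Longrightarrow> \<exists>f\<in>Hom C X Y. AMap F f = h"
    and surj: "\<And>Y. Y \<in> Obj D \<Longrightarrow> \<exists>X\<in>Obj C. \<exists>e\<in>Hom D (OMap F X) Y. is_iso D e"
  shows "is_equivalence C D F"
proof -
  interpret C: category C by (rule is_functorD(1)[OF F])
  interpret D: category D by (rule is_functorD(2)[OF F])
  note F' = is_functorD(3-)[OF F]
  have "\<exists>X e e'. X \<in> Obj C \<and> Src D e = OMap F X \<and> Tgt D e = Y \<and> inverse_arrows D e e'"
    if "Y \<in> Obj D" for Y
    using surj[OF that] unfolding is_iso_def by (metis mem_Hom)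
  then obtain G e e' where G: "\<And>Y. Y \<in> Obj D \<Longrightarrow> G Y \<in> Obj C \<and> Src D (e Y) = OMap F (G Y) \<and>
      Tgt D (e Y) = Y \<and> inverse_arrows D (e Y) (e' Y)"
    by metis
  have e: "G Y \<in> Obj C" "e Y \<in> Arr D" "Src D (e Y) = OMap F (G Y)" "Tgt D (e Y) = Y"
    "e' Y \<in> Arr D" "Src D (e' Y) = Y" "Tgt D (e' Y) = OMap F (G Y)"
    "e' Y \<cdot>\<^bsub>D\<^esub> e Y = Idn D (OMap F (G Y))" "e Y \<cdot>\<^bsub>D\<^esub> e' Y = Idn D Y"
    if "Y \<in> Obj D" for Y
    using G[OF that] D.inverse_arrowsD[of "e Y" "e' Y"] by auto
  have ec: "e' Y \<cdot>\<^bsub>D\<^esub> (e Y \<cdot>\<^bsub>D\<^esub> f) = f" "e Y \<cdot>\<^bsub>D\<^esub> (e' Y \<cdot>\<^bsub>D\<^esub> g) = g"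
    if "f \<in> Arr D" "Tgt D f = OMap F (G Y)" "g \<in> Arr D" "Tgt D g = Y" "Y \<in> Obj D" for Y f g
    using that e[of Y] D.Cmp_eq_Cmp[OF e(8)] D.Cmp_eq_Cmp[OF e(9)] by simp_all
  have "\<exists>f. f \<in> Arr C \<and> Src C f = G (Src D h) \<and> Tgt C f = G (Tgt D h) \<and>
      AMap F f = e' (Tgt D h) \<cdot>\<^bsub>D\<^esub> (h \<cdot>\<^bsub>D\<^esub> e (Src D h))" if "h \<in> Arr D" for h
    using full[of "G (Src D h)" "G (Tgt D h)" "e' (Tgt D h) \<cdot>\<^bsub>D\<^esub> (h \<cdot>\<^bsub>D\<^esub> e (Src D h))"] that
      e[of "Src D h"] e[of "Tgt D h"] by (auto simp: mem_Hom)
  then obtain g where g: "\<And>h. h \<in> Arr D \<Longrightarrow> g h \<in> Arr C" "\<And>h. h \<in> Arr D \<Longrightarrow> Src C (g h) = G (Src D h)"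
     "\<And>h. h \<in> Arr D \<Longrightarrow> Tgt C (g h) = G (Tgt D h)"
      "\<And>h. h \<in> Arr D \<Longrightarrow> AMap F (g h) = e' (Tgt D h) \<cdot>\<^bsub>D\<^esub> (h \<cdot>\<^bsub>D\<^esub> e (Src D h))"
    by metis
  have "\<exists>f. f \<in> Arr C \<and> Src C f = X \<and> Tgt C f = G (OMap F X) \<and> AMap F f = e' (OMap F X)"
    if "X \<in> Obj C" for X
    using full[of X "G (OMap F X)" "e' (OMap F X)"] that e[of "OMap F X"] F' by (auto simp: mem_Hom)
  then obtain \<eta> where \<eta>: "\<And>X. X \<in> Obj C \<Longrightarrow> \<eta> X \<in> Arr C" "\<And>X. X \<in> Obj C \<Longrightarrow> Src C (\<eta> X) = X"
      "\<And>X. X \<in> Obj C \<Longrightarrow> Tgt C (\<eta> X) = G (OMap F X)" "\<And>X. X \<in> Obj C \<Longrightarrow> AMap F (\<eta> X) = e' (OMap F X)"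
    by metis
  have "\<exists>f. f \<in> Arr C \<and> Src C f = G (OMap F X) \<and> Tgt C f = X \<and> AMap F f = e (OMap F X)"
    if "X \<in> Obj C" for X
    using full[of "G (OMap F X)" X "e (OMap F X)"] that e[of "OMap F X"] F' by (auto simp: mem_Hom)
  then obtain \<eta>' where \<eta>': "\<And>X. X \<in> Obj C \<Longrightarrow> \<eta>' X \<in> Arr C" "\<And>X. X \<in> Obj C \<Longrightarrow> Src C (\<eta>' X) = G (OMap F X)"
      "\<And>X. X \<in> Obj C \<Longrightarrow> Tgt C (\<eta>' X) = X" "\<And>X. X \<in> Obj C \<Longrightarrow> AMap F (\<eta>' X) = e (OMap F X)"
    by metis
  define GG where "GG = \<lparr>OMap = G, AMap = g\<rparr>"
  have GF: "is_functor D C GG"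
  proof (rule is_functorI)
    fix X assume X: "X \<in> Obj D"
    show "AMap GG (Idn D X) = Idn C (OMap GG X)"
      by (rule faithful) (use X e[OF X] in \<open>auto simp: GG_def g F'\<close>)
  next
    fix f h assume fh: "f \<in> Arr D" "h \<in> Arr D" "Tgt D f = Src D h"
    show "AMap GG (h \<cdot>\<^bsub>D\<^esub> f) = AMap GG h \<cdot>\<^bsub>C\<^esub> AMap GG f"
    proof (rule faithful)
      show "AMap F (AMap GG (h \<cdot>\<^bsub>D\<^esub> f)) = AMap F (AMap GG h \<cdot>\<^bsub>C\<^esub> AMap GG f)"
        using fh e[of "Src D h"] e[of "Tgt D h"] e[of "Src D f"] by (simp add: GG_def g F' ec)
    qed (use fh in \<open>auto simp: GG_def g F'\<close>)
  qed (use C.category_axioms D.category_axioms in \<open>auto simp: GG_def g e\<close>)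
  have "natural_iso C C id_ftr (comp_ftr GG F) \<eta>"
  proof (rule natural_isoI)
    fix X assume X: "X \<in> Obj C"
    show "is_iso C (\<eta> X)"
      by (rule C.is_isoI[where g = "\<eta>' X"]; (rule faithful)?)
        (use X F' e[of "OMap F X"] in \<open>auto simp: \<eta> \<eta>' F'\<close>)
  next
    fix f assume f: "f \<in> Arr C"
    show "\<eta> (Tgt C f) \<cdot>\<^bsub>C\<^esub> AMap id_ftr f = AMap (comp_ftr GG F) f \<cdot>\<^bsub>C\<^esub> \<eta> (Src C f)"
      by (rule faithful) (use f F' e[of "OMap F (Src C f)"]  e[of "OMap F (Tgt C f)"]
          in \<open>auto simp: \<eta> F' GG_def g\<close>)
  qed (use F' in \<open>auto simp: is_functor_id_ftr C.category_axioms is_functor_comp_ftr[OF F GF] \<eta>, auto simp: GG_def\<close>)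
  moreover have "natural_iso D D (comp_ftr F GG) id_ftr e"
  proof (rule natural_isoI)
    fix Y assume Y: "Y \<in> Obj D"
    show "is_iso D (e Y)" using G[OF Y] D.inverse_arrows_is_iso by blast
  next
    fix f assume f: "f \<in> Arr D"
    show "e (Tgt D f) \<cdot>\<^bsub>D\<^esub> AMap (comp_ftr F GG) f = AMap id_ftr f \<cdot>\<^bsub>D\<^esub> e (Src D f)"
      using f e[of "Src D f"] e[of "Tgt D f"] by (simp add: GG_def g ec)
  qed (use e in \<open>auto simp: is_functor_id_ftr D.category_axioms is_functor_comp_ftr[OF GF F], auto simp: GG_def\<close>)
  ultimately show ?thesis
    using F GF unfolding is_equivalence_def quasi_inverse_def by blast
qed

text \<open>Unit and counit of a \<open>quasi_inverse\<close> are unrelated. Their triangle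
  composite \<open>\<theta>\<close> is a natural automorphism of \<open>F\<close>; putting its
  inverse in front of the counit repairs the identity and leaves the unit alone.\<close>

lemma quasi_inverse_triangle:
  assumes q: "quasi_inverse C D F G \<eta> \<epsilon>"
  obtains \<epsilon>' where "natural_iso D D (comp_ftr F G) id_ftr \<epsilon>'"
    "\<And>X. X \<in> Obj C \<Longrightarrow> \<epsilon>' (OMap F X) \<cdot>\<^bsub>D\<^esub> AMap F (\<eta> X) = Idn D (OMap F X)"
proof -
  have F: "is_functor C D F" and G: "is_functor D C G" and \<eta>: "natural_iso C C id_ftr (comp_ftr G F) \<eta>"
    and \<epsilon>: "natural_iso D D (comp_ftr F G) id_ftr \<epsilon>"
    using q by (auto simp: quasi_inverse_def)
  interpret C: category C by (rule is_functorD(1)[OF F])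
  interpret D: category D by (rule is_functorD(2)[OF F])
  note F' = is_functorD(3-)[OF F] and G' = is_functorD(3-)[OF G]
    and \<eta>' = natural_isoD(3-)[OF \<eta>, simplified] and \<epsilon>' = natural_isoD(3-)[OF \<epsilon>, simplified]
  define \<theta> where "\<theta> X = \<epsilon> (OMap F X) \<cdot>\<^bsub>D\<^esub> AMap F (\<eta> X)" for X
  have \<theta>: "\<theta> X \<in> Arr D" "Src D (\<theta> X) = OMap F X" "Tgt D (\<theta> X) = OMap F X" "is_iso D (\<theta> X)"
    if "X \<in> Obj C" for X
    using that unfolding \<theta>_def by (simp_all add: F' G' \<eta>' \<epsilon>' D.is_iso_Cmp functor_is_iso[OF F])
  have \<theta>_nat: "\<theta> (Tgt C f) \<cdot>\<^bsub>D\<^esub> AMap F f = AMap F f \<cdot>\<^bsub>D\<^esub> \<theta> (Src C f)" if f: "f \<in> Arr C" for f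
  proof -
    have "\<theta> (Tgt C f) \<cdot>\<^bsub>D\<^esub> AMap F f = \<epsilon> (OMap F (Tgt C f)) \<cdot>\<^bsub>D\<^esub> AMap F (\<eta> (Tgt C f) \<cdot>\<^bsub>C\<^esub> f)"
      using f by (simp add: \<theta>_def F' G' \<eta>' \<epsilon>' del: \<eta>'(5))
    also have "\<dots> = (\<epsilon> (OMap F (Tgt C f)) \<cdot>\<^bsub>D\<^esub> AMap F (AMap G (AMap F f))) \<cdot>\<^bsub>D\<^esub> AMap F (\<eta> (Src C f))"
      using f by (simp add: F' G' \<eta>' \<epsilon>'(1-4))
    also have "\<dots> = AMap F f \<cdot>\<^bsub>D\<^esub> \<theta> (Src C f)"
      using f \<epsilon>'(5)[of "AMap F f"] by (simp add: \<theta>_def F' G' \<eta>'(1-4) \<epsilon>'(1-4) del: D.Cmp_assoc_simp)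
        (simp add: F' G' \<eta>'(1-4) \<epsilon>'(1-4))
    finally show ?thesis .
  qed
  have "\<exists>k. inverse_arrows D (\<theta> X) k" if "X \<in> Obj C" for X
    using \<theta>(4)[OF that] by (auto simp: is_iso_def)
  then obtain \<kappa> where "\<And>X. X \<in> Obj C \<Longrightarrow> inverse_arrows D (\<theta> X) (\<kappa> X)" by metis
  note \<kappa>0 = D.inverse_arrowsD[OF this] D.inverse_arrows_is_iso(2)[OF this]
  have \<kappa>: "\<kappa> X \<in> Arr D" "Src D (\<kappa> X) = OMap F X" "Tgt D (\<kappa> X) = OMap F X" "is_iso D (\<kappa> X)"
     "\<theta> X \<cdot>\<^bsub>D\<^esub> \<kappa> X = Idn D (OMap F X)" "\<kappa> X \<cdot>\<^bsub>D\<^esub> \<theta> X = Idn D (OMap F X)" if "X \<in> Obj C" for X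
    using \<kappa>0[OF that] \<theta>[OF that] by auto
  have \<kappa>_nat: "\<kappa> (Tgt C f) \<cdot>\<^bsub>D\<^esub> AMap F f = AMap F f \<cdot>\<^bsub>D\<^esub> \<kappa> (Src C f)" if f: "f \<in> Arr C" for f
  proof (rule D.iso_cancel_left[OF \<theta>(4)[of "Tgt C f"]])
    have "\<theta> (Tgt C f) \<cdot>\<^bsub>D\<^esub> (\<kappa> (Tgt C f) \<cdot>\<^bsub>D\<^esub> AMap F f) = AMap F f"
      using f \<theta> by (subst D.Cmp_eq_Cmp[OF \<kappa>(5)]) (simp_all add: F' \<kappa>)
    also have "\<dots> = AMap F f \<cdot>\<^bsub>D\<^esub> (\<theta> (Src C f) \<cdot>\<^bsub>D\<^esub> \<kappa> (Src C f))"
      using f by (simp add: F' \<kappa>)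
    also have "\<dots> = \<theta> (Tgt C f) \<cdot>\<^bsub>D\<^esub> (AMap F f \<cdot>\<^bsub>D\<^esub> \<kappa> (Src C f))"
      using f D.Cmp_eq_Cmp[OF \<theta>_nat[OF f], of "\<kappa> (Src C f)"] by (simp add: F' \<kappa>(1-3) \<theta>)
    finally show "\<theta> (Tgt C f) \<cdot>\<^bsub>D\<^esub> (\<kappa> (Tgt C f) \<cdot>\<^bsub>D\<^esub> AMap F f)
      = \<theta> (Tgt C f) \<cdot>\<^bsub>D\<^esub> (AMap F f \<cdot>\<^bsub>D\<^esub> \<kappa> (Src C f))" .
  qed (use f in \<open>simp_all add: F' \<kappa> \<theta>\<close>)
  \<comment> \<open>The correction is taken at \<open>G Y\<close>, so that naturality of
    \<open>\<kappa>\<close> at the arrow \<open>\<eta> X\<close> can move it past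
    \<open>F (\<eta> X)\<close> and cancel \<open>\<theta> X\<close>.\<close>
  define \<epsilon>2 where "\<epsilon>2 Y = \<epsilon> Y \<cdot>\<^bsub>D\<^esub> \<kappa> (OMap G Y)" for Y
  show thesis
  proof (rule that)
    show "natural_iso D D (comp_ftr F G) id_ftr \<epsilon>2"
    proof (rule natural_isoI)
      fix f assume f: "f \<in> Arr D"
      have "\<epsilon>2 (Tgt D f) \<cdot>\<^bsub>D\<^esub> AMap F (AMap G f)
          = (\<epsilon> (Tgt D f) \<cdot>\<^bsub>D\<^esub> AMap F (AMap G f)) \<cdot>\<^bsub>D\<^esub> \<kappa> (OMap G (Src D f))"
        using f \<kappa>_nat[of "AMap G f"] by (simp add: \<epsilon>2_def F' G' \<kappa> \<epsilon>'(1-4))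
      also have "\<dots> = f \<cdot>\<^bsub>D\<^esub> \<epsilon>2 (Src D f)"
        using f by (simp add: \<epsilon>'(5) del: D.Cmp_assoc_simp) (simp add: \<epsilon>2_def F' G' \<kappa> \<epsilon>'(1-4))
      finally show "\<epsilon>2 (Tgt D f) \<cdot>\<^bsub>D\<^esub> AMap (comp_ftr F G) f = AMap id_ftr f \<cdot>\<^bsub>D\<^esub> \<epsilon>2 (Src D f)"
        by simp
    qed (simp_all add: \<epsilon>2_def is_functor_id_ftr D.category_axioms is_functor_comp_ftr[OF G F] F' G' \<kappa> \<epsilon>' D.is_iso_Cmp)
  next
    fix X assume X: "X \<in> Obj C"
    have "\<epsilon>2 (OMap F X) \<cdot>\<^bsub>D\<^esub> AMap F (\<eta> X)
      = \<epsilon> (OMap F X) \<cdot>\<^bsub>D\<^esub> (AMap F (\<eta> X) \<cdot>\<^bsub>D\<^esub> \<kappa> X)"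
      using X \<kappa>_nat[of "\<eta> X"] by (simp add: \<epsilon>2_def F' G' \<kappa>(1-4) \<epsilon>' \<eta>')
    also have "\<dots> = \<theta> X \<cdot>\<^bsub>D\<^esub> \<kappa> X" using X by (simp add: \<theta>_def F' G' \<kappa>(1-4) \<epsilon>' \<eta>')
    also have "\<dots> = Idn D (OMap F X)" using X by (simp add: \<kappa>)
    finally show "\<epsilon>2 (OMap F X) \<cdot>\<^bsub>D\<^esub> AMap F (\<eta> X) = Idn D (OMap F X)" .
  qed
qed

text \<open>\<open>\<psi>\<close> at \<open>\<Sigma> X\<close> followed by \<open>T \<Phi>\<close>
  of the counit gives \<open>\<Phi> \<Sigma> -> T \<Phi> \<Omega> \<Sigma> -> T \<Phi>\<close>. The
  second conclusion is the one for triangles: \<open>\<Sigma> d\<close> after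
  \<open>\<eta> Z\<close> is the last morphism of the triangle with boundary \<open>d\<close>, and
  its image is expressed without \<open>\<Sigma>\<close>.\<close>

lemma quasi_inverse_shift_comparison:
  assumes q: "quasi_inverse H H \<Omega> \<Sigma> \<eta> \<epsilon>" and \<Phi>: "is_functor H S \<Phi>" and T: "is_functor S S T"
    and \<psi>: "natural_iso H S \<Phi> (comp_ftr T (comp_ftr \<Phi> \<Omega>)) \<psi>"
  obtains \<phi> where "natural_iso H S (comp_ftr \<Phi> \<Sigma>) (comp_ftr T \<Phi>) \<phi>"
    "\<And>Z d. \<lbrakk>Z \<in> Obj H; d \<in> Arr H; Src H d = OMap \<Omega> Z\<rbrakk> \<Longrightarrow>
      \<phi> (Tgt H d) \<cdot>\<^bsub>S\<^esub> AMap \<Phi> (AMap \<Sigma> d \<cdot>\<^bsub>H\<^esub> \<eta> Z) = AMap T (AMap \<Phi> d) \<cdot>\<^bsub>S\<^esub> \<psi> Z"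
proof -
  \<comment> \<open>From here on \<open>\<epsilon>\<close> is the corrected counit, which shadows
    the given one.\<close>
  obtain \<epsilon> where \<epsilon>: "natural_iso H H (comp_ftr \<Omega> \<Sigma>) id_ftr \<epsilon>" and
    tri: "\<And>X. X \<in> Obj H \<Longrightarrow> \<epsilon> (OMap \<Omega> X) \<cdot>\<^bsub>H\<^esub> AMap \<Omega> (\<eta> X) = Idn H (OMap \<Omega> X)"
    using quasi_inverse_triangle[OF q] by blast
  have \<Omega>: "is_functor H H \<Omega>" and \<Sigma>: "is_functor H H \<Sigma>" and \<eta>: "natural_iso H H id_ftr (comp_ftr \<Sigma> \<Omega>) \<eta>"
    using q by (auto simp: quasi_inverse_def)
  interpret H: category H by (rule is_functorD(1)[OF \<Phi>])
  interpret S: category S by (rule is_functorD(2)[OF \<Phi>])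
  note f = is_functorD(3-)[OF \<Omega>] is_functorD(3-)[OF \<Sigma>] is_functorD(3-)[OF \<Phi>] is_functorD(3-)[OF T]
  note \<eta>' = natural_isoD(3-)[OF \<eta>, simplified] and \<epsilon>' = natural_isoD(3-)[OF \<epsilon>, simplified]
    and \<psi>' = natural_isoD(3-)[OF \<psi>, simplified]
  define \<phi> where "\<phi> X = AMap T (AMap \<Phi> (\<epsilon> X)) \<cdot>\<^bsub>S\<^esub> \<psi> (OMap \<Sigma> X)" for X
  have nat: "\<phi> (Tgt H d) \<cdot>\<^bsub>S\<^esub> AMap \<Phi> (AMap \<Sigma> d) = AMap T (AMap \<Phi> d) \<cdot>\<^bsub>S\<^esub> \<phi> (Src H d)"
    if d: "d \<in> Arr H" for d
  proof -
    have "\<phi> (Tgt H d) \<cdot>\<^bsub>S\<^esub> AMap \<Phi> (AMap \<Sigma> d)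
       = AMap T (AMap \<Phi> (\<epsilon> (Tgt H d) \<cdot>\<^bsub>H\<^esub> AMap \<Omega> (AMap \<Sigma> d))) \<cdot>\<^bsub>S\<^esub> \<psi> (OMap \<Sigma> (Src H d))"
      using d \<psi>'(5)[of "AMap \<Sigma> d"] by (simp add: \<phi>_def f \<psi>'(1-4) \<epsilon>'(1-4))
    also have "\<dots> = AMap T (AMap \<Phi> d) \<cdot>\<^bsub>S\<^esub> \<phi> (Src H d)"
      using d by (simp add: \<epsilon>') (simp add: f \<phi>_def \<psi>' \<epsilon>'(1-4))
    finally show ?thesis .
  qed
  show thesis
  proof (rule that)
    show "natural_iso H S (comp_ftr \<Phi> \<Sigma>) (comp_ftr T \<Phi>) \<phi>"
    proof (rule natural_isoI)
      fix X assume "X \<in> Obj H"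
      then show "is_iso S (\<phi> X)" unfolding \<phi>_def
        by (intro S.is_iso_Cmp functor_is_iso[OF T] functor_is_iso[OF \<Phi>]) (simp_all add: f \<psi>' \<epsilon>')
    qed (simp_all add: is_functor_comp_ftr[OF \<Sigma> \<Phi>] is_functor_comp_ftr[OF \<Phi> T] nat,
        simp_all add: \<phi>_def f \<psi>' \<epsilon>')
  next
    fix Z d assume Z: "Z \<in> Obj H" "d \<in> Arr H" "Src H d = OMap \<Omega> Z"
    have "\<phi> (Tgt H d) \<cdot>\<^bsub>S\<^esub> AMap \<Phi> (AMap \<Sigma> d \<cdot>\<^bsub>H\<^esub> \<eta> Z)
      = (\<phi> (Tgt H d) \<cdot>\<^bsub>S\<^esub> AMap \<Phi> (AMap \<Sigma> d)) \<cdot>\<^bsub>S\<^esub> AMap \<Phi> (\<eta> Z)"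
      using Z by (simp add: \<phi>_def f \<psi>' \<epsilon>' \<eta>')
    \<comment> \<open>Naturality of \<open>\<psi>\<close> at \<open>\<eta> Z\<close> exposes the
      triangle composite of unit and counit, which is an identity.\<close>
    also have "\<dots> = AMap T (AMap \<Phi> d) \<cdot>\<^bsub>S\<^esub> (AMap T (AMap \<Phi> (\<epsilon> (OMap \<Omega> Z) \<cdot>\<^bsub>H\<^esub> AMap \<Omega> (\<eta> Z))) \<cdot>\<^bsub>S\<^esub> \<psi> Z)"
      using Z \<psi>'(5)[of "\<eta> Z"] by (simp only: nat) (simp add: \<phi>_def f \<psi>'(1-4) \<epsilon>'(1-4) \<eta>')
    also have "\<dots> = AMap T (AMap \<Phi> d) \<cdot>\<^bsub>S\<^esub> \<psi> Z"
      using Z by (simp add: tri) (simp add: f \<psi>'(1-4))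
    finally show "\<phi> (Tgt H d) \<cdot>\<^bsub>S\<^esub> AMap \<Phi> (AMap \<Sigma> d \<cdot>\<^bsub>H\<^esub> \<eta> Z) = AMap T (AMap \<Phi> d) \<cdot>\<^bsub>S\<^esub> \<psi> Z" .
  qed
qed

text \<open>\<open>quillen_tricat\<close> and \<open>happel_tricat\<close> add shift and triangles
  to a category by \<open>cat.extend\<close>; these rules and the next ones reduce statements about
  them to the underlying categories.\<close>

lemma extend_simps [simp]:
  "Obj (cat.extend C r) = Obj C" "Arr (cat.extend C r) = Arr C" "Src (cat.extend C r) = Src C"
  "Tgt (cat.extend C r) = Tgt C" "Idn (cat.extend C r) = Idn C" "Cmp (cat.extend C r) = Cmp C"
  by (simp_all add: cat.defs)

lemma Hom_extend [simp]: "Hom (cat.extend C r) = Hom C"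
  by (intro ext) (simp add: Hom_def)

lemma category_extend [simp]: "category (cat.extend C r) \<longleftrightarrow> category C"
  by (simp add: category_def)

lemma is_iso_extend [simp]: "Defs.is_iso (cat.extend C r) = Defs.is_iso C"
  by (intro ext) (simp add: Defs.is_iso_def inverse_arrows_def)

lemma is_functor_extend [simp]:
  "is_functor (cat.extend C r) D F \<longleftrightarrow> is_functor C D F"
  "is_functor D (cat.extend C r) G \<longleftrightarrow> is_functor D C G"
  by (simp_all add: is_functor_def)

lemma natural_iso_extend [simp]:
  "natural_iso (cat.extend C r) D F G \<eta> \<longleftrightarrow> natural_iso C D F G \<eta>"
  "natural_iso D (cat.extend C r) F' G' \<eta>' \<longleftrightarrow> natural_iso D C F' G' \<eta>'"
  by (simp_all add: natural_iso_def)

lemma is_equivalence_extend [simp]: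
  "is_equivalence (cat.extend C r) (cat.extend D t) F \<longleftrightarrow> is_equivalence C D F"
  by (simp add: is_equivalence_def quasi_inverse_def)

text \<open>These conditions make the unions in \<open>quotient_cat\<close> collapse to single
  classes. Two instances occur: stable equality on the arrows of the Frobenius category, and the
  Gabriel-Zisman relation on zigzags.\<close>

locale congruence = category C
  for C :: "('o, 'm, 'z) cat_scheme" (structure) and R :: "('m \<times> 'm) set" +
  assumes equiv: "equiv (Arr C) R"
    and parallel: "(f, g) \<in> R \<Longrightarrow> Src C f = Src C g \<and> Tgt C f = Tgt C g"
    and Cmp_cong: "\<lbrakk>(f, f') \<in> R; (g, g') \<in> R; Tgt C f = Src C g\<rbrakk> \<Longrightarrow> (g \<cdot> f, g' \<cdot> f') \<in> R"
begin

abbreviation "Q \<equiv> quotient_cat C R"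

lemma R_refl: "arr f \<Longrightarrow> (f, f) \<in> R"
  using equiv by (auto simp: equiv_def refl_on_def)

lemma class_eq_iff: "\<lbrakk>arr f; arr g\<rbrakk> \<Longrightarrow> R `` {f} = R `` {g} \<longleftrightarrow> (f, g) \<in> R"
  using eq_equiv_class_iff[OF equiv] by blast

lemma quotient_Obj [simp]: "Obj Q = Obj C"
  by (simp add: quotient_cat_def)

lemma quotient_Arr: "\<alpha> \<in> Arr Q \<longleftrightarrow> (\<exists>f\<in>Arr C. \<alpha> = R `` {f})"
  by (auto simp: quotient_cat_def quotient_def)

lemma class_Arr [simp]: "arr f \<Longrightarrow> R `` {f} \<in> Arr Q"
  by (auto simp: quotient_Arr)

lemma quotient_Src [simp]: "arr f \<Longrightarrow> Src Q (R `` {f}) = src f"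
  and quotient_Tgt [simp]: "arr f \<Longrightarrow> Tgt Q (R `` {f}) = tgt f"
proof -
  assume f: "arr f"
  have "src ` (R `` {f}) = {src f}" "tgt ` (R `` {f}) = {tgt f}"
    using R_refl[OF f] by (auto dest: parallel intro!: image_eqI)
  then show "Src Q (R `` {f}) = src f" "Tgt Q (R `` {f}) = tgt f"
    by (simp_all add: quotient_cat_def)
qed

lemma quotient_Idn: "Idn Q X = R `` {Idn C X}"
  by (simp add: quotient_cat_def)

lemma quotient_Cmp:
  assumes "arr f" "arr g" "tgt f = src g"
  shows "R `` {g} \<cdot>\<^bsub>Q\<^esub> R `` {f} = R `` {g \<cdot> f}"
proof -
  have "R `` {g' \<cdot> f'} = R `` {g \<cdot> f}" if "(g, g') \<in> R" "(f, f') \<in> R" for f' g'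
    using equiv_class_eq[OF equiv Cmp_cong[OF that(2,1) assms(3)]] by simp
  then have "R `` {g} \<cdot>\<^bsub>Q\<^esub> R `` {f} = (\<Union>g'\<in>R `` {g}. \<Union>f'\<in>R `` {f}. R `` {g \<cdot> f})"
    by (simp add: quotient_cat_def)
  also have "\<dots> = R `` {g \<cdot> f}"
    using R_refl assms by auto
  finally show ?thesis .
qed

lemma quotient_category: "category Q"
proof
  fix X assume "X \<in> Obj Q"
  then show "Idn Q X \<in> Hom Q X X" by (simp add: quotient_Idn mem_Hom)
next
  fix f X Y g Z assume "f \<in> Hom Q X Y" "g \<in> Hom Q Y Z"
  then show "g \<cdot>\<^bsub>Q\<^esub> f \<in> Hom Q X Z"
    by (auto simp: mem_Hom quotient_Arr quotient_Cmp)
next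
  fix f W X g Y h Z assume "f \<in> Hom Q W X" "g \<in> Hom Q X Y" "h \<in> Hom Q Y Z"
  then show "(h \<cdot>\<^bsub>Q\<^esub> g) \<cdot>\<^bsub>Q\<^esub> f = h \<cdot>\<^bsub>Q\<^esub> g \<cdot>\<^bsub>Q\<^esub> f"
    by (auto simp: mem_Hom quotient_Arr quotient_Cmp)
qed (auto simp: quotient_Arr quotient_Cmp quotient_Idn)

end

section \<open>Additive categories\<close>

lemma is_kernelD:
  assumes "is_kernel C k g"
  shows "k \<in> Arr C" "g \<in> Arr C" "Tgt C k = Src C g" "g \<cdot>\<^bsub>C\<^esub> k = Zero C (Src C k) (Tgt C g)"
  using assms by (auto simp: is_kernel_def)

lemma is_kernel_lift:
  assumes "is_kernel C k g" "x \<in> Arr C" "Tgt C x = Src C g" "g \<cdot>\<^bsub>C\<^esub> x = Zero C (Src C x) (Tgt C g)"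
  obtains h where "h \<in> Arr C" "Src C h = Src C x" "Tgt C h = Src C k" "k \<cdot>\<^bsub>C\<^esub> h = x"
proof -
  have "\<exists>h. h \<in> Hom C (Src C x) (Src C k) \<and> k \<cdot>\<^bsub>C\<^esub> h = x"
    using assms unfolding is_kernel_def by (metis mem_Hom)
  then show thesis using that by (auto simp: mem_Hom)
qed

lemma is_cokernelD:
  assumes "is_cokernel C g k"
  shows "k \<in> Arr C" "g \<in> Arr C" "Tgt C k = Src C g" "g \<cdot>\<^bsub>C\<^esub> k = Zero C (Src C k) (Tgt C g)"
  using assms by (auto simp: is_cokernel_def)

lemma is_cokernel_desc:
  assumes "is_cokernel C g k" "x \<in> Arr C" "Src C x = Tgt C k" "x \<cdot>\<^bsub>C\<^esub> k = Zero C (Src C k) (Tgt C x)"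
  obtains h where "h \<in> Arr C" "Src C h = Tgt C g" "Tgt C h = Tgt C x" "h \<cdot>\<^bsub>C\<^esub> g = x"
proof -
  have "\<exists>h. h \<in> Hom C (Tgt C g) (Tgt C x) \<and> h \<cdot>\<^bsub>C\<^esub> g = x"
    using assms unfolding is_cokernel_def by (metis mem_Hom)
  then show thesis using that by (auto simp: mem_Hom)
qed

lemma is_productD:
  assumes "is_product C a b"
  shows "a \<in> Arr C" "b \<in> Arr C" "Src C b = Src C a"
  using assms by (auto simp: is_product_def)

lemma is_product_pair:
  assumes "is_product C a b" "x \<in> Arr C" "y \<in> Arr C" "Src C x = Src C y" "Tgt C x = Tgt C a" "Tgt C y = Tgt C b"
  obtains h where "h \<in> Arr C" "Src C h = Src C y" "Tgt C h = Src C a" "a \<cdot>\<^bsub>C\<^esub> h = x" "b \<cdot>\<^bsub>C\<^esub> h = y"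
proof -
  have "\<exists>h. h \<in> Hom C (Src C x) (Src C a) \<and> a \<cdot>\<^bsub>C\<^esub> h = x \<and> b \<cdot>\<^bsub>C\<^esub> h = y"
    using assms unfolding is_product_def by (metis mem_Hom)
  then show thesis using that assms by (auto simp: mem_Hom)
qed

lemma is_pullbackD:
  assumes "is_pullback C f g a b"
  shows "f \<in> Arr C" "g \<in> Arr C" "a \<in> Arr C" "b \<in> Arr C" "Tgt C f = Tgt C g" "Src C a = Src C b"
    "Tgt C a = Src C f" "Tgt C b = Src C g" "f \<cdot>\<^bsub>C\<^esub> a = g \<cdot>\<^bsub>C\<^esub> b"
  using assms by (auto simp: is_pullback_def)

lemma is_pullback_pair:
  assumes "is_pullback C f g a b" "x \<in> Arr C" "y \<in> Arr C" "Src C x = Src C y" "Tgt C x = Src C f" "Tgt C y = Src C g"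
    "f \<cdot>\<^bsub>C\<^esub> x = g \<cdot>\<^bsub>C\<^esub> y"
  obtains h where "h \<in> Arr C" "Src C h = Src C y" "Tgt C h = Src C b" "a \<cdot>\<^bsub>C\<^esub> h = x" "b \<cdot>\<^bsub>C\<^esub> h = y"
proof -
  have "\<exists>h. h \<in> Hom C (Src C x) (Src C a) \<and> a \<cdot>\<^bsub>C\<^esub> h = x \<and> b \<cdot>\<^bsub>C\<^esub> h = y"
    using assms unfolding is_pullback_def by (metis mem_Hom)
  then show thesis using that assms is_pullbackD[OF assms(1)] by (auto simp: mem_Hom)
qed

lemma is_pushoutD:
  assumes "is_pushout C f g a b"
  shows "f \<in> Arr C" "g \<in> Arr C" "a \<in> Arr C" "b \<in> Arr C" "Src C f = Src C g" "Tgt C a = Tgt C b"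
    "Src C a = Tgt C f" "Src C b = Tgt C g" "a \<cdot>\<^bsub>C\<^esub> f = b \<cdot>\<^bsub>C\<^esub> g"
  using assms by (auto simp: is_pushout_def)

lemma is_pushout_copair:
  assumes "is_pushout C f g a b" "x \<in> Arr C" "y \<in> Arr C" "Tgt C x = Tgt C y" "Src C x = Tgt C f" "Src C y = Tgt C g"
    "x \<cdot>\<^bsub>C\<^esub> f = y \<cdot>\<^bsub>C\<^esub> g"
  obtains h where "h \<in> Arr C" "Src C h = Tgt C b" "Tgt C h = Tgt C y" "h \<cdot>\<^bsub>C\<^esub> a = x" "h \<cdot>\<^bsub>C\<^esub> b = y"
proof -
  have "\<exists>h. h \<in> Hom C (Tgt C a) (Tgt C x) \<and> h \<cdot>\<^bsub>C\<^esub> a = x \<and> h \<cdot>\<^bsub>C\<^esub> b = y"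
    using assms unfolding is_pushout_def by (metis mem_Hom)
  then show thesis using that assms is_pushoutD[OF assms(1)] by (auto simp: mem_Hom)
qed

lemma is_double_pullbackD:
  assumes "is_double_pullback C f g h k a b c"
  shows "f \<in> Arr C" "g \<in> Arr C" "h \<in> Arr C" "k \<in> Arr C" "Tgt C f = Tgt C g" "Src C g = Src C h"
    "Tgt C h = Tgt C k" "a \<in> Arr C" "b \<in> Arr C" "c \<in> Arr C" "Src C a = Src C b" "Src C b = Src C c"
    "Tgt C a = Src C f" "Tgt C b = Src C g" "Tgt C c = Src C k"
    "f \<cdot>\<^bsub>C\<^esub> a = g \<cdot>\<^bsub>C\<^esub> b" "h \<cdot>\<^bsub>C\<^esub> b = k \<cdot>\<^bsub>C\<^esub> c"
  using assms by (auto simp: is_double_pullback_def)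

lemma is_double_pullback_triple:
  assumes "is_double_pullback C f g h k a b c"
    "x \<in> Arr C" "y \<in> Arr C" "z \<in> Arr C" "Src C x = W" "Src C y = W" "Src C z = W"
    "Tgt C x = Src C f" "Tgt C y = Src C g" "Tgt C z = Src C k"
    "f \<cdot>\<^bsub>C\<^esub> x = g \<cdot>\<^bsub>C\<^esub> y" "h \<cdot>\<^bsub>C\<^esub> y = k \<cdot>\<^bsub>C\<^esub> z"
  obtains t where "t \<in> Arr C" "Src C t = W" "Tgt C t = Src C a"
    "a \<cdot>\<^bsub>C\<^esub> t = x" "b \<cdot>\<^bsub>C\<^esub> t = y" "c \<cdot>\<^bsub>C\<^esub> t = z"
proof -
  have "\<exists>t. t \<in> Hom C W (Src C a) \<and> a \<cdot>\<^bsub>C\<^esub> t = x \<and> b \<cdot>\<^bsub>C\<^esub> t = y \<and> c \<cdot>\<^bsub>C\<^esub> t = z"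
    using assms unfolding is_double_pullback_def by (metis mem_Hom)
  then show thesis using that by (auto simp: mem_Hom)
qed

context category
begin

lemma is_product_ext:
  assumes "is_product C a b" "arr x" "arr y" "src x = src y" "tgt x = src a" "tgt y = src a"
    "a \<cdot> x = a \<cdot> y" "b \<cdot> x = b \<cdot> y"
  shows "x = y"
proof -
  have *: "\<exists>!h. h \<in> Hom C W (src a) \<and> a \<cdot> h = u \<and> b \<cdot> h = v"
    if "u \<in> Hom C W (tgt a)" "v \<in> Hom C W (tgt b)" for W u v
    using assms(1) that unfolding is_product_def by blast
  have "\<exists>!h. h \<in> Hom C (src x) (src a) \<and> a \<cdot> h = a \<cdot> x \<and> b \<cdot> h = b \<cdot> x"
    by (rule *) (use assms is_productD[OF assms(1)] in \<open>simp_all add: mem_Hom\<close>)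
  then show ?thesis using assms by (auto simp: mem_Hom)
qed

lemma is_pullback_ext:
  assumes "is_pullback C f g a b" "arr x" "arr y" "src x = src y" "tgt x = src b" "tgt y = src b"
    "a \<cdot> x = a \<cdot> y" "b \<cdot> x = b \<cdot> y"
  shows "x = y"
proof -
  note D = is_pullbackD[OF assms(1)]
  have "f \<cdot> (a \<cdot> x) = g \<cdot> (b \<cdot> x)" using D assms(2-) Cmp_eq_Cmp[OF D(9), of x] by simp
  then have "\<exists>!h. h \<in> Hom C (src x) (src a) \<and> a \<cdot> h = a \<cdot> x \<and> b \<cdot> h = b \<cdot> x"
    using assms D unfolding is_pullback_def by (simp add: mem_Hom)
  then show ?thesis using assms D by (auto simp: mem_Hom)
qed

lemma is_pushout_ext:
  assumes "is_pushout C f g a b" "arr x" "arr y" "tgt x = tgt y" "src x = tgt b" "src y = tgt b"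
    "x \<cdot> a = y \<cdot> a" "x \<cdot> b = y \<cdot> b"
  shows "x = y"
proof -
  note D = is_pushoutD[OF assms(1)]
  have "(x \<cdot> a) \<cdot> f = (x \<cdot> b) \<cdot> g" using D assms(2-6) by simp
  then have "\<exists>!h. h \<in> Hom C (tgt a) (tgt x) \<and> h \<cdot> a = x \<cdot> a \<and> h \<cdot> b = x \<cdot> b"
    using assms D unfolding is_pushout_def by (simp add: mem_Hom)
  then show ?thesis using assms D by (auto simp: mem_Hom)
qed

end

context additive_category
begin

abbreviation Add_arrows (infixl "\<oplus>" 65) where "f \<oplus> g \<equiv> Add C f g"

definition Neg :: "'m \<Rightarrow> 'm" where
  "Neg f = inv\<^bsub>hom_group C (src f) (tgt f)\<^esub> f"

lemma Add_simps [simp]: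
  assumes "arr f" "arr g" "src f = src g" "tgt f = tgt g"
  shows "f \<oplus> g \<in> Arr C" "src (f \<oplus> g) = src g" "tgt (f \<oplus> g) = tgt g"
proof -
  interpret comm_group "hom_group C (src f) (tgt f)" using assms by (intro hom_comm_group) simp_all
  show "f \<oplus> g \<in> Arr C" "src (f \<oplus> g) = src g" "tgt (f \<oplus> g) = tgt g"
    using m_closed[of f g] assms by (simp_all add: hom_group_def mem_Hom)
qed

lemma Zero_simps [simp]:
  assumes "X \<in> Obj C" "Y \<in> Obj C"
  shows "Zero C X Y \<in> Arr C" "src (Zero C X Y) = X" "tgt (Zero C X Y) = Y"
proof -
  interpret comm_group "hom_group C X Y" using assms by (intro hom_comm_group) simp_all
  show "Zero C X Y \<in> Arr C" "src (Zero C X Y) = X" "tgt (Zero C X Y) = Y"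
    using one_closed by (simp_all add: hom_group_def mem_Hom)
qed

lemma Add_Zero [simp]: "\<lbrakk>arr f; src f = X; tgt f = Y\<rbrakk> \<Longrightarrow> f \<oplus> Zero C X Y = f"
  and Zero_Add [simp]: "\<lbrakk>arr f; src f = X; tgt f = Y\<rbrakk> \<Longrightarrow> Zero C X Y \<oplus> f = f"
proof -
  assume f: "arr f" "src f = X" "tgt f = Y"
  interpret comm_group "hom_group C X Y" using f by (intro hom_comm_group) auto
  show "f \<oplus> Zero C X Y = f" "Zero C X Y \<oplus> f = f"
    using f r_one[of f] l_one[of f] by (simp_all add: hom_group_def mem_Hom)
qed

lemma Add_commute:
  assumes "arr f" "arr g" "src f = src g" "tgt f = tgt g"
  shows "f \<oplus> g = g \<oplus> f"
proof -
  interpret comm_group "hom_group C (src f) (tgt f)" using assms by (intro hom_comm_group) simp_all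
  show ?thesis using m_comm[of f g] assms by (simp add: hom_group_def mem_Hom)
qed

lemma Add_assoc:
  assumes "arr f" "arr g" "arr h" "src f = src g" "tgt f = tgt g"
    "src g = src h" "tgt g = tgt h"
  shows "(f \<oplus> g) \<oplus> h = f \<oplus> (g \<oplus> h)"
proof -
  interpret comm_group "hom_group C (src f) (tgt f)" using assms by (intro hom_comm_group) simp_all
  show ?thesis using m_assoc[of f g h] assms by (simp add: hom_group_def mem_Hom)
qed

lemma Neg_simps [simp]:
  assumes "arr f"
  shows "Neg f \<in> Arr C" "src (Neg f) = src f" "tgt (Neg f) = tgt f"
    "f \<oplus> Neg f = Zero C (src f) (tgt f)" "Neg f \<oplus> f = Zero C (src f) (tgt f)"
proof -
  interpret comm_group "hom_group C (src f) (tgt f)" using assms by (intro hom_comm_group) simp_all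
  show "Neg f \<in> Arr C" "src (Neg f) = src f" "tgt (Neg f) = tgt f"
    "f \<oplus> Neg f = Zero C (src f) (tgt f)" "Neg f \<oplus> f = Zero C (src f) (tgt f)"
    using inv_closed[of f] r_inv[of f] l_inv[of f] assms
    by (simp_all add: hom_group_def mem_Hom Neg_def)
qed

lemma Add_Neg_cancel [simp]:
  assumes "arr f" "arr g" "src f = src g" "tgt f = tgt g"
  shows "f \<oplus> (Neg f \<oplus> g) = g" "Neg f \<oplus> (f \<oplus> g) = g" "f \<oplus> (g \<oplus> Neg f) = g" "Neg f \<oplus> (g \<oplus> f) = g"
  using assms Add_assoc[of f "Neg f" g] Add_assoc[of "Neg f" f g]
    Add_commute[of g "Neg f"] Add_commute[of g f] by simp_all

lemma Add_cancel_left: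
  assumes "f \<oplus> g = f \<oplus> h" "arr f" "arr g" "arr h" "src f = src g" "tgt f = tgt g"
    "src g = src h" "tgt g = tgt h"
  shows "g = h"
  using arg_cong[OF assms(1), of "\<lambda>u. Neg f \<oplus> u"] assms(2-) by simp

lemma Cmp_Add_simp [simp]:
  "\<lbrakk>arr f; arr f'; arr g; src f = src f'; tgt f = tgt f'; tgt f' = src g\<rbrakk>
    \<Longrightarrow> g \<cdot> (f \<oplus> f') = g \<cdot> f \<oplus> g \<cdot> f'"
  using Cmp_Add[of f "src f" "tgt f" f' g "tgt g"] by (simp add: mem_Hom)

lemma Add_Cmp_simp [simp]:
  "\<lbrakk>arr f; arr g; arr g'; src g = src g'; tgt g = tgt g'; tgt f = src g'\<rbrakk>
    \<Longrightarrow> (g \<oplus> g') \<cdot> f = g \<cdot> f \<oplus> g' \<cdot> f"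
  using Add_Cmp[of f "src f" "tgt f" g "tgt g" g'] by (simp add: mem_Hom)

lemma Cmp_Zero [simp]:
  assumes "arr f" "X \<in> Obj C" "src f = Y"
  shows "f \<cdot> Zero C X Y = Zero C X (tgt f)"
proof -
  have "f \<cdot> Zero C X Y \<oplus> f \<cdot> Zero C X Y = f \<cdot> (Zero C X Y \<oplus> Zero C X Y)"
    using assms by (intro Cmp_Add_simp[symmetric]) auto
  also have "\<dots> = f \<cdot> Zero C X Y \<oplus> Zero C X (tgt f)" using assms by auto
  finally show ?thesis by (rule Add_cancel_left) (use assms in auto)
qed

lemma Zero_Cmp [simp]:
  assumes "arr f" "Y \<in> Obj C" "tgt f = X"
  shows "Zero C X Y \<cdot> f = Zero C (src f) Y"
proof -
  have "Zero C X Y \<cdot> f \<oplus> Zero C X Y \<cdot> f = (Zero C X Y \<oplus> Zero C X Y) \<cdot> f"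
    using assms by (intro Add_Cmp_simp[symmetric]) auto
  also have "\<dots> = Zero C X Y \<cdot> f \<oplus> Zero C (src f) Y" using assms by auto
  finally show ?thesis by (rule Add_cancel_left) (use assms in auto)
qed

lemma Neg_unique:
  assumes "f \<oplus> g = Zero C (src f) (tgt f)" "arr f" "arr g" "src f = src g" "tgt f = tgt g"
  shows "g = Neg f"
  using assms by (intro Add_cancel_left[of f g "Neg f"]) simp_all

lemma Neg_Neg [simp]: "arr f \<Longrightarrow> Neg (Neg f) = f"
  using Neg_unique[of "Neg f" f] by simp

lemma Neg_Zero [simp]:
  "\<lbrakk>X \<in> Obj C; Y \<in> Obj C\<rbrakk> \<Longrightarrow> Neg (Zero C X Y) = Zero C X Y"
  by (rule Neg_unique[symmetric]) simp_all

lemma Neg_Cmp: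
  assumes "arr f" "arr g" "tgt f = src g"
  shows "Neg g \<cdot> f = Neg (g \<cdot> f)" "g \<cdot> Neg f = Neg (g \<cdot> f)"
  using assms by (intro Neg_unique; simp flip: Add_Cmp_simp Cmp_Add_simp)+

lemma diff_eq: "diff C f g = f \<oplus> Neg g" if "src f = src g" "tgt f = tgt g"
  by (simp add: diff_def Neg_def that)

lemma kernel_mono:
  assumes "is_kernel C k g" "arr h" "arr h'" "src h = src h'" "tgt h = src k"
    "tgt h' = src k" "k \<cdot> h = k \<cdot> h'"
  shows "h = h'"
proof -
  note K = is_kernelD[OF assms(1)]
  have "g \<cdot> (k \<cdot> h) = Zero C (src h) (tgt g)"
    using Cmp_eq_Cmp[OF K(4), of h] assms K by simp
  then have "\<exists>!u. u \<in> Hom C (src h) (src k) \<and> k \<cdot> u = k \<cdot> h"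
    using K assms unfolding is_kernel_def by (simp add: mem_Hom)
  then show ?thesis using assms by (auto simp: mem_Hom)
qed

lemma cokernel_epi:
  assumes "is_cokernel C g k" "arr h" "arr h'" "tgt h = tgt h'" "src h = tgt g"
    "src h' = tgt g" "h \<cdot> g = h' \<cdot> g"
  shows "h = h'"
proof -
  note K = is_cokernelD[OF assms(1)]
  have "(h \<cdot> g) \<cdot> k = Zero C (src k) (tgt h)"
    using assms K by simp
  then have "\<exists>!u. u \<in> Hom C (tgt g) (tgt h) \<and> u \<cdot> g = h \<cdot> g"
    using K assms unfolding is_cokernel_def by (simp add: mem_Hom)
  then show ?thesis using assms by (auto simp: mem_Hom)
qed

text \<open>The difference \<open>x - y\<close> is killed by \<open>g\<close> and so factors through
  the kernel. The sum form \<open>x = y + k h\<close> is the one in which stable equality is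
  handled.\<close>

lemma kernel_diff:
  assumes k: "is_kernel C k g" and x: "arr x" "arr y" "src x = src y" "tgt x = src g"
    "tgt y = src g" "g \<cdot> x = g \<cdot> y"
  obtains h where "arr h" "src h = src y" "tgt h = src k" "x = y \<oplus> k \<cdot> h"
proof -
  note K = is_kernelD[OF k]
  obtain h where h: "arr h" "src h = src (x \<oplus> Neg y)" "tgt h = src k" "k \<cdot> h = x \<oplus> Neg y"
    using is_kernel_lift[OF k, of "x \<oplus> Neg y"] x K by (auto simp: Neg_Cmp)
  show thesis using h x K by (intro that[of h]) simp_all
qed

lemma cokernel_diff:
  assumes k: "is_cokernel C g k" and x: "arr x" "arr y" "tgt x = tgt y" "src x = tgt k"
    "src y = tgt k" "x \<cdot> k = y \<cdot> k"
  obtains h where "arr h" "src h = tgt g" "tgt h = tgt y" "x = y \<oplus> h \<cdot> g"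
proof -
  note K = is_cokernelD[OF k]
  obtain h where h: "arr h" "src h = tgt g" "tgt h = tgt (x \<oplus> Neg y)" "h \<cdot> g = x \<oplus> Neg y"
    using is_cokernel_desc[OF k, of "x \<oplus> Neg y"] x K by (auto simp: Neg_Cmp)
  show thesis using h x K by (intro that[of h]) simp_all
qed

text \<open>The equational form of a direct sum, symmetric in products and coproducts: with it both
  universal properties become computations for the simplifier.\<close>

definition is_biproduct :: "'m \<Rightarrow> 'm \<Rightarrow> 'm \<Rightarrow> 'm \<Rightarrow> bool" where
  "is_biproduct p q i j \<longleftrightarrow> p \<in> Arr C \<and> arr q \<and> arr i \<and> arr j \<and>
    src q = src p \<and> tgt i = src p \<and> tgt j = src p \<and> src i = tgt p \<and> src j = tgt q \<and>
    p \<cdot> i = Idn C (tgt p) \<and> q \<cdot> j = Idn C (tgt q) \<and>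
    p \<cdot> j = Zero C (tgt q) (tgt p) \<and> q \<cdot> i = Zero C (tgt p) (tgt q) \<and>
    i \<cdot> p \<oplus> j \<cdot> q = Idn C (src p)"

lemma is_biproductD:
  assumes "is_biproduct p q i j"
  shows "arr p" "arr q" "arr i" "arr j"
    "src q = src p" "tgt i = src p" "tgt j = src p" "src i = tgt p" "src j = tgt q"
    "p \<cdot> i = Idn C (tgt p)" "q \<cdot> j = Idn C (tgt q)"
    "p \<cdot> j = Zero C (tgt q) (tgt p)" "q \<cdot> i = Zero C (tgt p) (tgt q)"
    "i \<cdot> p \<oplus> j \<cdot> q = Idn C (src p)"
  using assms unfolding is_biproduct_def by auto

lemma is_biproduct_simps:
  assumes "is_biproduct p q i j" "arr x"
  shows "tgt x = tgt p \<Longrightarrow> p \<cdot> (i \<cdot> x) = x" "tgt x = tgt p \<Longrightarrow> q \<cdot> (i \<cdot> x) = Zero C (src x) (tgt q)"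
    "tgt x = tgt q \<Longrightarrow> q \<cdot> (j \<cdot> x) = x" "tgt x = tgt q \<Longrightarrow> p \<cdot> (j \<cdot> x) = Zero C (src x) (tgt p)"
    "tgt x = src p \<Longrightarrow> i \<cdot> (p \<cdot> x) \<oplus> j \<cdot> (q \<cdot> x) = x"
    "src x = src p \<Longrightarrow> x \<cdot> (i \<cdot> p) \<oplus> x \<cdot> (j \<cdot> q) = x"
proof -
  note B = is_biproductD[OF assms(1)]
  show "tgt x = tgt p \<Longrightarrow> p \<cdot> (i \<cdot> x) = x" "tgt x = tgt p \<Longrightarrow> q \<cdot> (i \<cdot> x) = Zero C (src x) (tgt q)"
    "tgt x = tgt q \<Longrightarrow> q \<cdot> (j \<cdot> x) = x" "tgt x = tgt q \<Longrightarrow> p \<cdot> (j \<cdot> x) = Zero C (src x) (tgt p)"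
    using B(1-9) assms(2) by (simp_all add: Cmp_eq_Cmp[OF B(10)] Cmp_eq_Cmp[OF B(11)] Cmp_eq_Cmp[OF B(12)] Cmp_eq_Cmp[OF B(13)])
  show "i \<cdot> (p \<cdot> x) \<oplus> j \<cdot> (q \<cdot> x) = x" if "tgt x = src p"
    using arg_cong[OF B(14), of "\<lambda>u. u \<cdot> x"] B(1-9) assms(2) that by simp
  show "x \<cdot> (i \<cdot> p) \<oplus> x \<cdot> (j \<cdot> q) = x" if "src x = src p"
    using arg_cong[OF B(14), of "\<lambda>u. x \<cdot> u"] B(1-9) assms(2) that by simp
qed

lemma is_biproduct_swap: "is_biproduct p q i j \<Longrightarrow> is_biproduct q p j i"
  using Add_commute[of "i \<cdot> p" "j \<cdot> q"] unfolding is_biproduct_def by auto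

lemma product_biproduct:
  assumes pq: "is_product C p q"
  obtains i j where "is_biproduct p q i j"
proof -
  note P = is_productD[OF pq]
  obtain i where i: "arr i" "src i = tgt p" "tgt i = src p" "p \<cdot> i = Idn C (tgt p)"
    "q \<cdot> i = Zero C (tgt p) (tgt q)"
    using is_product_pair[OF pq, of "Idn C (tgt p)" "Zero C (tgt p) (tgt q)"] P by auto
  obtain j where j: "arr j" "src j = tgt q" "tgt j = src p" "q \<cdot> j = Idn C (tgt q)"
    "p \<cdot> j = Zero C (tgt q) (tgt p)"
    using is_product_pair[OF pq, of "Zero C (tgt q) (tgt p)" "Idn C (tgt q)"] P by auto
  have "i \<cdot> p \<oplus> j \<cdot> q = Idn C (src p)"
    by (rule is_product_ext[OF pq])
      (simp_all add: P i j Cmp_eq_Cmp[OF i(4)] Cmp_eq_Cmp[OF i(5)] Cmp_eq_Cmp[OF j(4)] Cmp_eq_Cmp[OF j(5)])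
  then have "is_biproduct p q i j"
    using P i j unfolding is_biproduct_def by simp
  then show thesis by (rule that)
qed

lemma biproduct_exists:
  assumes "X \<in> Obj C" "Y \<in> Obj C"
  obtains p q i j where "is_biproduct p q i j" "tgt p = X" "tgt q = Y"
  using product_exists[OF assms] product_biproduct by metis

lemma is_zero_objectI:
  assumes "K \<in> Obj C" "Idn C K = Zero C K K"
  shows "is_zero_object C K"
  unfolding is_zero_object_def
proof (intro conjI ballI)
  fix X assume X: "X \<in> Obj C"
  show "\<exists>!f. f \<in> Hom C X K"
  proof (rule ex1I)
    fix f assume f: "f \<in> Hom C X K"
    then have "f = Idn C K \<cdot> f" by (simp add: mem_Hom)
    then show "f = Zero C X K" unfolding assms(2) using f assms(1) by (simp add: mem_Hom)
  qed (use X assms in \<open>simp add: mem_Hom\<close>)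
  show "\<exists>!f. f \<in> Hom C K X"
  proof (rule ex1I)
    fix f assume f: "f \<in> Hom C K X"
    then have "f = f \<cdot> Idn C K" by (simp add: mem_Hom)
    then show "f = Zero C K X" unfolding assms(2) using f assms(1) by (simp add: mem_Hom)
  qed (use X assms in \<open>simp add: mem_Hom\<close>)
qed (use assms in simp)

end

section \<open>Exact and Frobenius categories\<close>

context category
begin

lemma is_pushoutI:
  assumes "arr f" "arr g" "arr a" "arr b" "src f = src g" "tgt a = tgt b"
    "src a = tgt f" "src b = tgt g" "a \<cdot> f = b \<cdot> g"
    and ex: "\<And>x y. \<lbrakk>arr x; arr y; src x = tgt f; src y = tgt g; tgt x = tgt y; x \<cdot> f = y \<cdot> g\<rbrakk>
      \<Longrightarrow> \<exists>h. h \<in> Arr C \<and> src h = tgt a \<and> tgt h = tgt y \<and> h \<cdot> a = x \<and> h \<cdot> b = y"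
    and uniq: "\<And>h h'. \<lbrakk>arr h; arr h'; src h = tgt b; src h' = tgt b; tgt h = tgt h';
      h \<cdot> a = h' \<cdot> a; h \<cdot> b = h' \<cdot> b\<rbrakk> \<Longrightarrow> h = h'"
  shows "is_pushout C f g a b"
  unfolding is_pushout_def
proof (intro conjI allI ballI impI)
  fix W x y assume x: "x \<in> Hom C (tgt f) W" "y \<in> Hom C (tgt g) W" "x \<cdot> f = y \<cdot> g"
  then obtain h where h: "arr h" "src h = tgt a" "tgt h = W" "h \<cdot> a = x" "h \<cdot> b = y"
    using ex[of x y] by (auto simp: mem_Hom)
  show "\<exists>!h. h \<in> Hom C (tgt a) W \<and> h \<cdot> a = x \<and> h \<cdot> b = y"
  proof (rule ex1I)
    fix h' assume "h' \<in> Hom C (tgt a) W \<and> h' \<cdot> a = x \<and> h' \<cdot> b = y"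
    with h assms(6) show "h' = h" by - (rule uniq, simp_all add: mem_Hom)
  qed (use h in \<open>simp add: mem_Hom\<close>)
qed (use assms in simp_all)

lemma is_pullbackI:
  assumes "arr f" "arr g" "arr a" "arr b" "tgt f = tgt g" "src a = src b"
    "tgt a = src f" "tgt b = src g" "f \<cdot> a = g \<cdot> b"
    and ex: "\<And>x y. \<lbrakk>arr x; arr y; tgt x = src f; tgt y = src g; src x = src y; f \<cdot> x = g \<cdot> y\<rbrakk>
      \<Longrightarrow> \<exists>h. h \<in> Arr C \<and> tgt h = src a \<and> src h = src y \<and> a \<cdot> h = x \<and> b \<cdot> h = y"
    and uniq: "\<And>h h'. \<lbrakk>arr h; arr h'; tgt h = src b; tgt h' = src b; src h = src h';
      a \<cdot> h = a \<cdot> h'; b \<cdot> h = b \<cdot> h'\<rbrakk> \<Longrightarrow> h = h'"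
  shows "is_pullback C f g a b"
  unfolding is_pullback_def
proof (intro conjI allI ballI impI)
  fix W x y assume x: "x \<in> Hom C W (src f)" "y \<in> Hom C W (src g)" "f \<cdot> x = g \<cdot> y"
  then obtain h where h: "arr h" "tgt h = src a" "src h = W" "a \<cdot> h = x" "b \<cdot> h = y"
    using ex[of x y] by (auto simp: mem_Hom)
  show "\<exists>!h. h \<in> Hom C W (src a) \<and> a \<cdot> h = x \<and> b \<cdot> h = y"
  proof (rule ex1I)
    fix h' assume "h' \<in> Hom C W (src a) \<and> a \<cdot> h' = x \<and> b \<cdot> h' = y"
    with h assms(6) show "h' = h" by - (rule uniq, simp_all add: mem_Hom)
  qed (use h in \<open>simp add: mem_Hom\<close>)
qed (use assms in simp_all)

end

context additive_category
begin

lemma biproduct_copair_ext: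
  assumes B: "is_biproduct p q i j" and h: "arr h" "arr h'" "src h = src p" "src h' = src p"
    and t: "tgt h = tgt h'" and e: "h \<cdot> i = h' \<cdot> i" "h \<cdot> j = h' \<cdot> j"
  shows "h = h'"
proof -
  note D = is_biproductD[OF B]
  have "(h \<cdot> i) \<cdot> p \<oplus> (h \<cdot> j) \<cdot> q = h" "(h' \<cdot> i) \<cdot> p \<oplus> (h' \<cdot> j) \<cdot> q = h'"
    using is_biproduct_simps(6)[OF B] h D by simp_all
  then show ?thesis using e by metis
qed

lemma biproduct_pair_ext:
  assumes B: "is_biproduct p q i j" and h: "arr h" "arr h'" "tgt h = src p" "tgt h' = src p"
    and t: "src h = src h'" and e: "p \<cdot> h = p \<cdot> h'" "q \<cdot> h = q \<cdot> h'"
  shows "h = h'"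
  using is_biproduct_simps(5)[OF B h(1)] is_biproduct_simps(5)[OF B h(2)] h(3,4) e by metis

end

context exact_category
begin

section \<open>Inflations and deflations of direct sums\<close>

lemma inflation_Arr: "inflation E f \<Longrightarrow> arr f"
  and deflation_Arr: "deflation E f \<Longrightarrow> arr f"
  using conflation is_kernelD(1,2) by (metis inflation_def) (metis conflation is_kernelD(2) deflation_def)

text \<open>An identity is a deflation, and its kernel \<open>f\<close> satisfies
  \<open>f = 0\<close>; being monic, \<open>f\<close> starts at a zero object. This is the seed from
  which the inclusions of direct sums become inflations.\<close>

lemma zero_inflation:
  assumes "X \<in> Obj C"
  obtains K where "is_zero_object C K" "inflation E (Zero C K X)"
proof -
  obtain f where f: "(f, Idn C X) \<in> E" using deflation_Idn[OF assms] by (auto simp: deflation_def)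
  note k = conflation[OF f, THEN conjunct1] and D = is_kernelD[OF conflation[OF f, THEN conjunct1]]
  have eq: "f = Zero C (src f) X" using D assms by simp
  have "Idn C (src f) = Zero C (src f) (src f)"
    by (rule kernel_mono[OF k]) (use D(1-3) assms eq in \<open>simp_all\<close>)
  then have "is_zero_object C (src f)" using D(1) by (intro is_zero_objectI) simp_all
  moreover have "inflation E (Zero C (src f) X)" using f eq by (auto simp: inflation_def)
  ultimately show thesis by (rule that)
qed

lemma zero_deflation:
  assumes "X \<in> Obj C"
  obtains K where "is_zero_object C K" "deflation E (Zero C X K)"
proof -
  obtain f where f: "(Idn C X, f) \<in> E" using inflation_Idn[OF assms] by (auto simp: inflation_def)
  note k = conflation[OF f, THEN conjunct2] and D = is_cokernelD[OF conflation[OF f, THEN conjunct2]]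
  have eq: "f = Zero C X (tgt f)" using D assms by simp
  have "Idn C (tgt f) = Zero C (tgt f) (tgt f)"
    by (rule cokernel_epi[OF k]) (use D(1-3) assms eq in \<open>simp_all\<close>)
  then have "is_zero_object C (tgt f)" using D(2) by (intro is_zero_objectI) simp_all
  moreover have "deflation E (Zero C X (tgt f))" using f eq by (auto simp: deflation_def)
  ultimately show thesis by (rule that)
qed

text \<open>With X and Y the targets of \<open>p\<close> and \<open>q\<close>, the direct sum is
  also a coproduct along \<open>i\<close> and the graph of \<open>f\<close>, that is, a pushout of
  \<open>0 -> X\<close> along \<open>0 -> Y\<close>. The graph is then the pushout of an
  inflation.\<close>

lemma graph_inflation:
  assumes B: "is_biproduct p q i j" and f: "arr f" "src f = tgt q" "tgt f = tgt p"
  shows "inflation E (i \<cdot> f \<oplus> j)"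
proof -
  note D = is_biproductD[OF B] and S = is_biproduct_simps[OF B]
  obtain K where K: "is_zero_object C K" "inflation E (Zero C K (tgt p))"
    using zero_inflation[of "tgt p"] D by auto
  have K': "K \<in> Obj C" using K(1) by (simp add: is_zero_object_def)
  have "is_pushout C (Zero C K (tgt p)) (Zero C K (tgt q)) i (i \<cdot> f \<oplus> j)"
  proof (rule is_pushoutI)
    fix x y assume x: "arr x" "arr y" "src x = tgt (Zero C K (tgt p))"
      "src y = tgt (Zero C K (tgt q))" "tgt x = tgt y"
    \<comment> \<open>A map with value \<open>x\<close> on \<open>i\<close> must take the value
      \<open>y - x f\<close> on \<open>j\<close> to give \<open>y\<close> on the graph.\<close>
    define w where "w = y \<oplus> Neg (x \<cdot> f)"
    have w: "arr w" "src w = tgt q" "tgt w = tgt y" "x \<cdot> f \<oplus> w = y"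
      using x f D K' by (simp_all add: w_def)
    show "\<exists>h. h \<in> Arr C \<and> src h = tgt i \<and> tgt h = tgt y \<and> h \<cdot> i = x \<and> h \<cdot> (i \<cdot> f \<oplus> j) = y"
      by (rule exI[of _ "x \<cdot> p \<oplus> w \<cdot> q"]) (use x w f D K' in \<open>simp add: S\<close>)
  next
    fix h h' assume h: "arr h" "arr h'" "src h = tgt (i \<cdot> f \<oplus> j)" "src h' = tgt (i \<cdot> f \<oplus> j)"
      "tgt h = tgt h'" "h \<cdot> i = h' \<cdot> i" "h \<cdot> (i \<cdot> f \<oplus> j) = h' \<cdot> (i \<cdot> f \<oplus> j)"
    have "(h \<cdot> i) \<cdot> f \<oplus> h \<cdot> j = (h' \<cdot> i) \<cdot> f \<oplus> h' \<cdot> j"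
      using h(1-5,7) f D by simp
    then have "(h \<cdot> i) \<cdot> f \<oplus> h \<cdot> j = (h \<cdot> i) \<cdot> f \<oplus> h' \<cdot> j" by (simp only: h(6))
    then have "h \<cdot> j = h' \<cdot> j" by (rule Add_cancel_left) (use h(1-5) f D in simp_all)
    then show "h = h'" by - (rule biproduct_copair_ext[OF B], use h f D in simp_all)
  qed (use D f K' in simp_all)
  then show ?thesis using K(2) inflation_pushout by blast
qed

text \<open>Dually, \<open>p\<close> and \<open>f p + q\<close> present the direct sum as a product,
  the pullback of \<open>X -> 0\<close> along \<open>Y -> 0\<close>.\<close>

lemma cograph_deflation:
  assumes B: "is_biproduct p q i j" and f: "arr f" "src f = tgt p" "tgt f = tgt q"
  shows "deflation E (f \<cdot> p \<oplus> q)"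
proof -
  note D = is_biproductD[OF B] and S = is_biproduct_simps[OF B]
  obtain K where K: "is_zero_object C K" "deflation E (Zero C (tgt p) K)"
    using zero_deflation[of "tgt p"] D by auto
  have K': "K \<in> Obj C" using K(1) by (simp add: is_zero_object_def)
  have "is_pullback C (Zero C (tgt p) K) (Zero C (tgt q) K) p (f \<cdot> p \<oplus> q)"
  proof (rule is_pullbackI)
    fix x y assume x: "arr x" "arr y" "tgt x = src (Zero C (tgt p) K)"
      "tgt y = src (Zero C (tgt q) K)" "src x = src y"
    define w where "w = y \<oplus> Neg (f \<cdot> x)"
    have w: "arr w" "tgt w = tgt q" "src w = src y" "f \<cdot> x \<oplus> w = y"
      using x f D K' by (simp_all add: w_def)
    show "\<exists>h. h \<in> Arr C \<and> tgt h = src p \<and> src h = src y \<and> p \<cdot> h = x \<and> (f \<cdot> p \<oplus> q) \<cdot> h = y"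
      by (rule exI[of _ "i \<cdot> x \<oplus> j \<cdot> w"]) (use x w f D K' in \<open>simp add: S\<close>)
  next
    fix h h' assume h: "arr h" "arr h'" "tgt h = src (f \<cdot> p \<oplus> q)" "tgt h' = src (f \<cdot> p \<oplus> q)"
      "src h = src h'" "p \<cdot> h = p \<cdot> h'" "(f \<cdot> p \<oplus> q) \<cdot> h = (f \<cdot> p \<oplus> q) \<cdot> h'"
    have "f \<cdot> (p \<cdot> h) \<oplus> q \<cdot> h = f \<cdot> (p \<cdot> h') \<oplus> q \<cdot> h'"
      using h(1-5,7) f D by simp
    then have "f \<cdot> (p \<cdot> h) \<oplus> q \<cdot> h = f \<cdot> (p \<cdot> h) \<oplus> q \<cdot> h'" by (simp only: h(6))
    then have "q \<cdot> h = q \<cdot> h'" by (rule Add_cancel_left) (use h(1-5) f D in simp_all)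
    then show "h = h'" by - (rule biproduct_pair_ext[OF B], use h f D in simp_all)
  qed (use D f K' in simp_all)
  then show ?thesis using K(2) deflation_pullback by blast
qed

text \<open>The graph of the zero map is \<open>j\<close> and its cograph is \<open>q\<close>;
  exchanging the summands gives the other two.\<close>

lemma biproduct_inflation:
  assumes B: "is_biproduct p q i j"
  shows "inflation E i" "inflation E j" "deflation E p" "deflation E q"
proof -
  have "inflation E j \<and> deflation E q" if B: "is_biproduct p q i j" for p q i j
    using graph_inflation[OF B, of "Zero C (tgt q) (tgt p)"] is_biproductD[OF B]
      cograph_deflation[OF B, of "Zero C (tgt p) (tgt q)"] by simp
  from this[OF B] this[OF is_biproduct_swap[OF B]]
  show "inflation E i" "inflation E j" "deflation E p" "deflation E q" by auto
qed

text \<open>The sum \<open>1 + m\<close> is the pushout of \<open>m\<close> along the inclusion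
  \<open>j\<close> of its source.\<close>

lemma sum_inflation:
  assumes B: "is_biproduct p q i j" and B': "is_biproduct p' q' i' j'" and t: "tgt p' = tgt p"
    and m: "inflation E m" "src m = tgt q" "tgt m = tgt q'"
  shows "inflation E (i' \<cdot> p \<oplus> j' \<cdot> (m \<cdot> q))"
proof -
  note D = is_biproductD[OF B] is_biproductD[OF B'] and S = is_biproduct_simps[OF B] is_biproduct_simps[OF B']
  note m' = inflation_Arr[OF m(1)]
  have "is_pushout C m j j' (i' \<cdot> p \<oplus> j' \<cdot> (m \<cdot> q))"
  proof (rule is_pushoutI)
    fix x y assume x: "arr x" "arr y" "src x = tgt m" "src y = tgt j" "tgt x = tgt y"
      "x \<cdot> m = y \<cdot> j"
    have "x \<cdot> (m \<cdot> q) = y \<cdot> (j \<cdot> q)"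
      using Cmp_eq_Cmp[OF x(6), of q] x(1-5) m m' D(1-9) by simp
    moreover have "y \<cdot> (i \<cdot> p) \<oplus> y \<cdot> (j \<cdot> q) = y" using S(6)[of y] x D(7) by simp
    ultimately
    show "\<exists>h. h \<in> Arr C \<and> src h = tgt j' \<and> tgt h = tgt y \<and> h \<cdot> j' = x \<and>
        h \<cdot> (i' \<cdot> p \<oplus> j' \<cdot> (m \<cdot> q)) = y"
      by (intro exI[of _ "y \<cdot> (i \<cdot> p') \<oplus> x \<cdot> q'"]) (use x(1-5) m m' D t in \<open>simp add: S\<close>)
  next
    fix h h' assume h: "arr h" "arr h'" "src h = tgt (i' \<cdot> p \<oplus> j' \<cdot> (m \<cdot> q))"
      "src h' = tgt (i' \<cdot> p \<oplus> j' \<cdot> (m \<cdot> q))" "tgt h = tgt h'" "h \<cdot> j' = h' \<cdot> j'"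
      "h \<cdot> (i' \<cdot> p \<oplus> j' \<cdot> (m \<cdot> q)) = h' \<cdot> (i' \<cdot> p \<oplus> j' \<cdot> (m \<cdot> q))"
    have "(h \<cdot> (i' \<cdot> p \<oplus> j' \<cdot> (m \<cdot> q))) \<cdot> i = (h' \<cdot> (i' \<cdot> p \<oplus> j' \<cdot> (m \<cdot> q))) \<cdot> i"
      by (simp only: h(7))
    then have "h \<cdot> i' = h' \<cdot> i'"
      using h(1-5) m m' D t by (simp add: S)
    then show "h = h'" by - (rule biproduct_copair_ext[OF B'], use h m m' D t in simp_all)
  qed (use D m m' t in \<open>simp_all add: S\<close>)
  then show ?thesis using m(1) inflation_pushout by blast
qed

text \<open>Dually, \<open>1 + m\<close> is the pullback of \<open>m\<close> along the projection
  \<open>q'\<close> onto its target.\<close>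

lemma sum_deflation:
  assumes B: "is_biproduct p q i j" and B': "is_biproduct p' q' i' j'" and t: "tgt p' = tgt p"
    and m: "deflation E m" "src m = tgt q" "tgt m = tgt q'"
  shows "deflation E (i' \<cdot> p \<oplus> j' \<cdot> (m \<cdot> q))"
proof -
  note D = is_biproductD[OF B] is_biproductD[OF B'] and S = is_biproduct_simps[OF B] is_biproduct_simps[OF B']
  note m' = deflation_Arr[OF m(1)]
  have "is_pullback C m q' q (i' \<cdot> p \<oplus> j' \<cdot> (m \<cdot> q))"
  proof (rule is_pullbackI)
    fix x y assume x: "arr x" "arr y" "tgt x = src m" "tgt y = src q'" "src x = src y"
      "m \<cdot> x = q' \<cdot> y"
    have "i' \<cdot> (p' \<cdot> y) \<oplus> j' \<cdot> (q' \<cdot> y) = y" using S(11)[of y] x D by simp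
    then show "\<exists>h. h \<in> Arr C \<and> tgt h = src q \<and> src h = src y \<and> q \<cdot> h = x \<and>
        (i' \<cdot> p \<oplus> j' \<cdot> (m \<cdot> q)) \<cdot> h = y"
      by (intro exI[of _ "i \<cdot> (p' \<cdot> y) \<oplus> j \<cdot> x"]) (use x m m' D t in \<open>simp add: S\<close>)
  next
    fix h h' assume h: "arr h" "arr h'" "tgt h = src (i' \<cdot> p \<oplus> j' \<cdot> (m \<cdot> q))"
      "tgt h' = src (i' \<cdot> p \<oplus> j' \<cdot> (m \<cdot> q))" "src h = src h'" "q \<cdot> h = q \<cdot> h'"
      "(i' \<cdot> p \<oplus> j' \<cdot> (m \<cdot> q)) \<cdot> h = (i' \<cdot> p \<oplus> j' \<cdot> (m \<cdot> q)) \<cdot> h'"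
    have "p' \<cdot> ((i' \<cdot> p \<oplus> j' \<cdot> (m \<cdot> q)) \<cdot> h) = p' \<cdot> ((i' \<cdot> p \<oplus> j' \<cdot> (m \<cdot> q)) \<cdot> h')"
      by (simp only: h(7))
    then have "p \<cdot> h = p \<cdot> h'"
      using h(1-5) m m' D t by (simp add: S)
    then show "h = h'" by - (rule biproduct_pair_ext[OF B], use h m m' D t in simp_all)
  qed (use D m m' t in \<open>simp_all add: S\<close>)
  then show ?thesis using m(1) deflation_pullback by blast
qed

text \<open>The pair (f, m) is the graph of \<open>f\<close> followed by \<open>1 + m\<close>, and
  inflations compose.\<close>

lemma pair_inflation:
  assumes B: "is_biproduct p q i j" and f: "arr f" "tgt f = tgt p"
    and m: "inflation E m" "src m = src f" "tgt m = tgt q"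
  shows "inflation E (i \<cdot> f \<oplus> j \<cdot> m)"
proof -
  note m' = inflation_Arr[OF m(1)]
  obtain p' q' i' j' where B': "is_biproduct p' q' i' j'" "tgt p' = tgt p" "tgt q' = src f"
    using biproduct_exists[of "tgt p" "src f"] f is_biproductD(1)[OF B] by (metis Src_Obj Tgt_Obj)
  note D = is_biproductD[OF B] is_biproductD[OF B'(1)] and S = is_biproduct_simps[OF B] is_biproduct_simps[OF B'(1)]
  have "inflation E ((i \<cdot> p' \<oplus> j \<cdot> (m \<cdot> q')) \<cdot> (i' \<cdot> f \<oplus> j'))"
    by (intro inflation_Cmp graph_inflation[OF B'(1)] sum_inflation[OF B'(1) B])
      (use f m m' B'(2-) D in simp_all)
  also have "(i \<cdot> p' \<oplus> j \<cdot> (m \<cdot> q')) \<cdot> (i' \<cdot> f \<oplus> j') = i \<cdot> f \<oplus> j \<cdot> m"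
    using f m m' B'(2-) D by (simp add: S)
  finally show ?thesis .
qed

lemma copair_deflation:
  assumes B: "is_biproduct p q i j" and f: "arr f" "src f = tgt p"
    and m: "deflation E m" "tgt m = tgt f" "src m = tgt q"
  shows "deflation E (f \<cdot> p \<oplus> m \<cdot> q)"
proof -
  note m' = deflation_Arr[OF m(1)]
  obtain p' q' i' j' where B': "is_biproduct p' q' i' j'" "tgt p' = tgt p" "tgt q' = tgt f"
    using biproduct_exists[of "tgt p" "tgt f"] f is_biproductD(1)[OF B] by (metis Tgt_Obj)
  note D = is_biproductD[OF B] is_biproductD[OF B'(1)] and S = is_biproduct_simps[OF B] is_biproduct_simps[OF B'(1)]
  have "deflation E ((f \<cdot> p' \<oplus> q') \<cdot> (i' \<cdot> p \<oplus> j' \<cdot> (m \<cdot> q)))"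
    by (intro deflation_Cmp cograph_deflation[OF B'(1)] sum_deflation[OF B B'(1)])
      (use f m m' B'(2-) D in simp_all)
  also have "(f \<cdot> p' \<oplus> q') \<cdot> (i' \<cdot> p \<oplus> j' \<cdot> (m \<cdot> q)) = f \<cdot> p \<oplus> m \<cdot> q"
    using f m m' B'(2-) D by (simp add: S)
  finally show ?thesis .
qed

text \<open>A deflation belongs to a conflation with some kernel; any other kernel of it is
  isomorphic to that one, and conflations are closed under isomorphism.\<close>

lemma kernel_conflation:
  assumes p: "deflation E p" and k: "is_kernel C i p"
  shows "(i, p) \<in> E"
proof -
  obtain f where f: "(f, p) \<in> E" using p by (auto simp: deflation_def)
  have kf: "is_kernel C f p" using conflation[OF f] by simp
  note K = is_kernelD[OF k] and F = is_kernelD[OF kf]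
  obtain h where h: "arr h" "src h = src i" "tgt h = src f" "f \<cdot> h = i"
    using is_kernel_lift[OF kf, of i] K by metis
  obtain h' where h': "arr h'" "src h' = src f" "tgt h' = src i" "i \<cdot> h' = f"
    using is_kernel_lift[OF k, of f] F by metis
  have "h' \<cdot> h = Idn C (src i)"
    by (rule kernel_mono[OF k]) (use h h' K F Cmp_eq_Cmp[OF h'(4), of h] in simp_all)
  moreover have "h \<cdot> h' = Idn C (src f)"
    by (rule kernel_mono[OF kf]) (use h h' K F Cmp_eq_Cmp[OF h(4), of h'] in simp_all)
  ultimately have "is_iso C h'" using h h' by (intro is_isoI[of h' h]) simp_all
  then show ?thesis using h' K F
    by (intro conflation_iso[OF f, of h' "Idn C (tgt i)" "Idn C (tgt p)"])
      (simp_all add: is_iso_Idn mem_Hom)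
qed

end

section \<open>Stable equality in a Frobenius category\<close>

context frobenius_category
begin

lemma injective_proj_inj: "injective C E J \<Longrightarrow> proj_inj C E J"
  and projective_proj_inj: "projective C E J \<Longrightarrow> proj_inj C E J"
  using projective_iff_injective by (auto simp: proj_inj_def)

lemma proj_inj_extend:
  assumes "proj_inj C E J" "inflation E m" "arr h" "src h = src m" "tgt h = J"
  obtains k where "arr k" "src k = tgt m" "tgt k = J" "k \<cdot> m = h"
  using assms unfolding proj_inj_def injective_def by (metis mem_Hom)

lemma proj_inj_lift:
  assumes "proj_inj C E J" "deflation E d" "arr h" "tgt h = tgt d" "src h = J"
  obtains k where "arr k" "src k = J" "tgt k = src d" "d \<cdot> k = h"
  using assms unfolding proj_inj_def projective_def by (metis mem_Hom)

text \<open>Injectivity passes to retracts by extending \<open>s h\<close> and composing with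
  \<open>r\<close>; projectivity comes along because the two notions agree.\<close>

lemma proj_inj_retract:
  assumes "proj_inj C E J" "arr s" "arr r" "tgt s = J" "src r = J" "src s = K" "tgt r = K"
    "r \<cdot> s = Idn C K"
  shows "proj_inj C E K"
proof (rule injective_proj_inj)
  show "injective C E K" unfolding injective_def
  proof (intro conjI allI impI)
    fix f h assume f: "inflation E f \<and> h \<in> Hom C (src f) K"
    then obtain k where k: "arr k" "src k = tgt f" "tgt k = J" "k \<cdot> f = s \<cdot> h"
      using proj_inj_extend[OF assms(1), of f "s \<cdot> h"] assms by (auto simp: mem_Hom)
    show "\<exists>k\<in>Hom C (tgt f) K. k \<cdot> f = h"
    proof (rule bexI)
      show "(r \<cdot> k) \<cdot> f = h"
        using f k assms inflation_Arr[of f] Cmp_eq_Cmp[OF assms(8), of h] by (simp add: mem_Hom)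
    qed (use k assms in \<open>simp add: mem_Hom\<close>)
  qed (use assms in auto)
qed

lemma injective_hull:
  assumes "X \<in> Obj C"
  obtains m where "inflation E m" "arr m" "src m = X" "proj_inj C E (tgt m)"
  using enough_injectives[OF assms] injective_proj_inj inflation_Arr by metis

lemma projective_cover:
  assumes "X \<in> Obj C"
  obtains d where "deflation E d" "arr d" "tgt d = X" "proj_inj C E (src d)"
  using enough_projectives[OF assms] projective_proj_inj deflation_Arr by metis

abbreviation stably_equal (infix "\<simeq>" 50) where "f \<simeq> g \<equiv> (f, g) \<in> stable_rel C E"

lemma stably_equalI:
  assumes "arr g" "arr a" "arr b" "proj_inj C E (tgt a)" "src a = src g"
    "src b = tgt a" "tgt b = tgt g" "f = g \<oplus> b \<cdot> a"
  shows "f \<simeq> g"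
proof -
  have "diff C f g = (g \<oplus> b \<cdot> a) \<oplus> Neg g" using assms by (simp add: diff_eq)
  also have "\<dots> = b \<cdot> a" using assms by (simp add: Add_assoc)
  finally show ?thesis using assms unfolding stable_rel_def mem_Hom by auto
qed

lemma stably_equalE:
  assumes "f \<simeq> g"
  obtains a b where "arr f" "arr g" "arr a" "arr b" "proj_inj C E (tgt a)"
    "src f = src g" "tgt f = tgt g" "src a = src g"
    "src b = tgt a" "tgt b = tgt g" "f = g \<oplus> b \<cdot> a"
proof -
  obtain J a b where 1: "arr f" "g \<in> Hom C (src f) (tgt f)" "proj_inj C E J"
    "a \<in> Hom C (src f) J" "b \<in> Hom C J (tgt f)" "diff C f g = b \<cdot> a"
    using assms by (auto simp: stable_rel_def)
  have "g \<oplus> b \<cdot> a = g \<oplus> (f \<oplus> Neg g)" using 1 by (simp add: mem_Hom diff_eq)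
  also have "\<dots> = f" using 1 by (simp add: mem_Hom)
  finally show thesis using 1(1-5) by (intro that[of a b]) (simp_all add: mem_Hom)
qed

text \<open>The map \<open>a\<close> extends along any inflation \<open>m\<close> out of the source,
  because its target is injective. Using one \<open>m\<close> for several stable equalities makes
  their differences addable.\<close>

lemma stably_equal_inflation:
  assumes "f \<simeq> g" "inflation E m" "src m = src f"
  obtains b where "arr b" "src b = tgt m" "tgt b = tgt g" "f = g \<oplus> b \<cdot> m"
proof -
  obtain a b where 1: "arr f" "arr g" "arr a" "arr b" "proj_inj C E (tgt a)"
    "src f = src g" "tgt f = tgt g" "src a = src g"
    "src b = tgt a" "tgt b = tgt g" "f = g \<oplus> b \<cdot> a"
    using assms(1) by (rule stably_equalE)
  obtain k where k: "arr k" "src k = tgt m" "tgt k = tgt a" "k \<cdot> m = a"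
    using proj_inj_extend[OF 1(5) assms(2), of a] 1 assms(3) by auto
  show thesis
    using 1(1-10) k inflation_Arr[OF assms(2)] by (intro that[of "b \<cdot> k"]) (simp_all add: 1(11))
qed

lemma stably_equal_deflation:
  assumes "f \<simeq> g" "deflation E d" "tgt d = tgt f"
  obtains a where "arr a" "src a = src g" "tgt a = src d" "f = g \<oplus> d \<cdot> a"
proof -
  obtain a b where 1: "arr f" "arr g" "arr a" "arr b" "proj_inj C E (tgt a)"
    "src f = src g" "tgt f = tgt g" "src a = src g"
    "src b = tgt a" "tgt b = tgt g" "f = g \<oplus> b \<cdot> a"
    using assms(1) by (rule stably_equalE)
  obtain k where k: "arr k" "src k = tgt a" "tgt k = src d" "d \<cdot> k = b"
    using proj_inj_lift[OF 1(5) assms(2), of b] 1 assms(3) by auto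
  have "d \<cdot> (k \<cdot> a) = b \<cdot> a" using Cmp_eq_Cmp[OF k(4), of a] 1 k deflation_Arr[OF assms(2)] by simp
  then show thesis
    using 1 k deflation_Arr[OF assms(2)] by (intro that[of "k \<cdot> a"]) simp_all
qed

lemma stably_equalD:
  assumes "f \<simeq> g"
  shows "arr f" "arr g" "src f = src g" "tgt f = tgt g"
  using assms stably_equalE by metis+

lemma stably_equal_refl: assumes f: "arr f" shows "f \<simeq> f"
proof -
  obtain m where "arr m" "src m = src f" "proj_inj C E (tgt m)"
    using injective_hull[of "src f"] f by auto
  then show ?thesis
    using f by (intro stably_equalI[of f m "Zero C (tgt m) (tgt f)"]) simp_all
qed

lemma stably_equal_sym: assumes "f \<simeq> g" shows "g \<simeq> f"
proof -
  obtain a b where 1: "arr f" "arr g" "arr a" "arr b" "proj_inj C E (tgt a)"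
    "src f = src g" "tgt f = tgt g" "src a = src g"
    "src b = tgt a" "tgt b = tgt g" "f = g \<oplus> b \<cdot> a"
    using assms(1) by (rule stably_equalE)
  show ?thesis
    using 1(1-10) by (intro stably_equalI[of f a "Neg b"]) (simp_all add: 1(11) Neg_Cmp Add_assoc)
qed

lemma stably_equal_trans: assumes "f \<simeq> g" "g \<simeq> h" shows "f \<simeq> h"
proof -
  note D = stably_equalD[OF assms(1)] stably_equalD[OF assms(2)]
  \<comment> \<open>Both differences are written through the same hull \<open>m\<close>, so their
    sum is again of this form.\<close>
  obtain m where m: "inflation E m" "arr m" "src m = src f" "proj_inj C E (tgt m)"
    using injective_hull[of "src f"] D by auto
  obtain b where b: "arr b" "src b = tgt m" "tgt b = tgt g" "f = g \<oplus> b \<cdot> m"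
    using stably_equal_inflation[OF assms(1) m(1,3)] by metis
  obtain b' where b': "arr b'" "src b' = tgt m" "tgt b' = tgt h" "g = h \<oplus> b' \<cdot> m"
    using stably_equal_inflation[OF assms(2) m(1)] m(3) D(3) by metis
  have "f = (h \<oplus> b' \<cdot> m) \<oplus> b \<cdot> m" using b(4) unfolding b'(4) .
  also have "\<dots> = h \<oplus> (b' \<oplus> b) \<cdot> m" using m b(1-3) b'(1-3) D by (simp add: Add_assoc)
  finally show ?thesis
    by (rule stably_equalI[rotated -1]) (use m b(1-3) b'(1-3) D in simp_all)
qed

lemma stably_equal_Cmp_left:
  assumes "f \<simeq> g" "arr h" "src h = tgt g"
  shows "h \<cdot> f \<simeq> h \<cdot> g"
proof -
  obtain a b where 1: "arr f" "arr g" "arr a" "arr b" "proj_inj C E (tgt a)"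
    "src f = src g" "tgt f = tgt g" "src a = src g"
    "src b = tgt a" "tgt b = tgt g" "f = g \<oplus> b \<cdot> a"
    using assms(1) by (rule stably_equalE)
  show ?thesis
    using 1(1-10) assms(2-) by (intro stably_equalI[of _ a "h \<cdot> b"]) (simp_all add: 1(11))
qed

lemma stably_equal_Cmp_right:
  assumes "f \<simeq> g" "arr h" "tgt h = src g"
  shows "f \<cdot> h \<simeq> g \<cdot> h"
proof -
  obtain a b where 1: "arr f" "arr g" "arr a" "arr b" "proj_inj C E (tgt a)"
    "src f = src g" "tgt f = tgt g" "src a = src g"
    "src b = tgt a" "tgt b = tgt g" "f = g \<oplus> b \<cdot> a"
    using assms(1) by (rule stably_equalE)
  show ?thesis
    using 1(1-10) assms(2-) by (intro stably_equalI[of _ "a \<cdot> h" b]) (simp_all add: 1(11))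
qed

sublocale stable: congruence C "stable_rel C E"
proof
  show "equiv (Arr C) (stable_rel C E)"
    by (intro equivI refl_onI symI transI)
      (auto intro: stably_equal_refl stably_equal_sym stably_equal_trans dest: stably_equalD)
next
  fix f f' g g' assume 1: "f \<simeq> f'" "g \<simeq> g'" "tgt f = src g"
  show "g \<cdot> f \<simeq> g' \<cdot> f'"
    by (rule stably_equal_trans[OF stably_equal_Cmp_right[OF 1(2)] stably_equal_Cmp_left[OF 1(1)]])
      (use 1 stably_equalD[OF 1(1)] stably_equalD[OF 1(2)] in simp_all)
qed (use stably_equalD in auto)

end

section \<open>The model structure\<close>

context frobenius_category
begin

abbreviation "St \<equiv> stable_cat C E"
abbreviation "scls \<equiv> stable_class C E"
abbreviation "weq \<equiv> stable_equivalence C E"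

lemma stable_category: "category St"
  unfolding stable_cat_def by (rule stable.quotient_category)

lemma stable_Arr: "\<alpha> \<in> Arr St \<longleftrightarrow> (\<exists>f\<in>Arr C. \<alpha> = scls f)"
  unfolding stable_cat_def stable_class_def by (rule stable.quotient_Arr)

lemma stable_simps [simp]:
  "Obj St = Obj C"
  "arr f \<Longrightarrow> scls f \<in> Arr St"
  "arr f \<Longrightarrow> Src St (scls f) = src f"
  "arr f \<Longrightarrow> Tgt St (scls f) = tgt f"
  "Idn St X = scls (Idn C X)"
  "\<lbrakk>arr f; arr g; tgt f = src g\<rbrakk> \<Longrightarrow> scls g \<cdot>\<^bsub>St\<^esub> scls f = scls (g \<cdot> f)"
  unfolding stable_cat_def stable_class_def by (simp_all add: stable.quotient_Cmp stable.quotient_Idn)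

lemma stable_class_eq_iff: "\<lbrakk>arr f; arr g\<rbrakk> \<Longrightarrow> scls f = scls g \<longleftrightarrow> f \<simeq> g"
  unfolding stable_class_def by (rule stable.class_eq_iff)

lemma stable_class_eqI: "f \<simeq> g \<Longrightarrow> scls f = scls g"
  using stable_class_eq_iff stably_equalD by metis

lemma stable_inverse_arrows_iff:
  assumes "arr f" "arr g"
  shows "inverse_arrows St (scls f) (scls g) \<longleftrightarrow>
    src g = tgt f \<and> tgt g = src f \<and> g \<cdot> f \<simeq> Idn C (src f) \<and> f \<cdot> g \<simeq> Idn C (tgt f)"
  using assms by (cases "src g = tgt f \<and> tgt g = src f")
    (simp_all add: inverse_arrows_def mem_Hom stable_class_eq_iff del: de_Morgan_conj, blast)

lemma stable_equivalence_Arr: "weq f \<Longrightarrow> arr f"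
  by (simp add: stable_equivalence_def)

lemma stable_equivalenceE:
  assumes "weq f"
  obtains g where "arr f" "arr g" "src g = tgt f" "tgt g = src f"
    "g \<cdot> f \<simeq> Idn C (src f)" "f \<cdot> g \<simeq> Idn C (tgt f)"
proof -
  from assms obtain \<gamma> where \<gamma>: "inverse_arrows St (scls f) \<gamma>" and f: "arr f"
    by (auto simp: stable_equivalence_def Defs.is_iso_def)
  then obtain g where "arr g" "\<gamma> = scls g"
    by (auto simp: inverse_arrows_def mem_Hom stable_Arr)
  with \<gamma> f that show thesis by (auto simp: stable_inverse_arrows_iff)
qed

lemma stable_equivalenceI:
  assumes "arr f" "arr g" "src g = tgt f" "tgt g = src f"
    "g \<cdot> f \<simeq> Idn C (src f)" "f \<cdot> g \<simeq> Idn C (tgt f)"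
  shows "weq f"
proof -
  have "inverse_arrows St (scls f) (scls g)" using assms by (simp add: stable_inverse_arrows_iff)
  then show ?thesis using assms(1) by (auto simp: stable_equivalence_def Defs.is_iso_def)
qed

lemma stable_equivalence_two_of_three:
  assumes "arr f" "arr g" "tgt f = src g"
    and w: "weq f \<and> weq g \<or>
      weq f \<and> weq (g \<cdot> f) \<or>
      weq g \<and> weq (g \<cdot> f)"
  shows "weq f \<and> weq g \<and> weq (g \<cdot> f)"
proof -
  interpret S: category St by (rule stable_category)
  have c: "scls g \<cdot>\<^bsub>St\<^esub> scls f = scls (g \<cdot> f)" "g \<cdot> f \<in> Arr C" using assms by simp_all
  show ?thesis
    using w S.is_iso_Cmp[of "scls f" "scls g"] S.is_iso_Cmp_cancel_left[of "scls g" "scls f"]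
      S.is_iso_Cmp_cancel_right[of "scls g" "scls f"] assms(1-3) c
    unfolding stable_equivalence_def by auto
qed

text \<open>The last equation makes \<open>s p\<close> stably equal to the identity, so
  \<open>s\<close> and \<open>p\<close> are stably inverse. In this equational form the criterion
  can be transported along pullbacks and pushouts.\<close>

lemma split_deflation_stable_equivalence:
  assumes "arr p" "arr s" "src s = tgt p" "tgt s = src p" "p \<cdot> s = Idn C (tgt p)"
    "arr a" "arr b" "src a = src p" "src b = tgt a" "tgt b = src p"
    "proj_inj C E (tgt a)" "s \<cdot> p \<oplus> b \<cdot> a = Idn C (src p)"
  shows "weq p" "weq s"
proof -
  have 1: "Idn C (src p) \<simeq> s \<cdot> p"
    using assms by (intro stably_equalI[of "s \<cdot> p" a b]) simp_all
  have 2: "p \<cdot> s \<simeq> Idn C (tgt p)" using assms stably_equal_refl by simp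
  show "weq p" "weq s"
    using stable_equivalenceI[of p s] stable_equivalenceI[of s p] stably_equal_sym[OF 1] 2 assms(1-4) by simp_all
qed

text \<open>A stable inverse \<open>g\<close> of \<open>p\<close> satisfies \<open>p g = 1\<close>
  only up to a map through a projective-injective object, and such a map lifts through the deflation
  \<open>p\<close>: correcting \<open>g\<close> by the lift gives a strict section.\<close>

lemma trivial_fibration_split:
  assumes p: "deflation E p" and w: "weq p"
  obtains s a b where "arr s" "src s = tgt p" "tgt s = src p" "p \<cdot> s = Idn C (tgt p)"
    "arr a" "arr b" "src a = src p" "src b = tgt a" "tgt b = src p"
    "proj_inj C E (tgt a)" "p \<cdot> b = Zero C (src b) (tgt p)" "s \<cdot> p \<oplus> b \<cdot> a = Idn C (src p)"
proof -
  obtain g where g: "arr p" "arr g" "src g = tgt p" "tgt g = src p"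
    "g \<cdot> p \<simeq> Idn C (src p)" "p \<cdot> g \<simeq> Idn C (tgt p)"
    using stable_equivalenceE[OF w] by metis
  obtain c where c: "arr c" "src c = src (p \<cdot> g)" "tgt c = src p" "Idn C (tgt p) = p \<cdot> g \<oplus> p \<cdot> c"
    using stably_equal_deflation[OF stably_equal_sym[OF g(6)] p] g by auto
  define s where "s = g \<oplus> c"
  have s: "arr s" "src s = tgt p" "tgt s = src p" "p \<cdot> s = Idn C (tgt p)"
    using g(1-4) c by (simp_all add: s_def)
  \<comment> \<open>Since \<open>p s = 1\<close> holds strictly, \<open>g p s\<close> is
    \<open>g\<close> itself, so the correction has not changed the stable class.\<close>
  have "(g \<cdot> p) \<cdot> s \<simeq> s" using stably_equal_Cmp_right[OF g(5), of s] s g(1) by simp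
  then have "g \<simeq> s" using g(1-4) s by simp
  then have "s \<cdot> p \<simeq> g \<cdot> p" by (rule stably_equal_Cmp_right[OF stably_equal_sym]) (use s g in simp_all)
  then have "Idn C (src p) \<simeq> s \<cdot> p" using g(5) stably_equal_trans stably_equal_sym by blast
  then obtain a b where ab: "arr a" "arr b" "proj_inj C E (tgt a)" "src a = src (s \<cdot> p)"
    "src b = tgt a" "tgt b = tgt (s \<cdot> p)" "Idn C (src p) = s \<cdot> p \<oplus> b \<cdot> a"
    by (rule stably_equalE)
  have ab': "src a = src p" "tgt b = src p" using ab s g by simp_all
  \<comment> \<open>Composing \<open>b\<close> with \<open>1 - s p\<close> gives
    \<open>p b' = 0\<close>; the product with \<open>a\<close> is unchanged because
    \<open>p b a = p - p s p = 0\<close>.\<close>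
  define b' where "b' = b \<oplus> Neg (s \<cdot> (p \<cdot> b))"
  have "p \<cdot> (s \<cdot> p \<oplus> b \<cdot> a) = p \<oplus> p \<cdot> (b \<cdot> a)"
    using s g(1) ab(1-6) ab' Cmp_eq_Cmp[OF s(4), of p] by simp
  then have "p \<oplus> p \<cdot> (b \<cdot> a) = p \<oplus> Zero C (src p) (tgt p)" using g(1) by (simp flip: ab(7))
  then have pba: "p \<cdot> (b \<cdot> a) = Zero C (src p) (tgt p)"
    by (rule Add_cancel_left) (use s g(1) ab(1-6) ab' in simp_all)
  have b': "arr b'" "src b' = tgt a" "tgt b' = src p"
    using ab(1-6) ab' s g(1) by (simp_all add: b'_def)
  have "p \<cdot> (s \<cdot> (p \<cdot> b)) = p \<cdot> b" using s g(1) ab(1-6) ab' Cmp_eq_Cmp[OF s(4), of "p \<cdot> b"] by simp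
  then have 1: "p \<cdot> b' = Zero C (src b') (tgt p)"
    using ab(1-6) ab' s g(1) b' unfolding b'_def by (simp add: Neg_Cmp)
  have "s \<cdot> (p \<cdot> (b \<cdot> a)) = Zero C (src p) (src p)" unfolding pba using s g(1) by simp
  then have 2: "b' \<cdot> a = b \<cdot> a"
    unfolding b'_def using ab(1-6) ab' s g(1) by (simp add: Neg_Cmp)
  show thesis
    using that[of s a b'] s ab ab' b' 1 2 by simp
qed

text \<open>Dually, the error in \<open>g i = 1\<close> extends along the inflation
  \<open>i\<close>, which gives a retraction \<open>r\<close>, and \<open>a\<close> is replaced by
  \<open>a (1 - i r)\<close> so that it kills \<open>i\<close>.\<close>

lemma trivial_cofibration_split:
  assumes i: "inflation E i" and w: "weq i"
  obtains r a b where "arr r" "src r = tgt i" "tgt r = src i" "r \<cdot> i = Idn C (src i)"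
    "arr a" "arr b" "src a = tgt i" "src b = tgt a" "tgt b = tgt i"
    "proj_inj C E (tgt a)" "a \<cdot> i = Zero C (src i) (tgt a)" "i \<cdot> r \<oplus> b \<cdot> a = Idn C (tgt i)"
proof -
  obtain g where g: "arr i" "arr g" "src g = tgt i" "tgt g = src i"
    "g \<cdot> i \<simeq> Idn C (src i)" "i \<cdot> g \<simeq> Idn C (tgt i)"
    using stable_equivalenceE[OF w] by metis
  obtain c where c: "arr c" "src c = tgt i" "tgt c = tgt (g \<cdot> i)" "Idn C (src i) = g \<cdot> i \<oplus> c \<cdot> i"
    using stably_equal_inflation[OF stably_equal_sym[OF g(5)] i] g by auto
  define r where "r = g \<oplus> c"
  have r: "arr r" "src r = tgt i" "tgt r = src i" "r \<cdot> i = Idn C (src i)"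
    using g(1-4) c by (simp_all add: r_def)
  have "r \<cdot> (i \<cdot> g) \<simeq> r" using stably_equal_Cmp_left[OF g(6), of r] r g(1) by simp
  then have "g \<simeq> r" using g(1-4) r by (simp add: Cmp_eq_Cmp[OF r(4)])
  then have "i \<cdot> r \<simeq> i \<cdot> g" by (rule stably_equal_Cmp_left[OF stably_equal_sym]) (use r g in simp_all)
  then have "Idn C (tgt i) \<simeq> i \<cdot> r" using g(6) stably_equal_trans stably_equal_sym by blast
  then obtain a b where ab: "arr a" "arr b" "proj_inj C E (tgt a)" "src a = src (i \<cdot> r)"
    "src b = tgt a" "tgt b = tgt (i \<cdot> r)" "Idn C (tgt i) = i \<cdot> r \<oplus> b \<cdot> a"
    by (rule stably_equalE)
  have ab': "src a = tgt i" "tgt b = tgt i" using ab r g by simp_all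
  define a' where "a' = a \<oplus> Neg (a \<cdot> (i \<cdot> r))"
  have "(i \<cdot> r \<oplus> b \<cdot> a) \<cdot> i = i \<oplus> b \<cdot> (a \<cdot> i)"
    using r g(1) ab(1-6) ab' by simp
  then have "i \<oplus> b \<cdot> (a \<cdot> i) = i \<oplus> Zero C (src i) (tgt i)" using g(1) by (simp flip: ab(7))
  then have pba: "b \<cdot> (a \<cdot> i) = Zero C (src i) (tgt i)"
    by (rule Add_cancel_left) (use r g(1) ab(1-6) ab' in simp_all)
  have a': "arr a'" "src a' = tgt i" "tgt a' = tgt a"
    using ab(1-6) ab' r g(1) by (simp_all add: a'_def)
  have 1: "a' \<cdot> i = Zero C (src i) (tgt a')"
    using ab(1-6) ab' r g(1) a' unfolding a'_def by (simp add: Neg_Cmp)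
  have "b \<cdot> (a \<cdot> (i \<cdot> r)) = (b \<cdot> (a \<cdot> i)) \<cdot> r" using ab(1-6) ab' r g(1) by simp
  also have "\<dots> = Zero C (tgt i) (tgt i)" unfolding pba using r g(1) by simp
  finally have 2: "b \<cdot> a' = b \<cdot> a"
    unfolding a'_def using ab(1-6) ab' r g(1) by (simp add: Neg_Cmp)
  show thesis
    using that[of r a' b] r ab ab' a' 1 2 by simp
qed

text \<open>The identity of the source of \<open>p\<close> is \<open>s p + b a\<close>. The lift is
  \<open>s g\<close> on the first part; on the second, \<open>a f\<close> extends to
  \<open>e\<close> along \<open>i\<close> because its target is injective, and \<open>b e\<close>
  does not disturb \<open>p h = g\<close> since \<open>p b = 0\<close>.\<close>

lemma lift_trivial_fibration:
  assumes i: "inflation E i" and p: "deflation E p" "weq p"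
    and f: "arr f" "src f = src i" "tgt f = src p"
    and g: "arr g" "src g = tgt i" "tgt g = tgt p" and sq: "p \<cdot> f = g \<cdot> i"
  obtains h where "arr h" "src h = tgt i" "tgt h = src p" "h \<cdot> i = f" "p \<cdot> h = g"
proof -
  note ar = inflation_Arr[OF i] deflation_Arr[OF p(1)]
  obtain s a b where s: "arr s" "src s = tgt p" "tgt s = src p" "p \<cdot> s = Idn C (tgt p)"
    "arr a" "arr b" "src a = src p" "src b = tgt a" "tgt b = src p"
    "proj_inj C E (tgt a)" "p \<cdot> b = Zero C (src b) (tgt p)" "s \<cdot> p \<oplus> b \<cdot> a = Idn C (src p)"
    using trivial_fibration_split[OF p] by metis
  obtain e where e: "arr e" "src e = tgt i" "tgt e = tgt a" "e \<cdot> i = a \<cdot> f"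
    using proj_inj_extend[OF s(10) i, of "a \<cdot> f"] f s by auto
  have "(s \<cdot> p \<oplus> b \<cdot> a) \<cdot> f = f" using s(12) f by simp
  then have "s \<cdot> (p \<cdot> f) \<oplus> b \<cdot> (a \<cdot> f) = f" using s(1-9) f ar by simp
  then have "(s \<cdot> g \<oplus> b \<cdot> e) \<cdot> i = f" using s(1-9) g f e ar sq by simp
  moreover have "p \<cdot> (s \<cdot> g \<oplus> b \<cdot> e) = g"
    using s(1-9) g e ar by (simp add: Cmp_eq_Cmp[OF s(4)] Cmp_eq_Cmp[OF s(11)])
  ultimately show thesis using s(1-9) g e ar by (intro that[of "s \<cdot> g \<oplus> b \<cdot> e"]) simp_all
qed

text \<open>Dually, the lift is \<open>f r + e a\<close>, where \<open>e\<close> lifts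
  \<open>g b\<close> through the deflation \<open>p\<close> by projectivity and
  \<open>a i = 0\<close> keeps \<open>h i = f\<close>.\<close>

lemma lift_trivial_cofibration:
  assumes i: "inflation E i" "weq i" and p: "deflation E p"
    and f: "arr f" "src f = src i" "tgt f = src p"
    and g: "arr g" "src g = tgt i" "tgt g = tgt p" and sq: "p \<cdot> f = g \<cdot> i"
  obtains h where "arr h" "src h = tgt i" "tgt h = src p" "h \<cdot> i = f" "p \<cdot> h = g"
proof -
  note ar = inflation_Arr[OF i(1)] deflation_Arr[OF p]
  obtain r a b where r: "arr r" "src r = tgt i" "tgt r = src i" "r \<cdot> i = Idn C (src i)"
    "arr a" "arr b" "src a = tgt i" "src b = tgt a" "tgt b = tgt i"
    "proj_inj C E (tgt a)" "a \<cdot> i = Zero C (src i) (tgt a)" "i \<cdot> r \<oplus> b \<cdot> a = Idn C (tgt i)"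
    using trivial_cofibration_split[OF i] by metis
  obtain e where e: "arr e" "src e = tgt a" "tgt e = src p" "p \<cdot> e = g \<cdot> b"
    using proj_inj_lift[OF r(10) p, of "g \<cdot> b"] g r by auto
  have "g \<cdot> (i \<cdot> r \<oplus> b \<cdot> a) = g" using r(12) g by simp
  then have "(g \<cdot> i) \<cdot> r \<oplus> (g \<cdot> b) \<cdot> a = g" using r(1-9) g ar by simp
  then have "(p \<cdot> f) \<cdot> r \<oplus> (p \<cdot> e) \<cdot> a = g" by (simp only: sq e(4))
  then have "p \<cdot> (f \<cdot> r \<oplus> e \<cdot> a) = g" using r(1-9) g f e(1-3) ar by simp
  moreover have "(f \<cdot> r \<oplus> e \<cdot> a) \<cdot> i = f"
    using r(1-9,11) f e(1-3) ar by simp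
  ultimately show thesis using r(1-9) f e ar by (intro that[of "f \<cdot> r \<oplus> e \<cdot> a"]) simp_all
qed

text \<open>The splitting pulls back: the new section is (s g, 1), the new \<open>b\<close> is (b,
  0), a compatible pair since \<open>p b = 0\<close>, and \<open>a\<close> is composed with the
  projection \<open>x\<close>.\<close>

lemma trivial_fibration_pullback:
  assumes p: "deflation E p" "weq p" and pb: "is_pullback C p g x y"
  shows "weq y"
proof -
  note P = is_pullbackD[OF pb]
  obtain s a b where s: "arr s" "src s = tgt p" "tgt s = src p" "p \<cdot> s = Idn C (tgt p)"
    "arr a" "arr b" "src a = src p" "src b = tgt a" "tgt b = src p"
    "proj_inj C E (tgt a)" "p \<cdot> b = Zero C (src b) (tgt p)" "s \<cdot> p \<oplus> b \<cdot> a = Idn C (src p)"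
    using trivial_fibration_split[OF p] by metis
  obtain s' where s': "arr s'" "src s' = src g" "tgt s' = src y" "x \<cdot> s' = s \<cdot> g" "y \<cdot> s' = Idn C (src g)"
    using is_pullback_pair[OF pb, of "s \<cdot> g" "Idn C (src g)"] s(1-4) P(1-8) Cmp_eq_Cmp[OF s(4), of g] by auto
  obtain b' where b': "arr b'" "src b' = tgt a" "tgt b' = src y" "x \<cdot> b' = b" "y \<cdot> b' = Zero C (tgt a) (src g)"
    using is_pullback_pair[OF pb, of b "Zero C (tgt a) (src g)"] s(5-11) P(1-8) by auto
  have "s \<cdot> (p \<cdot> x) \<oplus> b \<cdot> (a \<cdot> x) = x"
    using arg_cong[OF s(12), of "\<lambda>u. u \<cdot> x"] s(1-9) P(1-8) by simp
  then have "s \<cdot> (g \<cdot> y) \<oplus> b \<cdot> (a \<cdot> x) = x" by (simp only: P(9))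
  then have eq: "s' \<cdot> y \<oplus> b' \<cdot> (a \<cdot> x) = Idn C (src y)"
    using s(1-9) s'(1-3) b'(1-3) P(1-8) Cmp_eq_Cmp[OF s'(4), of y] Cmp_eq_Cmp[OF s'(5), of y]
      Cmp_eq_Cmp[OF b'(4), of "a \<cdot> x"] Cmp_eq_Cmp[OF b'(5), of "a \<cdot> x"]
    by - (rule is_pullback_ext[OF pb], simp_all)
  show ?thesis
    by (rule split_deflation_stable_equivalence(1)[of y s' "a \<cdot> x" b'])
      (use s(1-10) s' b' P(1-8) eq in simp_all)
qed

text \<open>The splitting pushes out: the new retraction is (g r, 1), the new \<open>a\<close> is
  (a, 0), and \<open>b\<close> is followed by \<open>x\<close>.\<close>

lemma trivial_cofibration_pushout:
  assumes i: "inflation E i" "weq i" and po: "is_pushout C i g x y"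
  shows "weq y"
proof -
  note P = is_pushoutD[OF po]
  obtain r a b where r: "arr r" "src r = tgt i" "tgt r = src i" "r \<cdot> i = Idn C (src i)"
    "arr a" "arr b" "src a = tgt i" "src b = tgt a" "tgt b = tgt i"
    "proj_inj C E (tgt a)" "a \<cdot> i = Zero C (src i) (tgt a)" "i \<cdot> r \<oplus> b \<cdot> a = Idn C (tgt i)"
    using trivial_cofibration_split[OF i] by metis
  obtain r' where r': "arr r'" "tgt r' = tgt g" "src r' = tgt y" "r' \<cdot> x = g \<cdot> r" "r' \<cdot> y = Idn C (tgt g)"
    using is_pushout_copair[OF po, of "g \<cdot> r" "Idn C (tgt g)"] r(1-4) P(1-8) by auto
  obtain a' where a': "arr a'" "tgt a' = tgt a" "src a' = tgt y" "a' \<cdot> x = a" "a' \<cdot> y = Zero C (tgt g) (tgt a)"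
    using is_pushout_copair[OF po, of a "Zero C (tgt g) (tgt a)"] r(5-11) P(1-8) by auto
  have "(x \<cdot> i) \<cdot> r \<oplus> (x \<cdot> b) \<cdot> a = x"
    using arg_cong[OF r(12), of "\<lambda>u. x \<cdot> u"] r(1-9) P(1-8) by simp
  then have "(y \<cdot> g) \<cdot> r \<oplus> (x \<cdot> b) \<cdot> a = x" by (simp only: P(9))
  then have eq: "y \<cdot> r' \<oplus> (x \<cdot> b) \<cdot> a' = Idn C (tgt y)"
    using r(1-9) r' a' P(1-8)
    by - (rule is_pushout_ext[OF po], simp_all)
  show ?thesis
    by (rule split_deflation_stable_equivalence(2)[of r' y a' "x \<cdot> b"])
      (use r(1-10) r' a' P(1-8) eq in simp_all)
qed

text \<open>The hull \<open>m\<close> of the source turns (f, m) into an inflation whatever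
  \<open>f\<close> is, and the projection away from a projective-injective summand is a trivial
  fibration.\<close>

lemma factor_trivial_fibration:
  assumes f: "arr f"
  obtains i p where "inflation E i" "deflation E p" "weq p" "tgt i = src p" "f = p \<cdot> i"
proof -
  obtain m where m: "inflation E m" "arr m" "src m = src f" "proj_inj C E (tgt m)"
    using injective_hull[of "src f"] f by auto
  obtain p q i j where B: "is_biproduct p q i j" "tgt p = tgt f" "tgt q = tgt m"
    using biproduct_exists[of "tgt f" "tgt m"] f m(2) by (metis Tgt_Obj)
  note D = is_biproductD[OF B(1)] and S = is_biproduct_simps[OF B(1)]
  have "inflation E (i \<cdot> f \<oplus> j \<cdot> m)" using f m B by (intro pair_inflation[OF B(1)]) simp_all
  moreover have "weq p"
    by (rule split_deflation_stable_equivalence(1)[of p i q j]) (use D B(2-) m in simp_all)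
  moreover have "f = p \<cdot> (i \<cdot> f \<oplus> j \<cdot> m)" using f m D B(2-) by (simp add: S)
  ultimately show thesis
    using D(1-9) B(2-) f m by (intro that[of "i \<cdot> f \<oplus> j \<cdot> m" p] biproduct_inflation(3)[OF B(1)]) simp_all
qed

text \<open>Dually, a projective cover \<open>d\<close> of the target makes \<open>f p + d q\<close>
  a deflation, and the inclusion of the source is a trivial cofibration.\<close>

lemma factor_trivial_cofibration:
  assumes f: "arr f"
  obtains i p where "inflation E i" "weq i" "deflation E p" "tgt i = src p" "f = p \<cdot> i"
proof -
  obtain d where d: "deflation E d" "arr d" "tgt d = tgt f" "proj_inj C E (src d)"
    using projective_cover[of "tgt f"] f by auto
  obtain p q i j where B: "is_biproduct p q i j" "tgt p = src f" "tgt q = src d"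
    using biproduct_exists[of "src f" "src d"] f d(2) by (metis Src_Obj)
  note D = is_biproductD[OF B(1)] and S = is_biproduct_simps[OF B(1)]
  have "deflation E (f \<cdot> p \<oplus> d \<cdot> q)" using f d B by (intro copair_deflation[OF B(1)]) simp_all
  moreover have "weq i"
    by (rule split_deflation_stable_equivalence(2)[of p i q j]) (use D B(2-) d in simp_all)
  moreover have "f = (f \<cdot> p \<oplus> d \<cdot> q) \<cdot> i" using f d D B(2-) by simp
  ultimately show thesis
    using D(1-9) B(2-) f d by (intro that[of i "f \<cdot> p \<oplus> d \<cdot> q"] biproduct_inflation(1)[OF B(1)]) simp_all
qed

lemma frobenius_model_simps [simp]:
  "Cof (frobenius_model C E) = {f. inflation E f}" "Fib (frobenius_model C E) = {f. deflation E f}"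
  "Weq (frobenius_model C E) = {f. weq f}"
  by (simp_all add: frobenius_model_def)

lemma frobenius_model_structure: "classical_model_structure C E (frobenius_model C E)"
proof (unfold_locales; (unfold frobenius_model_simps Int_iff mem_Collect_eq)?)
  fix f A X i B p Y g
  assume 1: "f \<in> Hom C A X" "i \<in> Hom C A B" "p \<in> Hom C X Y" "g \<in> Hom C B Y" "p \<cdot> f = g \<cdot> i"
    and "inflation E i \<and> deflation E p \<and> weq p \<or>
      (inflation E i \<and> weq i) \<and> deflation E p"
  from this(6) show "\<exists>h\<in>Hom C B X. h \<cdot> i = f \<and> p \<cdot> h = g"
  proof (elim disjE conjE)
    assume "inflation E i" "deflation E p" "weq p"
    then obtain h where "h \<in> Hom C B X" "h \<cdot> i = f" "p \<cdot> h = g"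
      using lift_trivial_fibration[of i p f g] 1 unfolding mem_Hom by metis
    then show ?thesis by blast
  next
    assume "inflation E i" "weq i" "deflation E p"
    then obtain h where "h \<in> Hom C B X" "h \<cdot> i = f" "p \<cdot> h = g"
      using lift_trivial_cofibration[of i p f g] 1 unfolding mem_Hom by metis
    then show ?thesis by blast
  qed
next
  fix f assume "arr f"
  then show "\<exists>i p. inflation E i \<and> (deflation E p \<and> weq p) \<and> tgt i = src p \<and> f = p \<cdot> i"
    using factor_trivial_fibration by metis
next
  fix f assume "arr f"
  then show "\<exists>i p. (inflation E i \<and> weq i) \<and> deflation E p \<and> tgt i = src p \<and> f = p \<cdot> i"
    using factor_trivial_cofibration by metis
next
  show "{f. weq f} \<subseteq> Arr C" using stable_equivalence_Arr by blast
next
  fix f g assume "arr f" "arr g" "tgt f = src g"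
    "weq f \<and> weq g \<or>
      weq f \<and> weq (g \<cdot> f) \<or>
      weq g \<and> weq (g \<cdot> f)"
  then show "weq f \<and> weq g \<and> weq (g \<cdot> f)"
    by (rule stable_equivalence_two_of_three)
qed (use trivial_fibration_pullback trivial_cofibration_pushout inflation_pushout deflation_pullback
    inflation_Cmp deflation_Cmp in blast)+

end

section \<open>The homotopy category\<close>

text \<open>The extension of \<open>F\<close> to zigzags. The inverse picked by \<open>SOME\<close>
  is meaningful once \<open>F\<close> inverts the arrow; the starting object is recorded for the
  sake of the empty zigzag.\<close>

fun zz_eval ::
  "('o, 'm, 'y) cat_scheme \<Rightarrow> ('p, 'n, 'z) cat_scheme \<Rightarrow> ('o, 'm, 'p, 'n) ftr \<Rightarrow> 'o \<Rightarrow> 'm step list \<Rightarrow> 'n" where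
  "zz_eval C D F X [] = Idn D (OMap F X)"
| "zz_eval C D F X (Fwd f # s) = zz_eval C D F (Tgt C f) s \<cdot>\<^bsub>D\<^esub> AMap F f"
| "zz_eval C D F X (Bwd w # s) =
    zz_eval C D F (Src C w) s \<cdot>\<^bsub>D\<^esub> (SOME k. inverse_arrows D (AMap F w) k)"

locale localization = category C
  for C :: "('o, 'm, 'z) cat_scheme" (structure) and W :: "'m set" +
  assumes W_Arr: "W \<subseteq> Arr C"
begin

abbreviation "Zz \<equiv> zigzag_cat C W"
abbreviation "Loc \<equiv> quotient_cat Zz (gz_rel C W)"

lemma zigzag_Obj: "zigzag C W X s Y \<Longrightarrow> X \<in> Obj C \<and> Y \<in> Obj C"
proof (induction s arbitrary: X)
  case (Cons a s)
  then show ?case using W_Arr by (cases a) auto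
qed simp

lemma zigzag_append: "\<lbrakk>zigzag C W X s Y; zigzag C W Y t Z\<rbrakk> \<Longrightarrow> zigzag C W X (s @ t) Z"
proof (induction s arbitrary: X)
  case (Cons a s)
  then show ?case by (cases a) auto
qed simp

lemma zigzag_cat_simps [simp]:
  "Obj Zz = Obj C" "(X, s, Y) \<in> Arr Zz \<longleftrightarrow> zigzag C W X s Y"
  "Src Zz (X, s, Y) = X" "Tgt Zz (X, s, Y) = Y" "Idn Zz X = (X, [], X)"
  "(Y', t, Z) \<cdot>\<^bsub>Zz\<^esub> (X, s, Y) = (X, s @ t, Z)"
  by (simp_all add: zigzag_cat_def)

lemma zigzag_category: "category Zz"
proof
  fix f X Y g Z assume "f \<in> Hom Zz X Y" "g \<in> Hom Zz Y Z"
  then show "g \<cdot>\<^bsub>Zz\<^esub> f \<in> Hom Zz X Z"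
    by (cases f; cases g) (auto simp: mem_Hom intro: zigzag_append)
next
  fix f W' X g Y h Z assume "f \<in> Hom Zz W' X" "g \<in> Hom Zz X Y" "h \<in> Hom Zz Y Z"
  then show "(h \<cdot>\<^bsub>Zz\<^esub> g) \<cdot>\<^bsub>Zz\<^esub> f = h \<cdot>\<^bsub>Zz\<^esub> g \<cdot>\<^bsub>Zz\<^esub> f"
    by (cases f; cases g; cases h) simp
qed (auto simp: mem_Hom dest: zigzag_Obj)

lemma gz_eqD:
  "gz_eq C W a b \<Longrightarrow> a \<in> Arr Zz \<and> b \<in> Arr Zz \<and> Src Zz a = Src Zz b \<and> Tgt Zz a = Tgt Zz b"
proof (induction rule: gz_eq.induct)
  case (cong a a' b b')
  interpret Z: category Zz by (rule zigzag_category)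
  show ?case using cong by simp
qed (use W_Arr in auto)

sublocale gz: congruence Zz "gz_rel C W"
proof -
  interpret Z: category Zz by (rule zigzag_category)
  show "congruence Zz (gz_rel C W)"
  proof
    show "equiv (Arr Zz) (gz_rel C W)"
      by (intro equivI refl_onI symI transI)
        (auto simp: gz_rel_def dest: gz_eqD intro: gz_eq.refl gz_eq.sym gz_eq.trans)
  qed (auto simp: gz_rel_def dest: gz_eqD intro: gz_eq.cong)
qed

definition loc :: "'m \<Rightarrow> ('o, 'm) ho_arr" where
  "loc f = gz_rel C W `` {(src f, [Fwd f], tgt f)}"

lemma zz_class_Cmp:
  "\<lbrakk>zigzag C W X s Y; zigzag C W Y t Z\<rbrakk> \<Longrightarrow>
    gz_rel C W `` {(Y, t, Z)} \<cdot>\<^bsub>Loc\<^esub> gz_rel C W `` {(X, s, Y)} = gz_rel C W `` {(X, s @ t, Z)}"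
  using gz.quotient_Cmp[of "(X, s, Y)" "(Y, t, Z)"] by simp

lemma zz_class_eqI: "gz_eq C W a b \<Longrightarrow> gz_rel C W `` {a} = gz_rel C W `` {b}"
  using equiv_class_eq[OF gz.equiv, of a b] by (simp add: gz_rel_def)

lemma loc_simps:
  "arr f \<Longrightarrow> loc f \<in> Arr Loc" "arr f \<Longrightarrow> Src Loc (loc f) = src f"
  "arr f \<Longrightarrow> Tgt Loc (loc f) = tgt f"
  "X \<in> Obj C \<Longrightarrow> Idn Loc X = loc (Idn C X)"
  "\<lbrakk>arr f; arr g; tgt f = src g\<rbrakk> \<Longrightarrow> loc g \<cdot>\<^bsub>Loc\<^esub> loc f = loc (g \<cdot> f)"
  using zz_class_eqI[OF gz_eq.Fwd_Idn[of X C W]] zz_class_eqI[OF gz_eq.Fwd_Cmp[of f C g W]]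
    zz_class_Cmp[of "src f" "[Fwd f]" "tgt f" "[Fwd g]" "tgt g"]
  by (simp_all add: loc_def gz.quotient_Idn)

lemma loc_Bwd:
  assumes "w \<in> W"
  shows "inverse_arrows Loc (loc w) (gz_rel C W `` {(tgt w, [Bwd w], src w)})"
  using assms W_Arr zz_class_eqI[OF gz_eq.Fwd_Bwd[of w W C]] zz_class_eqI[OF gz_eq.Bwd_Fwd[of w W C]]
    zz_class_Cmp[of "src w" "[Fwd w]" "tgt w" "[Bwd w]" "src w"]
    zz_class_Cmp[of "tgt w" "[Bwd w]" "src w" "[Fwd w]" "tgt w"]
  by (auto simp: inverse_arrows_def mem_Hom loc_def gz.quotient_Idn)

lemma loc_Arr_cases:
  assumes "\<alpha> \<in> Arr Loc"
  obtains X s Y where "zigzag C W X s Y" "\<alpha> = gz_rel C W `` {(X, s, Y)}"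
  using assms by (auto simp: gz.quotient_Arr)

context
  fixes D :: "('p, 'n, 'y) cat_scheme" and F
  assumes F: "is_functor C D F" and inv: "\<And>w. w \<in> W \<Longrightarrow> Defs.is_iso D (AMap F w)"
begin

interpretation D: category D by (rule is_functorD(2)[OF F])

lemma zz_eval_inverse: "w \<in> W \<Longrightarrow> inverse_arrows D (AMap F w) (SOME k. inverse_arrows D (AMap F w) k)"
  using inv[of w] by (auto simp: Defs.is_iso_def intro: someI)

lemma zz_eval_Hom: "zigzag C W X s Y \<Longrightarrow> zz_eval C D F X s \<in> Hom D (OMap F X) (OMap F Y)"
proof (induction s arbitrary: X)
  case Nil
  then show ?case by (auto simp: mem_Hom is_functorD[OF F])
next
  case (Cons a s)
  show ?case
  proof (cases a)
    case (Fwd f)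
    with Cons show ?thesis by (auto simp: mem_Hom is_functorD[OF F])
  next
    case (Bwd w)
    then have w: "w \<in> W" "arr w" "tgt w = X" using Cons.prems W_Arr by auto
    show ?thesis
      using D.inverse_arrowsD[OF zz_eval_inverse[OF w(1)]] Cons Bwd w by (simp add: mem_Hom is_functorD[OF F])
  qed
qed

lemma zz_eval_append:
  "\<lbrakk>zigzag C W X s Y; zigzag C W Y t Z\<rbrakk> \<Longrightarrow>
    zz_eval C D F X (s @ t) = zz_eval C D F Y t \<cdot>\<^bsub>D\<^esub> zz_eval C D F X s"
proof (induction s arbitrary: X)
  case Nil
  then show ?case using zz_eval_Hom[of Y t Z] by (auto simp: mem_Hom)
next
  case (Cons a s)
  note t = zz_eval_Hom[OF Cons.prems(2)]
  show ?case
  proof (cases a)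
    case (Fwd f)
    with Cons.prems zz_eval_Hom[of "tgt f" s Y] t show ?thesis
      by (auto simp: mem_Hom is_functorD[OF F] Cons.IH)
  next
    case (Bwd w)
    then have w: "w \<in> W" "arr w" "tgt w = X" "zigzag C W (src w) s Y"
      using Cons.prems W_Arr by auto
    show ?thesis
      using D.inverse_arrowsD[OF zz_eval_inverse[OF w(1)]] Cons.IH[OF w(4) Cons.prems(2)] Bwd w(2-4)
        zz_eval_Hom[OF w(4)] t
      by (simp add: mem_Hom is_functorD[OF F])
  qed
qed

text \<open>Induction over the generating relations: each of them holds after evaluation, and
  evaluation turns concatenation into composition.\<close>

lemma gz_eq_zz_eval:
  "gz_eq C W a b \<Longrightarrow> zz_eval C D F (fst a) (fst (snd a)) = zz_eval C D F (fst b) (fst (snd b))"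
proof (induction rule: gz_eq.induct)
  case (cong a a' b b')
  obtain X s Y X' s' Y' where a: "a = (X, s, Y)" "a' = (X', s', Y')" by (cases a, cases a')
  obtain U t V U' t' V' where b: "b = (U, t, V)" "b' = (U', t', V')" by (cases b, cases b')
  have z: "zigzag C W X s Y" "zigzag C W X' s' Y'" "zigzag C W U t V" "zigzag C W U' t' V'"
    "X = X'" "Y = Y'" "U = U'" "V = V'" "Y = U"
    using gz_eqD[OF cong.hyps(1)] gz_eqD[OF cong.hyps(2)] cong.hyps(3) a b by auto
  then show ?case using cong.IH a b zz_eval_append[of X s Y t V] zz_eval_append[of X' s' Y' t' V'] by simp
next
  case (Fwd_Bwd w)
  then show ?case using D.inverse_arrowsD[OF zz_eval_inverse[OF Fwd_Bwd]] W_Arr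
    by (auto simp: is_functorD[OF F])
next
  case (Bwd_Fwd w)
  then show ?case using D.inverse_arrowsD[OF zz_eval_inverse[OF Bwd_Fwd]] W_Arr
    by (auto simp: is_functorD[OF F])
qed (simp_all add: is_functorD[OF F])

text \<open>This bounds the localization from below: arrows separated by a functor that inverts
  \<open>W\<close> stay distinct in it.\<close>

lemma loc_eq_imp_functor_eq:
  assumes "arr f" "arr g" "loc f = loc g"
  shows "AMap F f = AMap F g"
proof -
  have "gz_eq C W (src f, [Fwd f], tgt f) (src g, [Fwd g], tgt g)"
    using assms gz.class_eq_iff[of "(src f, [Fwd f], tgt f)" "(src g, [Fwd g], tgt g)"]
    by (simp add: loc_def gz_rel_def)
  from gz_eq_zz_eval[OF this] show ?thesis using assms by (simp add: is_functorD[OF F])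
qed

end

end

section \<open>The localization at the stable equivalences compared with the stable category\<close>

context frobenius_category
begin

abbreviation "FM \<equiv> frobenius_model C E"
abbreviation "Ho \<equiv> ho_cat C FM"
abbreviation "hcls \<equiv> ho_class C FM"

sublocale gz: localization C "{f. weq f}"
  by unfold_locales (use stable_equivalence_Arr in auto)

lemma ho_cat_eq: "Ho = gz.Loc"
  by (simp add: ho_cat_def)

lemma ho_class_eq: "hcls f = gz.loc f"
  by (simp add: ho_class_def gz.loc_def)

lemma ho_category: "category Ho"
  unfolding ho_cat_eq by (rule gz.gz.quotient_category)

lemma ho_simps [simp]:
  "Obj Ho = Obj C"
  "arr f \<Longrightarrow> hcls f \<in> Arr Ho"
  "arr f \<Longrightarrow> Src Ho (hcls f) = src f"
  "arr f \<Longrightarrow> Tgt Ho (hcls f) = tgt f"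
  "X \<in> Obj C \<Longrightarrow> Idn Ho X = hcls (Idn C X)"
  "\<lbrakk>arr f; arr g; tgt f = src g\<rbrakk> \<Longrightarrow> hcls g \<cdot>\<^bsub>Ho\<^esub> hcls f = hcls (g \<cdot> f)"
  unfolding ho_cat_eq ho_class_eq by (simp_all add: gz.loc_simps)

text \<open>If \<open>f = g + b a\<close> with \<open>b\<close> defined on \<open>J\<close>, then \<open>f\<close> and \<open>g\<close> are the composites of \<open>(g, a)\<close>
  with \<open>(1, b)\<close> and \<open>(1, 0)\<close> from \<open>Y \<oplus> J\<close> to \<open>Y\<close>, and these have a common section, which is
  invertible in the localization.\<close>

lemma stably_equal_imp_ho_class_eq:
  assumes "f \<simeq> g"
  shows "hcls f = hcls g"
proof -
  interpret H: category Ho by (rule ho_category)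
  obtain a b where 1: "arr f" "arr g" "arr a" "arr b" "proj_inj C E (tgt a)"
    "src f = src g" "tgt f = tgt g" "src a = src g"
    "src b = tgt a" "tgt b = tgt g" "f = g \<oplus> b \<cdot> a"
    using assms by (rule stably_equalE)
  obtain p q i j where B: "is_biproduct p q i j" "tgt p = tgt g" "tgt q = tgt a"
    using biproduct_exists[of "tgt g" "tgt a"] 1(2,3) by (metis Tgt_Obj)
  note D = is_biproductD[OF B(1)] and S = is_biproduct_simps[OF B(1)]
  have "weq i"
    by (rule split_deflation_stable_equivalence(2)[of p i q j]) (use D B(2-) 1 in simp_all)
  then have iso: "Defs.is_iso Ho (hcls i)"
    using gz.loc_Bwd[of i] unfolding ho_cat_eq ho_class_eq by (auto simp: Defs.is_iso_def)
  have "hcls p = hcls (p \<oplus> b \<cdot> q)"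
    by (rule H.iso_cancel_right[OF iso]) (use D B(2-) 1(1-10) in simp_all)
  then have "hcls p \<cdot>\<^bsub>Ho\<^esub> hcls (i \<cdot> g \<oplus> j \<cdot> a) = hcls (p \<oplus> b \<cdot> q) \<cdot>\<^bsub>Ho\<^esub> hcls (i \<cdot> g \<oplus> j \<cdot> a)"
    by simp
  moreover have "p \<cdot> (i \<cdot> g \<oplus> j \<cdot> a) = g" "(p \<oplus> b \<cdot> q) \<cdot> (i \<cdot> g \<oplus> j \<cdot> a) = f"
    using D B(2-) 1(1-10) by (simp_all add: S 1(11))
  ultimately show ?thesis using D B(2-) 1(1-10) by (simp del: Cmp_Add_simp Add_Cmp_simp)
qed

definition stable_functor :: "('o, 'm, 'o, 'm set) ftr" where
  "stable_functor = \<lparr>OMap = \<lambda>X. X, AMap = scls\<rparr>"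

lemma stable_functor: "is_functor C St stable_functor"
  by (rule is_functorI) (simp_all add: stable_functor_def category_axioms stable_category)

text \<open>One direction evaluates zigzags in the stable category, where stable equivalences are
  invertible; the other is \<open>stably_equal_imp_ho_class_eq\<close>.\<close>

lemma ho_class_eq_iff:
  assumes "arr f" "arr g"
  shows "hcls f = hcls g \<longleftrightarrow> f \<simeq> g"
proof
  have inv: "Defs.is_iso St (AMap stable_functor w)" if "w \<in> {f. weq f}" for w
    using that by (simp add: stable_functor_def stable_equivalence_def)
  assume "hcls f = hcls g"
  then have "AMap stable_functor f = AMap stable_functor g"
    unfolding ho_class_eq using assms
    by (intro gz.loc_eq_imp_functor_eq[OF stable_functor inv])
  then show "f \<simeq> g" using assms by (simp add: stable_functor_def stable_class_eq_iff)
qed (rule stably_equal_imp_ho_class_eq)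

lemma stable_equivalence_imp_ho_inverse:
  assumes "weq w"
  obtains g where "arr g" "src g = tgt w" "tgt g = src w" "inverse_arrows Ho (hcls w) (hcls g)"
proof -
  interpret H: category Ho by (rule ho_category)
  obtain g where g: "arr w" "arr g" "src g = tgt w" "tgt g = src w"
    "g \<cdot> w \<simeq> Idn C (src w)" "w \<cdot> g \<simeq> Idn C (tgt w)"
    using stable_equivalenceE[OF assms] by metis
  have "inverse_arrows Ho (hcls w) (hcls g)"
    using g by (intro H.inverse_arrowsI) (simp_all add: stably_equal_imp_ho_class_eq)
  with g that show thesis by blast
qed

text \<open>By uniqueness of inverses, the formal inverse of a stable equivalence is the class of a
  stable inverse in \<open>C\<close>; hence every zigzag collapses to one forward arrow.\<close>

lemma zigzag_ho_class:
  "zigzag C {f. weq f} X s Y \<Longrightarrow>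
    \<exists>f. f \<in> Arr C \<and> src f = X \<and> tgt f = Y \<and> gz_rel C {f. weq f} `` {(X, s, Y)} = hcls f"
proof (induction s arbitrary: X)
  case Nil
  then have X: "X \<in> Obj C" "X = Y" by auto
  have "gz_rel C {f. weq f} `` {(X, [], X)} = hcls (Idn C X)"
    using X ho_simps(5)[of X] unfolding ho_cat_eq gz.gz.quotient_Idn by simp
  then show ?case using X by (intro exI[of _ "Idn C X"]) simp
next
  case (Cons a s)
  interpret H: category Ho by (rule ho_category)
  show ?case
  proof (cases a)
    case (Fwd f)
    then have f: "arr f" "src f = X" "zigzag C {f. weq f} (tgt f) s Y"
      using Cons.prems by auto
    obtain g where g: "arr g" "src g = tgt f" "tgt g = Y"
      "gz_rel C {f. weq f} `` {(tgt f, s, Y)} = hcls g"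
      using Cons.IH[OF f(3)] by blast
    have "gz_rel C {f. weq f} `` {(X, a # s, Y)} = hcls g \<cdot>\<^bsub>Ho\<^esub> hcls f"
      using gz.zz_class_Cmp[of X "[Fwd f]" "tgt f" s Y] f g Fwd
      by (simp add: ho_class_eq[of f] gz.loc_def ho_cat_eq)
    also have "\<dots> = hcls (g \<cdot> f)" using f g by simp
    finally show ?thesis using f g by (intro exI[of _ "g \<cdot> f"]) simp
  next
    case (Bwd w)
    then have w: "weq w" "arr w" "tgt w = X"
      "zigzag C {f. weq f} (src w) s Y"
      using Cons.prems stable_equivalence_Arr by auto
    obtain g where g: "arr g" "src g = src w" "tgt g = Y"
      "gz_rel C {f. weq f} `` {(src w, s, Y)} = hcls g"
      using Cons.IH[OF w(4)] by blast
    obtain k where k: "arr k" "src k = tgt w" "tgt k = src w" "inverse_arrows Ho (hcls w) (hcls k)"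
      using stable_equivalence_imp_ho_inverse[OF w(1)] by metis
    have "gz_rel C {f. weq f} `` {(tgt w, [Bwd w], src w)} = hcls k"
      using H.inverse_arrows_unique[OF _ k(4)] gz.loc_Bwd[of w] w(1) by (simp add: ho_cat_eq ho_class_eq)
    then have "gz_rel C {f. weq f} `` {(X, a # s, Y)} = hcls g \<cdot>\<^bsub>Ho\<^esub> hcls k"
      using gz.zz_class_Cmp[of X "[Bwd w]" "src w" s Y] w g Bwd by (simp add: ho_cat_eq)
    also have "\<dots> = hcls (g \<cdot> k)" using g k by simp
    finally show ?thesis using w g k by (intro exI[of _ "g \<cdot> k"]) simp
  qed
qed

lemma ho_Arr: "\<alpha> \<in> Arr Ho \<longleftrightarrow> (\<exists>f\<in>Arr C. \<alpha> = hcls f)"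
proof
  assume "\<alpha> \<in> Arr Ho"
  then obtain X s Y where "zigzag C {f. weq f} X s Y"
    "\<alpha> = gz_rel C {f. weq f} `` {(X, s, Y)}"
    unfolding ho_cat_eq by (rule gz.loc_Arr_cases)
  then show "\<exists>f\<in>Arr C. \<alpha> = hcls f" using zigzag_ho_class[of X s Y] by auto
qed auto

lemma ho_ArrE:
  assumes "\<alpha> \<in> Arr Ho"
  obtains f where "arr f" "\<alpha> = hcls f"
  using assms ho_Arr by blast

text \<open>A union over representatives makes this a function of the homotopy class; all of them
  contribute the same stable class by \<open>ho_class_eq_iff\<close>.\<close>

definition ho_stable :: "('o, ('o, 'm) ho_arr, 'o, 'm set) ftr" where
  "ho_stable = \<lparr>OMap = \<lambda>X. X, AMap = \<lambda>\<alpha>. \<Union>f\<in>{f \<in> Arr C. hcls f = \<alpha>}. scls f\<rparr>"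

lemma ho_stable_simps [simp]:
  "OMap ho_stable X = X"
  "arr f \<Longrightarrow> AMap ho_stable (hcls f) = scls f"
proof -
  assume f: "arr f"
  then have "scls g = scls f" if "g \<in> {g \<in> Arr C. hcls g = hcls f}" for g
    using that by (intro stable_class_eqI) (auto simp: ho_class_eq_iff)
  then have "(\<Union>g\<in>{g \<in> Arr C. hcls g = hcls f}. scls g) = (\<Union>g\<in>{g \<in> Arr C. hcls g = hcls f}. scls f)"
    by (rule SUP_cong[OF HOL.refl])
  then have "AMap ho_stable (hcls f) = (\<Union>g\<in>{g \<in> Arr C. hcls g = hcls f}. scls f)"
    by (simp add: ho_stable_def)
  then show "AMap ho_stable (hcls f) = scls f" using f by auto
qed (simp add: ho_stable_def)

lemma ho_stable_functor: "is_functor Ho St ho_stable"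
proof (rule is_functorI)
  fix f assume "f \<in> Arr Ho"
  then show "AMap ho_stable f \<in> Arr St" "Src St (AMap ho_stable f) = OMap ho_stable (Src Ho f)"
    "Tgt St (AMap ho_stable f) = OMap ho_stable (Tgt Ho f)"
    by (auto elim: ho_ArrE)
next
  fix f g assume "f \<in> Arr Ho" "g \<in> Arr Ho" "Tgt Ho f = Src Ho g"
  then show "AMap ho_stable (g \<cdot>\<^bsub>Ho\<^esub> f) = AMap ho_stable g \<cdot>\<^bsub>St\<^esub> AMap ho_stable f"
    by (auto elim!: ho_ArrE)
qed (simp_all add: ho_category stable_category)

lemma ho_stable_equivalence: "is_equivalence Ho St ho_stable"
proof (rule is_equivalenceI[OF ho_stable_functor])
  fix \<alpha> \<beta> assume "\<alpha> \<in> Arr Ho" "\<beta> \<in> Arr Ho" "AMap ho_stable \<alpha> = AMap ho_stable \<beta>"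
  then show "\<alpha> = \<beta>"
    by (auto elim!: ho_ArrE simp: stable_class_eq_iff stably_equal_imp_ho_class_eq)
next
  fix X Y \<alpha> assume "\<alpha> \<in> Hom St (OMap ho_stable X) (OMap ho_stable Y)"
  then obtain f where "arr f" "\<alpha> = scls f" "src f = X" "tgt f = Y"
    by (auto simp: mem_Hom stable_Arr)
  then show "\<exists>f\<in>Hom Ho X Y. AMap ho_stable f = \<alpha>"
    by (intro bexI[of _ "hcls f"]) (simp_all add: mem_Hom)
next
  interpret S: category St by (rule stable_category)
  fix Y assume "Y \<in> Obj St"
  then show "\<exists>X\<in>Obj Ho. \<exists>e\<in>Hom St (OMap ho_stable X) Y. Defs.is_iso St e"
    using S.Idn_closed[of Y] S.is_iso_Idn[of Y] by (auto simp del: stable_simps(5))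
qed

end

section \<open>Morphisms of covers and path objects\<close>

context frobenius_category
begin

text \<open>Read from the right, \<open>src k\<close> is a loop object of \<open>tgt r\<close>; read
  from the left, \<open>tgt r\<close> is a suspension of \<open>src k\<close>.\<close>

definition cover :: "'m \<Rightarrow> 'm \<Rightarrow> bool" where
  "cover k r \<longleftrightarrow> (k, r) \<in> E \<and> proj_inj C E (tgt k)"

lemma coverD:
  assumes "cover k r"
  shows "arr k" "arr r" "src r = tgt k" "r \<cdot> k = Zero C (src k) (tgt r)"
    "is_kernel C k r" "is_cokernel C r k" "inflation E k" "deflation E r" "proj_inj C E (tgt k)"
  using assms conflation[of k r] is_kernelD[of C k r] unfolding cover_def inflation_def deflation_def by auto

text \<open>The middle morphism is quantified away: with one end fixed, another choice of it changes
  the other end only within its stable class.\<close>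

definition cover_map :: "'m \<Rightarrow> 'm \<Rightarrow> 'm \<Rightarrow> 'm \<Rightarrow> 'm \<Rightarrow> 'm \<Rightarrow> bool" where
  "cover_map k r k' r' t f \<longleftrightarrow> t \<in> Arr C \<and> arr f \<and> src t = src k \<and> tgt t = src k' \<and>
    src f = tgt r \<and> tgt f = tgt r' \<and>
    (\<exists>e. e \<in> Arr C \<and> src e = tgt k \<and> tgt e = tgt k' \<and> e \<cdot> k = k' \<cdot> t \<and> r' \<cdot> e = f \<cdot> r)"

lemma cover_mapE:
  assumes "cover_map k r k' r' t f"
  obtains e where "arr t" "arr f" "src t = src k" "tgt t = src k'"
    "src f = tgt r" "tgt f = tgt r'" "arr e" "src e = tgt k" "tgt e = tgt k'"
    "e \<cdot> k = k' \<cdot> t" "r' \<cdot> e = f \<cdot> r"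
  using assms unfolding cover_map_def by blast

lemma cover_mapI:
  "\<lbrakk>arr t; arr f; src t = src k; tgt t = src k'; src f = tgt r; tgt f = tgt r';
    e \<in> Arr C; src e = tgt k; tgt e = tgt k'; e \<cdot> k = k' \<cdot> t; r' \<cdot> e = f \<cdot> r\<rbrakk>
    \<Longrightarrow> cover_map k r k' r' t f"
  unfolding cover_map_def by blast

lemma cover_mapD:
  assumes "cover_map k r k' r' t f"
  shows "arr t" "arr f" "src t = src k" "tgt t = src k'" "src f = tgt r" "tgt f = tgt r'"
  using assms unfolding cover_map_def by auto

text \<open>Projectivity of the middle term \<open>tgt k\<close> lifts \<open>f r\<close> through
  \<open>r'\<close>, and restriction to the kernels gives \<open>t\<close>.\<close>

lemma cover_map_from_right:
  assumes c: "cover k r" and c': "cover k' r'" and f: "arr f" "src f = tgt r" "tgt f = tgt r'"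
  obtains t where "cover_map k r k' r' t f"
proof -
  note D = coverD[OF c] and D' = coverD[OF c']
  obtain e where e: "arr e" "src e = tgt k" "tgt e = src r'" "r' \<cdot> e = f \<cdot> r"
    using proj_inj_lift[OF D(9) D'(8), of "f \<cdot> r"] D(1-3) D'(1-3) f by auto
  obtain t where t: "arr t" "src t = src (e \<cdot> k)" "tgt t = src k'" "k' \<cdot> t = e \<cdot> k"
  proof (rule is_kernel_lift[OF D'(5)])
    show "r' \<cdot> (e \<cdot> k) = Zero C (src (e \<cdot> k)) (tgt r')"
      using D(1-4) D'(1-3) e(1-3) f Cmp_eq_Cmp[OF e(4), of k] by simp
  qed (use D(1-3) D'(1-3) e in simp_all)
  show thesis
    by (rule that[of t], rule cover_mapI[where e = e]) (use D(1-3) D'(1-3) e t f in simp_all)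
qed

text \<open>Injectivity of the middle term \<open>tgt k'\<close> extends \<open>k' t\<close> along
  \<open>k\<close>, and passage to the cokernels gives \<open>f\<close>.\<close>

lemma cover_map_from_left:
  assumes c: "cover k r" and c': "cover k' r'" and t: "arr t" "src t = src k" "tgt t = src k'"
  obtains f where "cover_map k r k' r' t f"
proof -
  note D = coverD[OF c] and D' = coverD[OF c']
  obtain e where e: "arr e" "src e = tgt k" "tgt e = tgt k'" "e \<cdot> k = k' \<cdot> t"
    using proj_inj_extend[OF D'(9) D(7), of "k' \<cdot> t"] D(1-3) D'(1-3) t by auto
  obtain f where f: "arr f" "src f = tgt r" "tgt f = tgt (r' \<cdot> e)" "f \<cdot> r = r' \<cdot> e"
  proof (rule is_cokernel_desc[OF D(6)])
    show "(r' \<cdot> e) \<cdot> k = Zero C (src k) (tgt (r' \<cdot> e))"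
      using D(1-3) D'(1-3) e t Cmp_eq_Cmp[OF D'(4), of t] by simp
  qed (use D(1-3) D'(1-3) e in simp_all)
  show thesis
    by (rule that[of f], rule cover_mapI[where e = e]) (use D(1-3) D'(1-3) e t f in simp_all)
qed

text \<open>If \<open>f = f' + r' c\<close>, then \<open>e - e' - c r\<close> is killed by
  \<open>r'\<close>, hence equals \<open>k' h\<close>; composing with \<open>k\<close> gives
  \<open>t = t' + h k\<close>, and \<open>h k\<close> passes through the projective-injective middle
  term. The converse runs dually.\<close>

lemma cover_map_stably_equal_iff:
  assumes c: "cover k r" and c': "cover k' r'" and m: "cover_map k r k' r' t f" "cover_map k r k' r' t' f'"
  shows "t \<simeq> t' \<longleftrightarrow> f \<simeq> f'"
proof -
  note D = coverD[OF c] and D' = coverD[OF c']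
  obtain e where e: "arr t" "arr f" "src t = src k" "tgt t = src k'"
    "src f = tgt r" "tgt f = tgt r'" "arr e" "src e = tgt k" "tgt e = tgt k'"
    "e \<cdot> k = k' \<cdot> t" "r' \<cdot> e = f \<cdot> r" using m(1) by (rule cover_mapE)
  obtain e' where e': "arr t'" "arr f'" "src t' = src k" "tgt t' = src k'"
    "src f' = tgt r" "tgt f' = tgt r'" "arr e'" "src e' = tgt k" "tgt e' = tgt k'"
    "e' \<cdot> k = k' \<cdot> t'" "r' \<cdot> e' = f' \<cdot> r" using m(2) by (rule cover_mapE)
  show ?thesis
  proof
    assume "f \<simeq> f'"
    then obtain c where c: "arr c" "src c = src f'" "tgt c = src r'" "f = f' \<oplus> r' \<cdot> c"
      using stably_equal_deflation[OF _ D'(8), of f f'] e(6) by metis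
    have *: "r' \<cdot> e = r' \<cdot> (e' \<oplus> c \<cdot> r)"
      using D(1-3) D'(1-3) e(7-9,11) e'(1-9,11) c(1-3) by (simp add: c(4))
    obtain h where h: "arr h" "src h = src (e' \<oplus> c \<cdot> r)" "tgt h = src k'" "e = (e' \<oplus> c \<cdot> r) \<oplus> k' \<cdot> h"
      by (rule kernel_diff[OF D'(5) _ _ _ _ _ *]) (use D(1-3) D'(1-3) e(7-9) e'(1-9) c(1-3) in simp_all)
    have h': "src h = tgt k" using h(2) D(1-3) D'(1-3) e'(1-9) c(1-3) by simp
    have "k' \<cdot> t = e \<cdot> k" using e(10) by simp
    also have "\<dots> = k' \<cdot> (t' \<oplus> h \<cdot> k)"
      unfolding h(4) using D(1-4) D'(1-3) e'(1-10) c(1-3) h(1,3) h' by simp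
    finally have "t = t' \<oplus> h \<cdot> k"
      by (rule kernel_mono[OF D'(5), rotated -1]) (use D(1-3) D'(1-3) e(1-4) e'(1-4) h(1,3) h' in simp_all)
    then show "t \<simeq> t'"
      by (rule stably_equalI[rotated -1]) (use D(1-3,9) D'(1-3) e'(1-4) h(1,3) h' in simp_all)
  next
    assume "t \<simeq> t'"
    then obtain h where h: "arr h" "src h = tgt k" "tgt h = tgt t'" "t = t' \<oplus> h \<cdot> k"
      using stably_equal_inflation[OF _ D(7), of t t'] e(3) by metis
    have *: "e \<cdot> k = (e' \<oplus> k' \<cdot> h) \<cdot> k"
      using D(1-3) D'(1-3) e(7-10) e'(1-10) h(1-3) by (simp add: h(4))
    obtain c where c: "arr c" "src c = tgt r" "tgt c = tgt (e' \<oplus> k' \<cdot> h)" "e = (e' \<oplus> k' \<cdot> h) \<oplus> c \<cdot> r"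
      by (rule cokernel_diff[OF D(6) _ _ _ _ _ *]) (use D(1-3) D'(1-3) e(7-9) e'(1-9) h(1-3) in simp_all)
    have c': "tgt c = tgt k'" using c(3) D(1-3) D'(1-3) e'(1-9) h(1-3) by simp
    have "f \<cdot> r = r' \<cdot> e" using e(11) by simp
    also have "\<dots> = (f' \<oplus> r' \<cdot> c) \<cdot> r"
      unfolding c(4) using D(1-3) D'(1-3) e'(1-9,11) c(1,2) c' h(1-3) Cmp_eq_Cmp[OF D'(4), of h] by simp
    finally have "f = f' \<oplus> r' \<cdot> c"
      by (rule cokernel_epi[OF D(6), rotated -1]) (use D(1-3) D'(1-3) e(1-6) e'(1-6) c(1,2) c' in simp_all)
    then show "f \<simeq> f'"
      by (rule stably_equalI[rotated -1]) (use D(1-3) D'(1-3,9) e'(1-6) c(1,2) c' in simp_all)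
  qed
qed

lemma cover_map_Idn: "cover k r \<Longrightarrow> cover_map k r k r (Idn C (src k)) (Idn C (tgt r))"
  using coverD[of k r] by (intro cover_mapI[where e = "Idn C (tgt k)"]) simp_all

lemma cover_map_Neg:
  assumes c: "cover k r" and c': "cover k' r'" and m: "cover_map k r k' r' t f"
  shows "cover_map k r k' r' (Neg t) (Neg f)"
proof -
  note D = coverD[OF c] and D' = coverD[OF c']
  obtain e where e: "arr t" "arr f" "src t = src k" "tgt t = src k'"
    "src f = tgt r" "tgt f = tgt r'" "arr e" "src e = tgt k" "tgt e = tgt k'"
    "e \<cdot> k = k' \<cdot> t" "r' \<cdot> e = f \<cdot> r" using m by (rule cover_mapE)
  show ?thesis
    by (rule cover_mapI[where e = "Neg e"]) (use D(1-3) D'(1-3) e in \<open>simp_all add: Neg_Cmp\<close>)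
qed

lemma cover_map_Cmp:
  assumes c: "cover k r" "cover k' r'" "cover k2 r2"
    and m: "cover_map k r k' r' t f" "cover_map k' r' k2 r2 t' f'"
  shows "cover_map k r k2 r2 (t' \<cdot> t) (f' \<cdot> f)"
proof -
  note D = coverD(1-3)[OF c(1)] and D' = coverD(1-3)[OF c(2)] and D2 = coverD(1-3)[OF c(3)]
  obtain e where e: "arr t" "arr f" "src t = src k" "tgt t = src k'"
    "src f = tgt r" "tgt f = tgt r'" "arr e" "src e = tgt k" "tgt e = tgt k'"
    "e \<cdot> k = k' \<cdot> t" "r' \<cdot> e = f \<cdot> r" using m(1) by (rule cover_mapE)
  obtain e' where e': "arr t'" "arr f'" "src t' = src k'" "tgt t' = src k2"
    "src f' = tgt r'" "tgt f' = tgt r2" "arr e'" "src e' = tgt k'" "tgt e' = tgt k2"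
    "e' \<cdot> k' = k2 \<cdot> t'" "r2 \<cdot> e' = f' \<cdot> r'" using m(2) by (rule cover_mapE)
  show ?thesis
    by (rule cover_mapI[where e = "e' \<cdot> e"])
      (use D D' D2 e e' Cmp_eq_Cmp[OF e'(10), of t] Cmp_eq_Cmp[OF e'(11), of e] in simp_all)
qed

text \<open>The composite and the identity are both cover maps from (k, r) to itself, so their
  stable equality can be tested at either end.\<close>

lemma cover_map_inverse_iff:
  assumes c: "cover k r" "cover k' r'"
    and m: "cover_map k r k' r' t f" "cover_map k' r' k r t' f'"
  shows "t' \<cdot> t \<simeq> Idn C (src k) \<longleftrightarrow> f' \<cdot> f \<simeq> Idn C (tgt r)"
  using cover_map_stably_equal_iff[OF c(1) c(1) cover_map_Cmp[OF c c(1) m] cover_map_Idn[OF c(1)]] .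

text \<open>The analogue of the path fibration of topology: \<open>j\<close> includes the paths that
  start at zero, \<open>r\<close> is their endpoint, and \<open>k\<close> includes the
  loops.\<close>

definition path_cover :: "'m path_object \<Rightarrow> 'm \<Rightarrow> 'm \<Rightarrow> 'm \<Rightarrow> bool" where
  "path_cover P j k r \<longleftrightarrow> cover k r \<and> is_kernel C j (po_p0 C P) \<and> src j = tgt k \<and>
    src k = src (po_k P) \<and> po_p1 C P \<cdot> j = r \<and> j \<cdot> k = po_k P"

lemma path_coverD:
  assumes "path_cover P j k r"
  shows "cover k r" "is_kernel C j (po_p0 C P)" "src j = tgt k" "src k = src (po_k P)"
    "po_p1 C P \<cdot> j = r" "j \<cdot> k = po_k P"
  using assms by (auto simp: path_cover_def)

lemma path_objectD:
  assumes "is_path_object C FM B P"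
  shows "is_product C (po_q0 P) (po_q1 P)" "tgt (po_q0 P) = B" "tgt (po_q1 P) = B"
    "po_s P \<in> Arr C" "src (po_s P) = B" "po_p P \<in> Arr C" "src (po_p P) = tgt (po_s P)"
    "tgt (po_p P) = src (po_q0 P)" "inflation E (po_s P)" "weq (po_s P)" "deflation E (po_p P)"
    "po_p0 C P \<cdot> po_s P = Idn C B" "po_p1 C P \<cdot> po_s P = Idn C B" "is_kernel C (po_k P) (po_p P)"
    "po_q0 P \<in> Arr C" "po_q1 P \<in> Arr C" "src (po_q1 P) = src (po_q0 P)"
    "po_p0 C P \<in> Arr C" "po_p1 C P \<in> Arr C" "src (po_p0 C P) = tgt (po_s P)" "src (po_p1 C P) = tgt (po_s P)"
    "tgt (po_p0 C P) = B" "tgt (po_p1 C P) = B" "B \<in> Obj C"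
    "po_k P \<in> Arr C" "tgt (po_k P) = tgt (po_s P)"
proof -
  show a: "is_product C (po_q0 P) (po_q1 P)" "tgt (po_q0 P) = B" "tgt (po_q1 P) = B"
    "po_s P \<in> Arr C" "src (po_s P) = B" "po_p P \<in> Arr C" "src (po_p P) = tgt (po_s P)"
    "tgt (po_p P) = src (po_q0 P)" "inflation E (po_s P)" "weq (po_s P)" "deflation E (po_p P)"
    "po_p0 C P \<cdot> po_s P = Idn C B" "po_p1 C P \<cdot> po_s P = Idn C B" "is_kernel C (po_k P) (po_p P)"
    using assms unfolding is_path_object_def mem_Hom frobenius_model_simps Int_iff mem_Collect_eq by blast+
  show b: "po_q0 P \<in> Arr C" "po_q1 P \<in> Arr C" "src (po_q1 P) = src (po_q0 P)"
    using is_productD[OF a(1)] by auto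
  show "po_p0 C P \<in> Arr C" "po_p1 C P \<in> Arr C" "src (po_p0 C P) = tgt (po_s P)" "src (po_p1 C P) = tgt (po_s P)"
    "tgt (po_p0 C P) = B" "tgt (po_p1 C P) = B"
    using a(2-8) b by (simp_all add: po_p0_def po_p1_def)
  show "B \<in> Obj C" using a(2) b(1) by auto
  show "po_k P \<in> Arr C" "tgt (po_k P) = tgt (po_s P)"
    using is_kernelD[OF a(14)] a(7) by auto
qed

lemma path_object_ext:
  assumes P: "is_path_object C FM B P" and x: "arr x" "arr y" "src x = src y"
    "tgt x = tgt (po_p P)" "tgt y = tgt (po_p P)"
    "po_q0 P \<cdot> x = po_q0 P \<cdot> y" "po_q1 P \<cdot> x = po_q1 P \<cdot> y"
  shows "x = y"
  using is_product_ext[OF path_objectD(1)[OF P]] x path_objectD(8)[OF P] by simp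

lemma path_object_p_Cmp:
  assumes P: "is_path_object C FM B P" and x: "arr x" "tgt x = tgt (po_s P)"
  shows "po_q0 P \<cdot> (po_p P \<cdot> x) = po_p0 C P \<cdot> x" "po_q1 P \<cdot> (po_p P \<cdot> x) = po_p1 C P \<cdot> x"
  using path_objectD[OF P] x by (simp_all add: po_p0_def po_p1_def)

lemma path_object_kernel_iff:
  assumes P: "is_path_object C FM B P" and x: "arr x" "tgt x = tgt (po_s P)"
  shows "po_p P \<cdot> x = Zero C (src x) (tgt (po_p P)) \<longleftrightarrow>
    po_p0 C P \<cdot> x = Zero C (src x) B \<and> po_p1 C P \<cdot> x = Zero C (src x) B"
proof
  note D = path_objectD[OF P]
  {
    assume "po_p P \<cdot> x = Zero C (src x) (tgt (po_p P))"
    from path_object_p_Cmp[OF P x, unfolded this] D x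
    show "po_p0 C P \<cdot> x = Zero C (src x) B \<and> po_p1 C P \<cdot> x = Zero C (src x) B" by simp
  next
    assume "po_p0 C P \<cdot> x = Zero C (src x) B \<and> po_p1 C P \<cdot> x = Zero C (src x) B"
    then show "po_p P \<cdot> x = Zero C (src x) (tgt (po_p P))"
      by - (rule path_object_ext[OF P], use D(1-8,15-17) x path_object_p_Cmp[OF P x] in simp_all)
  }
qed

lemma path_object_k:
  assumes P: "is_path_object C FM B P"
  shows "po_p0 C P \<cdot> po_k P = Zero C (src (po_k P)) B" "po_p1 C P \<cdot> po_k P = Zero C (src (po_k P)) B"
  using path_object_kernel_iff[OF P, of "po_k P"] path_objectD(7,8,14,25,26)[OF P]
    is_kernelD(4)[OF path_objectD(14)[OF P]] by simp_all

text \<open>The kernel of the trivial fibration \<open>p\<^sub>0\<close> is projective-injective, and \<open>p\<^sub>1\<close> restricts to a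
  deflation from it onto \<open>B\<close> with kernel \<open>\<Omega>B\<close>.\<close>

lemma path_cover_exists:
  assumes P: "is_path_object C FM B P"
  obtains j k r where "path_cover P j k r"
proof -
  note D = path_objectD[OF P]
  obtain i0 i1 where "is_biproduct (po_q0 P) (po_q1 P) i0 i1" using product_biproduct[OF D(1)] .
  note bi = this and BD = is_biproductD[OF this]
  have p0: "deflation E (po_p0 C P)"
    unfolding po_p0_def using biproduct_inflation[OF bi] D by (intro deflation_Cmp) simp_all
  have "weq (Idn C B)" using D(24) stably_equal_refl by (intro stable_equivalenceI[of _ "Idn C B"]) simp_all
  then have w0: "weq (po_p0 C P)"
    using stable_equivalence_two_of_three[of "po_s P" "po_p0 C P"] D by simp
  obtain j where jE: "(j, po_p0 C P) \<in> E" using p0 by (auto simp: deflation_def)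
  have j: "is_kernel C j (po_p0 C P)" using conflation[OF jE] by simp
  note J = is_kernelD[OF j, unfolded D]
  obtain s a b where s: "arr s" "src s = B" "tgt s = tgt (po_s P)" "po_p0 C P \<cdot> s = Idn C B"
    "arr a" "arr b" "src a = tgt (po_s P)" "src b = tgt a" "tgt b = tgt (po_s P)"
    "proj_inj C E (tgt a)" "po_p0 C P \<cdot> b = Zero C (src b) B"
    "s \<cdot> po_p0 C P \<oplus> b \<cdot> a = Idn C (tgt (po_s P))"
    using trivial_fibration_split[OF p0 w0] unfolding D by metis
  obtain b' where b': "arr b'" "src b' = src b" "tgt b' = src j" "j \<cdot> b' = b"
    using is_kernel_lift[OF j, of b] s D by auto
  \<comment> \<open>As \<open>po_p0\<close> kills \<open>j\<close>, the splitting reduces to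
    \<open>b a\<close> on the kernel; with \<open>b = j b'\<close> this exhibits the kernel as a
    retract of a projective-injective object.\<close>
  have "j = (s \<cdot> po_p0 C P \<oplus> b \<cdot> a) \<cdot> j" unfolding s(12) using J by simp
  also have "\<dots> = j \<cdot> (b' \<cdot> (a \<cdot> j))" using s(1-9) b' J D(18-23) Cmp_eq_Cmp[OF b'(4), of "a \<cdot> j"] by simp
  finally have "j \<cdot> ((b' \<cdot> a) \<cdot> j) = j \<cdot> Idn C (src j)" using s(1-9) b' J by simp
  then have "(b' \<cdot> a) \<cdot> j = Idn C (src j)"
    by (rule kernel_mono[OF j, rotated -1]) (use s(1-9) b' J D(18-23) in simp_all)
  then have K: "proj_inj C E (src j)"
    by (intro proj_inj_retract[OF s(10), of "a \<cdot> j" b']) (use s(1-9) b' J in simp_all)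
  define r where "r = po_p1 C P \<cdot> j"
  have r: "arr r" "src r = src j" "tgt r = B" using J D by (simp_all add: r_def)
  \<comment> \<open>Over the second summand of B x B lie exactly the paths starting at zero, so
    \<open>r\<close> is a base change of the deflation \<open>po_p\<close>.\<close>
  have "is_pullback C (po_p P) i1 j r"
  proof (rule is_pullbackI)
    show "po_p P \<cdot> j = i1 \<cdot> r"
      by (rule path_object_ext[OF P])
        (use D(2-8,15-23) J BD r path_object_p_Cmp[OF P, of j] is_biproduct_simps[OF bi, of r] in \<open>simp_all add: r_def\<close>)
  next
    fix x y assume x: "arr x" "arr y" "tgt x = src (po_p P)" "tgt y = src i1" "src x = src y"
      "po_p P \<cdot> x = i1 \<cdot> y"
    have x': "tgt x = tgt (po_s P)" "tgt y = B" using x D BD by simp_all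
    have 0: "po_p0 C P \<cdot> x = Zero C (src y) B" "po_p1 C P \<cdot> x = y"
      using path_object_p_Cmp[OF P x(1) x'(1)] is_biproduct_simps[OF bi x(2)] x' D(2,3) unfolding x(6) by simp_all
    then obtain h where h: "arr h" "src h = src x" "tgt h = src j" "j \<cdot> h = x"
      using is_kernel_lift[OF j, of x] x x' D by auto
    then show "\<exists>h. h \<in> Arr C \<and> tgt h = src j \<and> src h = src y \<and> j \<cdot> h = x \<and> r \<cdot> h = y"
      using x 0 J D(18-23) by (intro exI[of _ h]) (simp add: r_def)
  next
    fix h h' assume "arr h" "arr h'" "tgt h = src r" "tgt h' = src r" "src h = src h'"
      "j \<cdot> h = j \<cdot> h'"
    then show "h = h'" using r by - (rule kernel_mono[OF j], simp_all)
  qed (use J D BD r in simp_all)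
  then have rd: "deflation E r" using deflation_pullback D(11) by blast
  obtain k where k: "arr k" "src k = src (po_k P)" "tgt k = src j" "j \<cdot> k = po_k P"
    using is_kernel_lift[OF j, of "po_k P"] D path_object_k[OF P] by auto
  have "is_kernel C k r"
    unfolding is_kernel_def
  proof (intro conjI allI ballI impI)
    show "r \<cdot> k = Zero C (src k) (tgt r)"
      using r k J path_object_k[OF P] D by (simp add: r_def)
  next
    fix W x assume x: "x \<in> Hom C W (src r)" "r \<cdot> x = Zero C W (tgt r)"
    have x': "arr x" "tgt x = src j" "src x = W" using x r by (simp_all add: mem_Hom)
    have "po_p0 C P \<cdot> (j \<cdot> x) = Zero C W B" "po_p1 C P \<cdot> (j \<cdot> x) = Zero C W B"
      using Cmp_eq_Cmp[OF J(4), of x] J(1-3) D(18-24) x' x(2) r(3) by (simp_all add: r_def)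
    then have *: "po_p P \<cdot> (j \<cdot> x) = Zero C (src (j \<cdot> x)) (tgt (po_p P))"
      using path_object_kernel_iff[OF P, of "j \<cdot> x"] x' J by simp
    obtain h where h: "arr h" "src h = src (j \<cdot> x)" "tgt h = src (po_k P)" "po_k P \<cdot> h = j \<cdot> x"
      by (rule is_kernel_lift[OF D(14) _ _ *]) (use x' J D in simp_all)
    have "k \<cdot> h = x"
      by (rule kernel_mono[OF j]) (use x' J k h Cmp_eq_Cmp[OF k(4), of h] in simp_all)
    show "\<exists>!h. h \<in> Hom C W (src k) \<and> k \<cdot> h = x"
    proof (rule ex1I)
      show "h \<in> Hom C W (src k) \<and> k \<cdot> h = x" using h x' k J \<open>k \<cdot> h = x\<close> by (simp add: mem_Hom)
      fix h' assume h': "h' \<in> Hom C W (src k) \<and> k \<cdot> h' = x"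
      then have "po_k P \<cdot> h' = j \<cdot> x" using Cmp_eq_Cmp[OF k(4), of h'] k J by (simp add: mem_Hom)
      then show "h' = h" using h' h x' J k
        by - (rule kernel_mono[OF D(14)], simp_all add: mem_Hom)
    qed
  qed (use r k in simp_all)
  then have "(k, r) \<in> E" using kernel_conflation[OF rd] by blast
  then show thesis using K k j r_def by (intro that[of j k r]) (simp add: path_cover_def cover_def)
qed

text \<open>A lift \<open>g\<close> compatible with \<open>po_p0\<close> maps one kernel of
  \<open>po_p0\<close> into the other; this restriction is the middle morphism of the cover
  map.\<close>

lemma loop_induced_cover_map:
  assumes Q: "is_path_object C FM (src f) (P (src f))" and R: "is_path_object C FM (tgt f) (P (tgt f))"
    and q: "path_cover (P (src f)) j k r" and q': "path_cover (P (tgt f)) j' k' r'"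
    and f: "arr f" and t: "loop_induced C P f t"
  shows "cover_map k r k' r' t f"
proof -
  note D = path_objectD[OF Q] and D' = path_objectD[OF R] and K = path_coverD[OF q] and K' = path_coverD[OF q']
  note c = coverD[OF K(1)] and c' = coverD[OF K'(1)]
  note J = is_kernelD[OF K(2), unfolded D] and J' = is_kernelD[OF K'(2), unfolded D']
  have r: "tgt r = src f" "tgt r' = tgt f" using K(5) K'(5) J J' D D' by auto
  obtain g where g: "arr g" "src g = tgt (po_s (P (src f)))" "tgt g = tgt (po_s (P (tgt f)))"
    "po_p0 C (P (tgt f)) \<cdot> g = f \<cdot> po_p0 C (P (src f))"
    "po_p1 C (P (tgt f)) \<cdot> g = f \<cdot> po_p1 C (P (src f))"
    "arr t" "src t = src (po_k (P (src f)))" "tgt t = src (po_k (P (tgt f)))"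
    "po_k (P (tgt f)) \<cdot> t = g \<cdot> po_k (P (src f))"
    using t by (auto simp: loop_induced_def Let_def mem_Hom)
  have *: "po_p0 C (P (tgt f)) \<cdot> (g \<cdot> j) = Zero C (src (g \<cdot> j)) (tgt (po_p0 C (P (tgt f))))"
    using Cmp_eq_Cmp[OF g(4), of j] J D(18-23) D'(18-23) g(1-3) f by simp
  obtain e where e: "arr e" "src e = src (g \<cdot> j)" "tgt e = src j'" "j' \<cdot> e = g \<cdot> j"
    by (rule is_kernel_lift[OF K'(2) _ _ *]) (use J J' g(1-3) D D' in simp_all)
  show ?thesis
  proof (rule cover_mapI[where e = e])
    show "e \<cdot> k = k' \<cdot> t"
      by (rule kernel_mono[OF K'(2)])
        (use e J J' c(1-3) c'(1-3) g(1-3,6-9) K(3,4,6) K'(3,4,6) Cmp_eq_Cmp[OF e(4), of k]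
          Cmp_eq_Cmp[OF K'(6), of t] in simp_all)
    show "r' \<cdot> e = f \<cdot> r"
      using e J J' c(1-3) c'(1-3) g(1-3) K(3-5) K'(3-5) D(18-23) D'(18-23) f Cmp_eq_Cmp[OF K'(5), of e]
        Cmp_eq_Cmp[OF g(5), of j] by simp
  qed (use g e f c(1-3) c'(1-3) K(3,4) K'(3,4) J J' r in simp_all)
qed

text \<open>The lift of \<open>f\<close> to path objects is a diagonal filler: \<open>po_s\<close>
  is a trivial cofibration on the left, \<open>po_p\<close> a fibration on the right, and the bottom
  \<open>h\<close> applies \<open>f\<close> to both endpoints.\<close>

lemma loop_induced_exists:
  assumes f: "arr f" and Q: "is_path_object C FM (src f) (P (src f))"
    and R: "is_path_object C FM (tgt f) (P (tgt f))"
  obtains t where "loop_induced C P f t"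
proof -
  note D = path_objectD[OF Q] and D' = path_objectD[OF R]
  obtain h where h: "arr h" "src h = tgt (po_s (P (src f)))" "tgt h = src (po_q0 (P (tgt f)))"
    "po_q0 (P (tgt f)) \<cdot> h = f \<cdot> po_p0 C (P (src f))" "po_q1 (P (tgt f)) \<cdot> h = f \<cdot> po_p1 C (P (src f))"
    using is_product_pair[OF D'(1), of "f \<cdot> po_p0 C (P (src f))" "f \<cdot> po_p1 C (P (src f))"]
      D(18-23) D'(2,3) f by auto
  have sq: "po_p (P (tgt f)) \<cdot> (po_s (P (tgt f)) \<cdot> f) = h \<cdot> po_s (P (src f))"
  proof (rule path_object_ext[OF R])
    note c = path_object_p_Cmp[OF R, of "po_s (P (tgt f)) \<cdot> f"] Cmp_eq_Cmp[OF D'(12), of f]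
      Cmp_eq_Cmp[OF D'(13), of f] Cmp_eq_Cmp[OF h(4), of "po_s (P (src f))"]
      Cmp_eq_Cmp[OF h(5), of "po_s (P (src f))"]
    show "po_q0 (P (tgt f)) \<cdot> (po_p (P (tgt f)) \<cdot> (po_s (P (tgt f)) \<cdot> f)) = po_q0 (P (tgt f)) \<cdot> (h \<cdot> po_s (P (src f)))"
      "po_q1 (P (tgt f)) \<cdot> (po_p (P (tgt f)) \<cdot> (po_s (P (tgt f)) \<cdot> f)) = po_q1 (P (tgt f)) \<cdot> (h \<cdot> po_s (P (src f)))"
      using c D(4,5,12,13,18-23) D'(4,5,15-23) f h(1-3) by simp_all
  qed (use D D' f h(1-3) in simp_all)
  obtain g where g: "arr g" "src g = tgt (po_s (P (src f)))" "tgt g = src (po_p (P (tgt f)))"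
    "g \<cdot> po_s (P (src f)) = po_s (P (tgt f)) \<cdot> f" "po_p (P (tgt f)) \<cdot> g = h"
    by (rule lift_trivial_cofibration[OF D(9,10) D'(11) _ _ _ _ _ _ sq]) (use D D' f h(1-3) in simp_all)
  have g': "tgt g = tgt (po_s (P (tgt f)))" using g(3) D'(7) by simp
  have p: "po_p0 C (P (tgt f)) \<cdot> g = f \<cdot> po_p0 C (P (src f))" "po_p1 C (P (tgt f)) \<cdot> g = f \<cdot> po_p1 C (P (src f))"
    using path_object_p_Cmp[OF R g(1) g'] h g(5) by simp_all
  have *: "po_p (P (tgt f)) \<cdot> (g \<cdot> po_k (P (src f)))
      = Zero C (src (g \<cdot> po_k (P (src f)))) (tgt (po_p (P (tgt f))))"
  proof (subst path_object_kernel_iff[OF R], goal_cases)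
    case 3
    show ?case
      using Cmp_eq_Cmp[OF p(1), of "po_k (P (src f))"] Cmp_eq_Cmp[OF p(2), of "po_k (P (src f))"]
        path_object_k[OF Q] D(18-26) D'(18-23) g(1,2) g' f by simp
  qed (use g(1,2) g' D in simp_all)
  obtain t where t: "arr t" "src t = src (g \<cdot> po_k (P (src f)))" "tgt t = src (po_k (P (tgt f)))"
    "po_k (P (tgt f)) \<cdot> t = g \<cdot> po_k (P (src f))"
    by (rule is_kernel_lift[OF D'(14) _ _ *]) (use g(1,2) g' D D' in simp_all)
  have "loop_induced C P f t"
    unfolding loop_induced_def Let_def
    by (rule bexI[of _ g]) (use g g' p t D in \<open>simp_all add: mem_Hom\<close>)
  then show thesis by (rule that)
qed

end

section \<open>Shift, loops and triangles\<close>

text \<open>Evaluates the unions over representatives and choices by which the shift and the loop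
  functor are defined.\<close>

lemma UN_eq_const: "\<lbrakk>a \<in> A; \<And>x. x \<in> A \<Longrightarrow> f x = c\<rbrakk> \<Longrightarrow> (\<Union>x\<in>A. f x) = c"
  by auto

lemma isomorphic_triangles_trans:
  assumes T: "is_functor S S T" and 1: "isomorphic_triangles S T t1 t2" and 2: "isomorphic_triangles S T t2 t3"
  shows "isomorphic_triangles S T t1 t3"
proof -
  interpret S: category S by (rule is_functorD(1)[OF T])
  note T' = is_functorD(3-)[OF T]
  obtain u v w where t1: "t1 = (u, v, w)" by (cases t1)
  obtain u' v' w' where t2: "t2 = (u', v', w')" by (cases t2)
  obtain x y z where t3: "t3 = (x, y, z)" by (cases t3)
  obtain a b c where a: "is_triangle S T u v w" "is_triangle S T u' v' w'" "Defs.is_iso S a" "Defs.is_iso S b" "Defs.is_iso S c"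
    "a \<in> Arr S" "Src S a = Src S u" "Tgt S a = Src S u'" "b \<in> Arr S" "Src S b = Tgt S u" "Tgt S b = Tgt S u'"
    "c \<in> Arr S" "Src S c = Tgt S v" "Tgt S c = Tgt S v'"
    "u' \<cdot>\<^bsub>S\<^esub> a = b \<cdot>\<^bsub>S\<^esub> u" "v' \<cdot>\<^bsub>S\<^esub> b = c \<cdot>\<^bsub>S\<^esub> v" "w' \<cdot>\<^bsub>S\<^esub> c = AMap T a \<cdot>\<^bsub>S\<^esub> w"
    using 1 unfolding t1 t2 isomorphic_triangles_def case_prod_conv mem_Hom by blast
  obtain a' b' c' where a': "is_triangle S T x y z" "Defs.is_iso S a'" "Defs.is_iso S b'" "Defs.is_iso S c'"
    "a' \<in> Arr S" "Src S a' = Src S u'" "Tgt S a' = Src S x" "b' \<in> Arr S" "Src S b' = Tgt S u'" "Tgt S b' = Tgt S x"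
    "c' \<in> Arr S" "Src S c' = Tgt S v'" "Tgt S c' = Tgt S y"
    "x \<cdot>\<^bsub>S\<^esub> a' = b' \<cdot>\<^bsub>S\<^esub> u'" "y \<cdot>\<^bsub>S\<^esub> b' = c' \<cdot>\<^bsub>S\<^esub> v'" "z \<cdot>\<^bsub>S\<^esub> c' = AMap T a' \<cdot>\<^bsub>S\<^esub> w'"
    using 2 unfolding t2 t3 isomorphic_triangles_def case_prod_conv mem_Hom by blast
  have uvw: "u \<in> Arr S" "v \<in> Arr S" "w \<in> Arr S" "Src S v = Tgt S u" "Src S w = Tgt S v" "Tgt S w = OMap T (Src S u)"
    "u' \<in> Arr S" "v' \<in> Arr S" "w' \<in> Arr S" "Src S v' = Tgt S u'" "Src S w' = Tgt S v'" "Tgt S w' = OMap T (Src S u')"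
    "x \<in> Arr S" "y \<in> Arr S" "z \<in> Arr S" "Src S y = Tgt S x" "Src S z = Tgt S y" "Tgt S z = OMap T (Src S x)"
    using a(1,2) a'(1) by (auto simp: is_triangle_def mem_Hom)
  show ?thesis
    unfolding t1 t3 isomorphic_triangles_def case_prod_conv
  proof (intro conjI exI)
    show "Defs.is_iso S (a' \<cdot>\<^bsub>S\<^esub> a)" "Defs.is_iso S (b' \<cdot>\<^bsub>S\<^esub> b)" "Defs.is_iso S (c' \<cdot>\<^bsub>S\<^esub> c)"
      using a a' by (simp_all add: S.is_iso_Cmp)
    show "x \<cdot>\<^bsub>S\<^esub> a' \<cdot>\<^bsub>S\<^esub> a = (b' \<cdot>\<^bsub>S\<^esub> b) \<cdot>\<^bsub>S\<^esub> u"
      using a(6-14) a'(5-13) uvw by (simp add: S.Cmp_eq_Cmp[OF a'(14), of a] a(15))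
    show "y \<cdot>\<^bsub>S\<^esub> b' \<cdot>\<^bsub>S\<^esub> b = (c' \<cdot>\<^bsub>S\<^esub> c) \<cdot>\<^bsub>S\<^esub> v"
      using a(6-14) a'(5-13) uvw by (simp add: S.Cmp_eq_Cmp[OF a'(15), of b] a(16))
    show "z \<cdot>\<^bsub>S\<^esub> c' \<cdot>\<^bsub>S\<^esub> c = AMap T (a' \<cdot>\<^bsub>S\<^esub> a) \<cdot>\<^bsub>S\<^esub> w"
      using a(6-14) a'(5-13) uvw by (simp add: S.Cmp_eq_Cmp[OF a'(16), of c] a(17) T')
  qed (use a a' in \<open>simp_all add: mem_Hom\<close>)
qed

context frobenius_category
begin

lemma mem_stable_class: "g \<in> scls f \<longleftrightarrow> f \<simeq> g"
  by (simp add: stable_class_def)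

abbreviation "Sh \<equiv> happel_shift C E"
abbreviation "Lo \<equiv> loop_functor C FM"

section \<open>Happel's shift and triangles\<close>

context
  fixes \<mu> \<pi> :: "'o \<Rightarrow> 'm"
  assumes happel: "happel_choice C E \<mu> \<pi>"
begin

lemma happel_cover: "X \<in> Obj C \<Longrightarrow> cover (\<mu> X) (\<pi> X)" "X \<in> Obj C \<Longrightarrow> src (\<mu> X) = X"
  using happel by (auto simp: happel_choice_def cover_def)

lemma happel_induced_iff:
  assumes "arr f"
  shows "happel_induced C \<mu> \<pi> f t \<longleftrightarrow>
    cover_map (\<mu> (src f)) (\<pi> (src f)) (\<mu> (tgt f)) (\<pi> (tgt f)) f t"
  using assms happel_cover(2)[of "src f"] happel_cover(2)[of "tgt f"]
  unfolding happel_induced_def cover_map_def Let_def Bex_def mem_Hom by auto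

lemma shift_OMap [simp]: "OMap (Sh \<mu> \<pi>) X = tgt (\<pi> X)"
  by (simp add: happel_shift_def)

text \<open>Every representative with every extension gives a cover map between the same two covers,
  so \<open>cover_map_stably_equal_iff\<close> makes the union constant.\<close>

lemma shift_AMap:
  assumes t: "cover_map (\<mu> (src f)) (\<pi> (src f)) (\<mu> (tgt f)) (\<pi> (tgt f)) f t"
  shows "AMap (Sh \<mu> \<pi>) (scls f) = scls t"
proof -
  note f = cover_mapD(1)[OF t]
  have inner: "(\<Union>t\<in>{t. happel_induced C \<mu> \<pi> f' t}. scls t) = scls t" if "f' \<in> scls f" for f'
  proof -
    note f' = stably_equalD[OF that[unfolded mem_stable_class]]
    have c: "cover (\<mu> (src f)) (\<pi> (src f))" "cover (\<mu> (tgt f)) (\<pi> (tgt f))"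
      "src (\<mu> (src f)) = src f" "src (\<mu> (tgt f)) = tgt f"
      using f by (simp_all add: happel_cover)
    obtain t' where "cover_map (\<mu> (src f)) (\<pi> (src f)) (\<mu> (tgt f)) (\<pi> (tgt f)) f' t'"
      using cover_map_from_left[OF c(1,2), of f'] f' c by auto
    then have "t' \<in> {t. happel_induced C \<mu> \<pi> f' t}" using happel_induced_iff[of f'] f' by simp
    moreover have "scls t' = scls t" if "t' \<in> {t. happel_induced C \<mu> \<pi> f' t}" for t'
    proof -
      have "cover_map (\<mu> (src f)) (\<pi> (src f)) (\<mu> (tgt f)) (\<pi> (tgt f)) f' t'"
        using that happel_induced_iff[of f'] f' by simp
      then have "t \<simeq> t'"
        using cover_map_stably_equal_iff[OF c(1,2) t] \<open>f' \<in> scls f\<close> by (simp add: mem_stable_class)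
      then show ?thesis by (rule stable_class_eqI[OF stably_equal_sym])
    qed
    ultimately show ?thesis by (rule UN_eq_const)
  qed
  have "f \<in> scls f" using stably_equal_refl[OF f] by (simp add: mem_stable_class)
  then have "(\<Union>f'\<in>scls f. \<Union>t\<in>{t. happel_induced C \<mu> \<pi> f' t}. scls t) = scls t"
    using inner by (rule UN_eq_const)
  then show ?thesis by (simp add: happel_shift_def)
qed

lemma shift_AMapE:
  assumes f: "arr f"
  obtains t where "cover_map (\<mu> (src f)) (\<pi> (src f)) (\<mu> (tgt f)) (\<pi> (tgt f)) f t"
    "AMap (Sh \<mu> \<pi>) (scls f) = scls t"
    "arr t" "src t = tgt (\<pi> (src f))" "tgt t = tgt (\<pi> (tgt f))"
proof -
  obtain t where t: "cover_map (\<mu> (src f)) (\<pi> (src f)) (\<mu> (tgt f)) (\<pi> (tgt f)) f t"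
    using cover_map_from_left[OF happel_cover(1) happel_cover(1), of "src f" "tgt f" f] happel_cover(2) f by auto
  from that[OF this shift_AMap[OF this] cover_mapD(2,5,6)[OF this]] show thesis .
qed

lemma shift_functor: "is_functor St St (Sh \<mu> \<pi>)"
proof (rule is_functorI)
  fix X assume "X \<in> Obj St"
  then have X: "X \<in> Obj C" by simp
  note c = happel_cover[OF X]
  show "OMap (Sh \<mu> \<pi>) X \<in> Obj St" using coverD[OF c(1)] by simp
  show "AMap (Sh \<mu> \<pi>) (Idn St X) = Idn St (OMap (Sh \<mu> \<pi>) X)"
    using shift_AMap[of "Idn C X" "Idn C (tgt (\<pi> X))"] cover_map_Idn[OF c(1)] X c(2) by simp
next
  fix \<alpha> assume "\<alpha> \<in> Arr St"
  then obtain f where f: "arr f" "\<alpha> = scls f" by (auto simp: stable_Arr)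
  obtain t where "AMap (Sh \<mu> \<pi>) (scls f) = scls t" "arr t" "src t = tgt (\<pi> (src f))" "tgt t = tgt (\<pi> (tgt f))"
    using shift_AMapE[OF f(1)] by metis
  then show "AMap (Sh \<mu> \<pi>) \<alpha> \<in> Arr St" "Src St (AMap (Sh \<mu> \<pi>) \<alpha>) = OMap (Sh \<mu> \<pi>) (Src St \<alpha>)" "Tgt St (AMap (Sh \<mu> \<pi>) \<alpha>) = OMap (Sh \<mu> \<pi>) (Tgt St \<alpha>)"
    using f by simp_all
next
  fix \<alpha> \<beta> assume "\<alpha> \<in> Arr St" "\<beta> \<in> Arr St" "Tgt St \<alpha> = Src St \<beta>"
  then obtain f g where f: "arr f" "\<alpha> = scls f" and g: "arr g" "\<beta> = scls g" "src g = tgt f"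
    by (auto simp: stable_Arr)
  obtain t where t: "cover_map (\<mu> (src f)) (\<pi> (src f)) (\<mu> (tgt f)) (\<pi> (tgt f)) f t"
    "AMap (Sh \<mu> \<pi>) (scls f) = scls t" "arr t" "src t = tgt (\<pi> (src f))" "tgt t = tgt (\<pi> (tgt f))"
    using shift_AMapE[OF f(1)] by metis
  obtain s where s: "cover_map (\<mu> (tgt f)) (\<pi> (tgt f)) (\<mu> (tgt g)) (\<pi> (tgt g)) g s"
    "AMap (Sh \<mu> \<pi>) (scls g) = scls s" "arr s" "src s = tgt (\<pi> (tgt f))" "tgt s = tgt (\<pi> (tgt g))"
    using shift_AMapE[OF g(1)] g(3) by metis
  have "AMap (Sh \<mu> \<pi>) (scls (g \<cdot> f)) = scls (s \<cdot> t)"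
    by (rule shift_AMap) (use cover_map_Cmp[OF _ _ _ t(1) s(1)] happel_cover f g in simp)
  then show "AMap (Sh \<mu> \<pi>) (\<beta> \<cdot>\<^bsub>St\<^esub> \<alpha>) = AMap (Sh \<mu> \<pi>) \<beta> \<cdot>\<^bsub>St\<^esub> AMap (Sh \<mu> \<pi>) \<alpha>"
    using f g t s by simp
qed (rule stable_category)+

text \<open>A connecting morphism \<open>w : B \<rightarrow> TF\<close> of a conflation \<open>F \<rightarrow> E \<rightarrow> B\<close> completes it to a
  distinguished triangle only after a change of sign: the comparison \<open>c\<close> with the cone \<open>C\<^sub>i\<close>
  satisfies \<open>w c + w\<^sub>0 = \<pi>\<^sub>F (\<sigma>, 1)\<close>, where \<open>w\<^sub>0\<close> is the standard morphism \<open>C\<^sub>i \<rightarrow> TF\<close>.\<close>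

lemma conflation_triangle:
  assumes ip: "(i, p) \<in> E"
    and \<sigma>: "arr \<sigma>" "src \<sigma> = tgt i" "tgt \<sigma> = tgt (\<mu> (src i))" "\<sigma> \<cdot> i = \<mu> (src i)"
    and w: "arr w" "src w = tgt p" "tgt w = tgt (\<pi> (src i))" "w \<cdot> p = \<pi> (src i) \<cdot> \<sigma>"
  obtains v w0 where "happel_standard C \<mu> \<pi> i v w0"
    "isomorphic_triangles St (Sh \<mu> \<pi>) (scls i, scls v, scls w0) (scls i, scls p, scls (Neg w))"
proof -
  define F where "F = src i"
  have iF: "src i = F" by (simp add: F_def)
  note k = conflation[OF ip, THEN conjunct1] and ck = conflation[OF ip, THEN conjunct2]
  note I = is_kernelD[OF k]
  have F: "F \<in> Obj C" using I(1) iF by auto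
  note c = coverD[OF happel_cover(1)[OF F]] happel_cover(2)[OF F] and \<sigma>' = \<sigma>[folded F_def] and w' = w[folded F_def]
  interpret S: category St by (rule stable_category)
  obtain u' v where po: "is_pushout C (\<mu> F) i u' v" using pushout_exists[OF c(7), of i] I c(10) iF by auto
  note P = is_pushoutD[OF po]
  obtain w0 where w0: "arr w0" "src w0 = tgt v" "tgt w0 = tgt (\<pi> F)" "w0 \<cdot> u' = \<pi> F"
      "w0 \<cdot> v = Zero C (tgt i) (tgt (\<pi> F))"
    by (rule is_pushout_copair[OF po, of "\<pi> F" "Zero C (tgt i) (tgt (\<pi> F))"])
      (use c I iF in simp_all)
  \<comment> \<open>\<open>q\<close> is the comparison \<open>c\<close> of the remark above and
    \<open>\<tau>\<close> is (\<sigma>, 1). Together with \<open>s\<close> and \<open>u'\<close>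
    they decompose the cone into B and the hull of F.\<close>
  obtain q where q: "arr q" "src q = tgt v" "tgt q = tgt p" "q \<cdot> u' = Zero C (tgt (\<mu> F)) (tgt p)" "q \<cdot> v = p"
    by (rule is_pushout_copair[OF po, of "Zero C (tgt (\<mu> F)) (tgt p)" p])
      (use c I iF in simp_all)
  obtain \<tau> where \<tau>: "arr \<tau>" "src \<tau> = tgt v" "tgt \<tau> = tgt (\<mu> F)" "\<tau> \<cdot> u' = Idn C (tgt (\<mu> F))" "\<tau> \<cdot> v = \<sigma>"
    by (rule is_pushout_copair[OF po, of "Idn C (tgt (\<mu> F))" \<sigma>])
      (use c I iF \<sigma>' in simp_all)
  \<comment> \<open>The difference \<open>v - u' \<sigma>\<close> kills \<open>i\<close>, because
    \<open>v i = u' \<mu>\<close> by the pushout square and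
    \<open>\<mu> = \<sigma> i\<close>.\<close>
  obtain s where s: "arr s" "src s = tgt p" "tgt s = tgt v" "s \<cdot> p = v \<oplus> Neg (u' \<cdot> \<sigma>)"
  proof (rule is_cokernel_desc[OF ck, of "v \<oplus> Neg (u' \<cdot> \<sigma>)"])
    show "(v \<oplus> Neg (u' \<cdot> \<sigma>)) \<cdot> i = Zero C (src i) (tgt (v \<oplus> Neg (u' \<cdot> \<sigma>)))"
      using P(1-8) \<sigma>' I(1,2) iF by (simp add: Neg_Cmp P(9))
  qed (use P(1-8) \<sigma>' I(1-3) iF in simp_all)
  have "q \<cdot> s = Idn C (tgt p)"
  proof (rule cokernel_epi[OF ck])
    have "q \<cdot> (s \<cdot> p) = p"
      unfolding s(4) using P(1-8) \<sigma>' I(1-3) iF q Cmp_eq_Cmp[OF q(4), of \<sigma>] c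
      by (simp add: Neg_Cmp)
    then show "(q \<cdot> s) \<cdot> p = Idn C (tgt p) \<cdot> p" using q s I by simp
  qed (use q s I in simp_all)
  moreover have "s \<cdot> q \<oplus> u' \<cdot> \<tau> = Idn C (tgt v)"
    by (rule is_pushout_ext[OF po]) (use P(1-8) q s \<tau> I(1-3) c \<sigma>' iF in \<open>simp_all add: Add_assoc\<close>)
  ultimately have qw: "weq q"
    by (intro split_deflation_stable_equivalence(1)[of q s \<tau> u'])
      (use P(1-8) q s \<tau> c in simp_all)
  \<comment> \<open>On the leg \<open>v\<close> this is \<open>w p = \<pi> \<sigma>\<close>, on the
    leg \<open>u'\<close> it is trivial. The right-hand side passes through the hull and is stably
    zero, which forces the sign.\<close>
  have "w \<cdot> q \<oplus> w0 = \<pi> F \<cdot> \<tau>"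
    by (rule is_pushout_ext[OF po]) (use P(1-8) q w0 w' \<tau> I(1-3) c \<sigma>' iF in simp_all)
  then have "w0 = Neg w \<cdot> q \<oplus> \<pi> F \<cdot> \<tau>" using q w' w0 by (simp add: Neg_Cmp flip: \<open>w \<cdot> q \<oplus> w0 = \<pi> F \<cdot> \<tau>\<close>)
  then have w0w: "w0 \<simeq> Neg w \<cdot> q"
    by (rule stably_equalI[rotated -1]) (use q w' \<tau> c in simp_all)
  show thesis
  proof (rule that)
    show "happel_standard C \<mu> \<pi> i v w0"
      unfolding happel_standard_def using po w0 P I iF by (auto simp: mem_Hom)
    show "isomorphic_triangles St (Sh \<mu> \<pi>) (scls i, scls v, scls w0) (scls i, scls p, scls (Neg w))"
      unfolding isomorphic_triangles_def case_prod_conv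
    proof (intro conjI exI)
      show "Defs.is_iso St (Idn St F)" "Defs.is_iso St (Idn St (tgt i))"
        by (rule S.is_iso_Idn; use F I in simp)+
      show "Defs.is_iso St (scls q)" using qw by (simp add: stable_equivalence_def)
      show "scls (Neg w) \<cdot>\<^bsub>St\<^esub> scls q = AMap (Sh \<mu> \<pi>) (Idn St F) \<cdot>\<^bsub>St\<^esub> scls w0"
        using is_functorD(7)[OF shift_functor, of F] F w0 q w' stable_class_eqI[OF w0w] c(1-3) by simp
    qed (use I P q w0 w' F iF c(1-3) in \<open>simp_all add: mem_Hom is_triangle_def\<close>)
  qed
qed

end

section \<open>The loop functor and Quillen's boundary\<close>

context
  fixes P :: "'o \<Rightarrow> 'm path_object" and J K R :: "'o \<Rightarrow> 'm"
  assumes paths: "path_object_choice C FM P"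
    and covers: "\<forall>Z\<in>Obj C. path_cover (P Z) (J Z) (K Z) (R Z)"
begin

lemmas cov = covers[rule_format]

lemma loop_OMap [simp]: "OMap (Lo P) B = src (po_k (P B))"
  by (simp add: loop_functor_def)

lemma is_path_object_P: "B \<in> Obj C \<Longrightarrow> is_path_object C FM B (P B)"
  using paths by (simp add: path_object_choice_def)

lemma covK:
  assumes B: "B \<in> Obj C"
  shows "cover (K B) (R B)" "src (K B) = OMap (Lo P) B" "tgt (R B) = B" "OMap (Lo P) B \<in> Obj C"
proof -
  note D = path_coverD[OF cov[OF B]] and PD = path_objectD[OF is_path_object_P[OF B]]
  show c: "cover (K B) (R B)" "src (K B) = OMap (Lo P) B" using D by simp_all
  have "tgt (po_p1 C (P B) \<cdot> J B) = B" using is_kernelD[OF D(2)] PD by simp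
  then show "tgt (R B) = B" using D(5) by simp
  show "OMap (Lo P) B \<in> Obj C" using coverD(1)[OF c(1)] c(2) by (metis Src_Obj)
qed

text \<open>As for the shift, but with cover maps read from right to left; every lift between path
  objects yields one by \<open>loop_induced_cover_map\<close>.\<close>

lemma loop_AMap:
  assumes t: "cover_map (K (src f)) (R (src f)) (K (tgt f)) (R (tgt f)) t f"
  shows "AMap (Lo P) (hcls f) = hcls t"
proof -
  note f = cover_mapD(2)[OF t]
  have inner: "(\<Union>t\<in>{t. loop_induced C P f' t}. hcls t) = hcls t" if "f' \<in> {f' \<in> Arr C. hcls f' = hcls f}" for f'
  proof -
    have f': "f' \<simeq> f" using that f ho_class_eq_iff[of f' f] by auto
    note D = stably_equalD[OF f']
    have p: "is_path_object C FM (src f') (P (src f'))" "is_path_object C FM (tgt f') (P (tgt f'))"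
      using D by (simp_all add: is_path_object_P)
    obtain t' where "loop_induced C P f' t'" using loop_induced_exists[OF D(1) p] .
    then have "t' \<in> {t. loop_induced C P f' t}" by simp
    moreover have "hcls t' = hcls t" if "t' \<in> {t. loop_induced C P f' t}" for t'
    proof -
      have "cover_map (K (src f)) (R (src f)) (K (tgt f)) (R (tgt f)) t' f'"
        using loop_induced_cover_map[OF p cov cov D(1), of t'] D that by simp
      then have "t' \<simeq> t" using cover_map_stably_equal_iff[OF covK(1) covK(1) _ t] f f' by simp
      then show ?thesis by (rule stably_equal_imp_ho_class_eq)
    qed
    ultimately show ?thesis by (rule UN_eq_const)
  qed
  have "f \<in> {f' \<in> Arr C. hcls f' = hcls f}" using f by simp
  then have "(\<Union>f'\<in>{f' \<in> Arr C. hcls f' = hcls f}. \<Union>t\<in>{t. loop_induced C P f' t}. hcls t) = hcls t"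
    using inner by (rule UN_eq_const)
  then show ?thesis by (simp add: loop_functor_def)
qed

lemma loop_AMapE:
  assumes f: "arr f"
  obtains t where "cover_map (K (src f)) (R (src f)) (K (tgt f)) (R (tgt f)) t f"
    "AMap (Lo P) (hcls f) = hcls t"
    "arr t" "src t = src (K (src f))" "tgt t = src (K (tgt f))"
proof -
  obtain t where t: "cover_map (K (src f)) (R (src f)) (K (tgt f)) (R (tgt f)) t f"
    using cover_map_from_right[OF covK(1) covK(1), of "src f" "tgt f" f] covK(3) f by auto
  from that[OF this loop_AMap[OF this] cover_mapD(1,3,4)[OF this]] show thesis .
qed

lemma loop_functor: "is_functor Ho Ho (Lo P)"
proof (rule is_functorI)
  fix X assume "X \<in> Obj Ho"
  then have X: "X \<in> Obj C" by simp
  note c = covK[OF X]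
  show "OMap (Lo P) X \<in> Obj Ho" using c(4) by simp
  show "AMap (Lo P) (Idn Ho X) = Idn Ho (OMap (Lo P) X)"
    using loop_AMap[of "Idn C X" "Idn C (src (K X))"] cover_map_Idn[OF c(1)] X c by simp
next
  fix \<alpha> assume "\<alpha> \<in> Arr Ho"
  then obtain f where f: "arr f" "\<alpha> = hcls f" by (rule ho_ArrE)
  obtain t where t: "AMap (Lo P) (hcls f) = hcls t" "arr t" "src t = src (K (src f))"
    "tgt t = src (K (tgt f))"
    using loop_AMapE[OF f(1)] by metis
  then show "AMap (Lo P) \<alpha> \<in> Arr Ho" "Src Ho (AMap (Lo P) \<alpha>) = OMap (Lo P) (Src Ho \<alpha>)"
    "Tgt Ho (AMap (Lo P) \<alpha>) = OMap (Lo P) (Tgt Ho \<alpha>)"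
    using f covK(2) by simp_all
next
  fix \<alpha> \<beta> assume "\<alpha> \<in> Arr Ho" "\<beta> \<in> Arr Ho" "Tgt Ho \<alpha> = Src Ho \<beta>"
  then obtain f g where f: "arr f" "\<alpha> = hcls f" and g: "arr g" "\<beta> = hcls g" "src g = tgt f"
    by (auto simp: ho_Arr)
  obtain t where t: "cover_map (K (src f)) (R (src f)) (K (tgt f)) (R (tgt f)) t f"
    "AMap (Lo P) (hcls f) = hcls t" "arr t" "tgt t = src (K (tgt f))"
    using loop_AMapE[OF f(1)] by metis
  obtain s where s: "cover_map (K (tgt f)) (R (tgt f)) (K (tgt g)) (R (tgt g)) s g"
    "AMap (Lo P) (hcls g) = hcls s" "arr s" "src s = src (K (tgt f))"
    using loop_AMapE[OF g(1)] g(3) by metis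
  have "AMap (Lo P) (hcls (g \<cdot> f)) = hcls (s \<cdot> t)"
    by (rule loop_AMap) (use cover_map_Cmp[OF _ _ _ t(1) s(1)] covK(1) f g in simp)
  then show "AMap (Lo P) (\<beta> \<cdot>\<^bsub>Ho\<^esub> \<alpha>) = AMap (Lo P) \<beta> \<cdot>\<^bsub>Ho\<^esub> AMap (Lo P) \<alpha>"
    using f g t s by simp
qed (rule ho_category)+

text \<open>Full faithfulness is the correspondence between the two ends of cover maps. For density,
  \<open>Y\<close> is the left end of the cover \<open>m\<close>, \<open>d\<close> of its suspension
  \<open>X\<close>, and the loop object of \<open>X\<close> is the left end of another cover of the
  same \<open>X\<close>.\<close>

lemma loop_equivalence: "is_equivalence Ho Ho (Lo P)"
proof (rule is_equivalenceI[OF loop_functor])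
  fix \<alpha> \<beta> assume "\<alpha> \<in> Arr Ho" "\<beta> \<in> Arr Ho" "Src Ho \<alpha> = Src Ho \<beta>" "Tgt Ho \<alpha> = Tgt Ho \<beta>"
    and eq: "AMap (Lo P) \<alpha> = AMap (Lo P) \<beta>"
  then obtain f g where f: "arr f" "\<alpha> = hcls f" and g: "arr g" "\<beta> = hcls g" "src g = src f" "tgt g = tgt f"
    by (auto simp: ho_Arr)
  obtain t where t: "cover_map (K (src f)) (R (src f)) (K (tgt f)) (R (tgt f)) t f"
    "AMap (Lo P) (hcls f) = hcls t" "arr t"
    using loop_AMapE[OF f(1)] by metis
  obtain s where s: "cover_map (K (src f)) (R (src f)) (K (tgt f)) (R (tgt f)) s g"
    "AMap (Lo P) (hcls g) = hcls s" "arr s"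
    using loop_AMapE[OF g(1)] g(3,4) by metis
  have "t \<simeq> s" using eq f(2) g(2) t(2,3) s(2,3) ho_class_eq_iff[of t s] by simp
  then have "f \<simeq> g" using cover_map_stably_equal_iff[OF covK(1) covK(1) t(1) s(1)] f(1) by simp
  then show "\<alpha> = \<beta>" using f g stably_equal_imp_ho_class_eq by simp
next
  fix X Y \<beta> assume X: "X \<in> Obj Ho" "Y \<in> Obj Ho" and \<beta>: "\<beta> \<in> Hom Ho (OMap (Lo P) X) (OMap (Lo P) Y)"
  then obtain t where t: "arr t" "\<beta> = hcls t" "src t = OMap (Lo P) X" "tgt t = OMap (Lo P) Y"
    by (auto simp: ho_Arr mem_Hom)
  have "X \<in> Obj C" "Y \<in> Obj C" using X by simp_all
  note c = covK[OF this(1)] covK[OF this(2)]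
  obtain f where f: "cover_map (K X) (R X) (K Y) (R Y) t f"
    using cover_map_from_left[OF c(1,5) t(1)] c t by auto
  note D = cover_mapD[OF f]
  show "\<exists>\<alpha>\<in>Hom Ho X Y. AMap (Lo P) \<alpha> = \<beta>"
    using D c t loop_AMap[of f t] f by (intro bexI[of _ "hcls f"]) (simp_all add: mem_Hom)
next
  fix Y assume "Y \<in> Obj Ho"
  then have Y: "Y \<in> Obj C" by simp
  obtain m where m: "inflation E m" "arr m" "src m = Y" "proj_inj C E (tgt m)"
    using injective_hull[OF Y] by metis
  obtain d where d: "cover m d" using m by (auto simp: inflation_def cover_def)
  define X where "X = tgt d"
  have X: "X \<in> Obj C" "tgt d = X" using coverD[OF d] by (simp_all add: X_def)
  note c = covK[OF X(1)]
  obtain t where t: "cover_map (K X) (R X) m d t (Idn C X)"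
    using cover_map_from_right[OF c(1) d, of "Idn C X"] X c(3) by auto
  obtain t' where t': "cover_map m d (K X) (R X) t' (Idn C X)"
    using cover_map_from_right[OF d c(1), of "Idn C X"] X c(3) by auto
  note D = cover_mapD[OF t] cover_mapD[OF t']
  interpret H: category Ho by (rule ho_category)
  have "t' \<cdot> t \<simeq> Idn C (src (K X))" "t \<cdot> t' \<simeq> Idn C (src m)"
    using cover_map_inverse_iff[OF c(1) d t t'] cover_map_inverse_iff[OF d c(1) t' t] X c(3)
      stably_equal_refl[of "Idn C X"] by simp_all
  then have "Defs.is_iso Ho (hcls t)"
    using D coverD(1)[OF c(1)] m Y
    by (intro H.is_isoI[of "hcls t" "hcls t'"]) (simp_all add: stably_equal_imp_ho_class_eq)
  then show "\<exists>X\<in>Obj Ho. \<exists>e\<in>Hom Ho (OMap (Lo P) X) Y. Defs.is_iso Ho e"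
    using D c(2) m(3) X by (intro bexI[of _ X] bexI[of _ "hcls t"]) (simp_all add: mem_Hom)
qed

text \<open>Quillen's action involves the inverse of \<open>\<pi>\<close>, so an explicit preimage
  of (0, 1) under \<open>\<pi>\<close> is built, namely \<open>g = (0, y k, \<delta>)\<close>. Its
  right-hand component \<open>\<delta>\<close> is then the boundary.\<close>

lemma quillen_boundary_lift:
  assumes q: "quillen_boundary C FM P p i d"
  obtains \<delta> e where "d = hcls \<delta>" "arr \<delta>" "src \<delta> = src (K (tgt p))" "tgt \<delta> = src i"
    "arr e" "src e = tgt (K (tgt p))" "tgt e = tgt i"
    "p \<cdot> e = R (tgt p)" "i \<cdot> \<delta> = e \<cdot> K (tgt p)"
    "deflation E p" "is_kernel C i p"
proof -
  define B where "B = tgt p"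
  obtain n0 n1 m z where act: "quillen_action C FM P p i n0 n1 m" and z: "arr z" "src z = tgt n1"
    "tgt z = src n0" "n0 \<cdot> z = Zero C (tgt n1) (tgt n0)" "n1 \<cdot> z = Idn C (tgt n1)" "d = m \<cdot>\<^bsub>Ho\<^esub> hcls z"
    using q unfolding quillen_boundary_def mem_Hom by blast
  have p: "deflation E p" "is_kernel C i p" using act by (simp_all add: quillen_action_def)
  have n: "is_product C n0 n1" "tgt n0 = src i" "tgt n1 = src (po_k (P B))"
    using act by (simp_all add: quillen_action_def Let_def B_def)
  obtain l0 l1 l2 h q m0 m1 m2 \<pi> \<rho> where
      l: "is_double_pullback C p (po_p0 C (P B)) (po_p1 C (P B)) p l0 l1 l2" and
      q: "deflation E q" "q \<in> Hom C (tgt h) (src l0)" and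
      m: "is_double_pullback C i (l0 \<cdot> q) (l2 \<cdot> q) i m0 m1 m2" and
      \<pi>: "\<pi> \<in> Hom C (src m0) (src n0)" "n0 \<cdot> \<pi> = m0" "po_k (P B) \<cdot> n1 \<cdot> \<pi> = (l1 \<cdot> q) \<cdot> m1" and
      \<rho>: "inverse_arrows Ho (hcls \<pi>) \<rho>" "m = hcls m2 \<cdot>\<^bsub>Ho\<^esub> \<rho>"
    using act unfolding quillen_action_def Let_def B_def[symmetric] frobenius_model_simps mem_Collect_eq by blast
  note I = is_kernelD[OF p(2)]
  have B: "B \<in> Obj C" using I by (simp add: B_def)
  note PD = path_objectD[OF is_path_object_P[OF B]]
  define j k r where "j = J B" and "k = K B" and "r = R B"
  note jkr = j_def[symmetric] k_def[symmetric] r_def[symmetric]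
  note K = path_coverD[OF cov[OF B], unfolded jkr] and cs = covK[OF B, unfolded jkr] and cv = coverD[OF covK(1)[OF B], unfolded jkr]
  note J = is_kernelD[OF K(2), unfolded PD]
  note L = is_double_pullbackD[OF l] and M = is_double_pullbackD[OF m] and N = is_productD[OF n(1)]
  have q': "arr q" "tgt q = src l0" using q by (simp_all add: mem_Hom)
  have \<pi>': "arr \<pi>" "src \<pi> = src m0" "tgt \<pi> = src n0" using \<pi>(1) by (simp_all add: mem_Hom)
  obtain e where e: "arr e" "src e = tgt k" "tgt e = src p" "p \<cdot> e = r"
    using proj_inj_lift[OF cv(9) p(1), of r] cv cs(3) B_def by auto
  \<comment> \<open>To a path starting at zero this assigns the zero of the total object, the path
    itself, and the lift \<open>e\<close> of its endpoint.\<close>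
  obtain x where x: "arr x" "src x = tgt k" "tgt x = src l0"
    "l0 \<cdot> x = Zero C (tgt k) (src p)" "l1 \<cdot> x = j" "l2 \<cdot> x = e"
    by (rule is_double_pullback_triple[OF l, of "Zero C (tgt k) (src p)" j e])
      (use I cv(1-3) J PD(18-23) K(3,5) e B_def in simp_all)
  \<comment> \<open>The source of \<open>x\<close> is the middle term of a cover, hence projective,
    so \<open>x\<close> lifts through the fibration \<open>q\<close>.\<close>
  obtain y where y: "arr y" "src y = tgt k" "tgt y = src q" "q \<cdot> y = x"
    using proj_inj_lift[OF cv(9) q(1), of x] x q' by auto
  have "p \<cdot> (e \<cdot> k) = Zero C (src (e \<cdot> k)) (tgt p)"
    using Cmp_eq_Cmp[OF e(4), of k] e(1-3) cv(1-4) cs(3) I(1,2) B_def by simp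
  then have "\<exists>\<delta>. \<delta> \<in> Arr C \<and> src \<delta> = src (e \<cdot> k) \<and> tgt \<delta> = src i \<and> i \<cdot> \<delta> = e \<cdot> k"
    using is_kernel_lift[OF p(2), of "e \<cdot> k"] e(1-3) cv(1-3) by (metis Cmp_simps)
  then obtain \<delta> where \<delta>: "arr \<delta>" "src \<delta> = src k" "tgt \<delta> = src i" "i \<cdot> \<delta> = e \<cdot> k"
    using e cv(1-3) by auto
  obtain g where g: "arr g" "src g = src k" "tgt g = src m0"
    "m0 \<cdot> g = Zero C (src k) (src i)" "m1 \<cdot> g = y \<cdot> k" "m2 \<cdot> g = \<delta>"
    by (rule is_double_pullback_triple[OF m, of "Zero C (src k) (src i)" "y \<cdot> k" \<delta>])
      (use I cv(1-3) q' x y \<delta> L(1-15) Cmp_eq_Cmp[OF y(4), of k] Cmp_eq_Cmp[OF x(4), of k]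
        Cmp_eq_Cmp[OF x(6), of k] in simp_all)
  \<comment> \<open>Both sides have components 0 and the identity. The second is tested after the
    monomorphism \<open>po_k\<close>, where \<open>l1 q y k\<close> becomes
    \<open>j k\<close>.\<close>
  have "\<pi> \<cdot> g = z"
  proof (rule is_product_ext[OF n(1)])
    show "n0 \<cdot> (\<pi> \<cdot> g) = n0 \<cdot> z"
      using Cmp_eq_Cmp[OF \<pi>(2), of g] g \<pi>' N z n K(4) by simp
    have "po_k (P B) \<cdot> (n1 \<cdot> (\<pi> \<cdot> g)) = (po_k (P B) \<cdot> n1 \<cdot> \<pi>) \<cdot> g"
      using g(1-3) \<pi>' N n PD(25) by simp
    also have "\<dots> = l1 \<cdot> (q \<cdot> (m1 \<cdot> g))"
      unfolding \<pi>(3) using g(1-3) L(1-15) M(1-15) q' by simp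
    also have "\<dots> = (l1 \<cdot> (q \<cdot> y)) \<cdot> k"
      unfolding g(5) using y(1-3) L(1-15) q' cv(1-3) by simp
    also have "\<dots> = po_k (P B)" unfolding y(4) x(5) by (rule K(6))
    finally have "po_k (P B) \<cdot> (n1 \<cdot> (\<pi> \<cdot> g)) = po_k (P B) \<cdot> Idn C (tgt n1)"
      using n PD(25) by simp
    then have "n1 \<cdot> (\<pi> \<cdot> g) = Idn C (tgt n1)"
      by (rule kernel_mono[OF PD(14), rotated -1]) (use g(1-3) \<pi>' N n PD(25) K(4) in simp_all)
    then show "n1 \<cdot> (\<pi> \<cdot> g) = n1 \<cdot> z" using z by simp
  qed (use g \<pi>' N z n K(4) in simp_all)
  interpret H: category Ho by (rule ho_category)
  note R = H.inverse_arrowsD[OF \<rho>(1)]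
  have "d = (hcls m2 \<cdot>\<^bsub>Ho\<^esub> \<rho>) \<cdot>\<^bsub>Ho\<^esub> (hcls \<pi> \<cdot>\<^bsub>Ho\<^esub> hcls g)"
    using z(6) \<rho>(2) \<open>\<pi> \<cdot> g = z\<close> g \<pi>' by simp
  also have "\<dots> = hcls m2 \<cdot>\<^bsub>Ho\<^esub> (\<rho> \<cdot>\<^bsub>Ho\<^esub> (hcls \<pi> \<cdot>\<^bsub>Ho\<^esub> hcls g))"
    using R(1-4) g(1-3) \<pi>' M(8-15) by (intro H.Cmp_assoc_simp) simp_all
  also have "\<rho> \<cdot>\<^bsub>Ho\<^esub> (hcls \<pi> \<cdot>\<^bsub>Ho\<^esub> hcls g) = Idn Ho (Src Ho (hcls \<pi>)) \<cdot>\<^bsub>Ho\<^esub> hcls g"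
    using R(1-4) g(1-3) \<pi>' by (intro H.Cmp_eq_Cmp[OF R(5)]) simp_all
  also have "\<dots> = hcls g" using g(1-3) \<pi>' by (intro H.Idn_Cmp_simp) simp_all
  also have "hcls m2 \<cdot>\<^bsub>Ho\<^esub> hcls g = hcls \<delta>" using g M(8-15) by simp
  finally have "d = hcls \<delta>" .
  then show thesis using that[of \<delta> e] \<delta> e p I(3) unfolding jkr B_def[symmetric] by simp
qed

end

end

lemma quillen_tricat_simps:
  "Shift (quillen_tricat C M P \<Sigma> \<eta>) = \<Sigma>"
  "Src (quillen_tricat C M P \<Sigma> \<eta>) = Src (ho_cat C M)"
  "(u, v, w) \<in> Tri (quillen_tricat C M P \<Sigma> \<eta>) \<longleftrightarrow> (\<exists>d. (d, u, v) \<in> left_triangles C M P \<and>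
    w = AMap \<Sigma> d \<cdot>\<^bsub>ho_cat C M\<^esub> \<eta> (Tgt (ho_cat C M) v))"
  by (simp_all add: quillen_tricat_def cat.defs tricat.defs)

lemma happel_tricat_simps:
  "Shift (happel_tricat C E \<mu> \<pi>) = happel_shift C E \<mu> \<pi>"
  "Cmp (happel_tricat C E \<mu> \<pi>) = Cmp (stable_cat C E)"
  "t \<in> Tri (happel_tricat C E \<mu> \<pi>) \<longleftrightarrow> (\<exists>u v w. happel_standard C \<mu> \<pi> u v w \<and>
    isomorphic_triangles (stable_cat C E) (happel_shift C E \<mu> \<pi>)
      (stable_class C E u, stable_class C E v, stable_class C E w) t)"
  by (simp_all add: happel_tricat_def cat.defs tricat.defs)

section \<open>Quillen's triangles are sent to Happel's triangles\<close>

context frobenius_category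
begin

text \<open>\<open>\<psi> Z : Z -> T \<Omega> Z\<close> compares the path cover of \<open>Z\<close>
  with the chosen hull of its loop object. Inducing it from -1 instead of 1 supplies the sign in
  \<open>conflation_triangle\<close>.\<close>

context
  fixes \<mu> \<pi> :: "'o \<Rightarrow> 'm" and P :: "'o \<Rightarrow> 'm path_object" and J K R \<psi> :: "'o \<Rightarrow> 'm"
  assumes happel: "happel_choice C E \<mu> \<pi>" and paths: "path_object_choice C FM P"
    and covers: "\<forall>Z\<in>Obj C. path_cover (P Z) (J Z) (K Z) (R Z)"
    and \<psi>: "\<And>Z. Z \<in> Obj C \<Longrightarrow> cover_map (K Z) (R Z) (\<mu> (src (K Z))) (\<pi> (src (K Z))) (Neg (Idn C (src (K Z)))) (\<psi> Z)"
begin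

lemmas covK' = covK[OF paths covers]

lemma \<psi>_simps:
  assumes "Z \<in> Obj C"
  shows "\<psi> Z \<in> Arr C" "src (\<psi> Z) = Z" "tgt (\<psi> Z) = OMap (Sh \<mu> \<pi>) (OMap (Lo P) Z)"
  using cover_mapD(2,5,6)[OF \<psi>[OF assms]] covK'[OF assms] by (simp_all add: shift_OMap[OF happel])

lemma \<psi>_natural: "natural_iso Ho St ho_stable (comp_ftr (Sh \<mu> \<pi>) (comp_ftr ho_stable (Lo P))) (\<lambda>Z. scls (\<psi> Z))"
proof (rule natural_isoI)
  show "is_functor Ho St (comp_ftr (Sh \<mu> \<pi>) (comp_ftr ho_stable (Lo P)))"
    by (rule is_functor_comp_ftr[OF is_functor_comp_ftr[OF loop_functor[OF paths covers] ho_stable_functor] shift_functor[OF happel]])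
next
  fix Z assume "Z \<in> Obj Ho"
  then have Z: "Z \<in> Obj C" by simp
  note p = \<psi>_simps[OF Z] and c = covK'[OF Z]
  show "scls (\<psi> Z) \<in> Arr St" "Src St (scls (\<psi> Z)) = OMap ho_stable Z"
    "Tgt St (scls (\<psi> Z)) = OMap (comp_ftr (Sh \<mu> \<pi>) (comp_ftr ho_stable (Lo P))) Z"
    using p by simp_all
  define V where "V = OMap (Lo P) Z"
  have V: "src (K Z) = V" "V \<in> Obj C" using c by (simp_all add: V_def)
  note h = happel_cover[OF happel V(2)]
  note psi = \<psi>[OF Z, unfolded V]
  obtain \<psi>' where \<psi>': "cover_map (\<mu> V) (\<pi> V) (K Z) (R Z) (Neg (Idn C V)) \<psi>'"
    using cover_map_from_left[OF h(1) c(1), of "Neg (Idn C V)"] V h by auto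
  \<comment> \<open>As -1 is its own inverse, the cover maps it induces in the two directions are
    inverse at the left end, hence stably inverse at the right end.\<close>
  have "Neg (Idn C V) \<cdot> Neg (Idn C V) = Idn C V" using V by (simp add: Neg_Cmp)
  then have "\<psi>' \<cdot> \<psi> Z \<simeq> Idn C (tgt (R Z))" "\<psi> Z \<cdot> \<psi>' \<simeq> Idn C (tgt (\<pi> V))"
    using cover_map_inverse_iff[OF c(1) h(1) psi \<psi>'] cover_map_inverse_iff[OF h(1) c(1) \<psi>' psi]
      V h stably_equal_refl[of "Idn C V"] by simp_all
  then have "weq (\<psi> Z)"
    using cover_mapD[OF psi] cover_mapD[OF \<psi>'] p(2) c(3) by (intro stable_equivalenceI[of _ \<psi>']) simp_all
  then show "Defs.is_iso St (scls (\<psi> Z))" by (simp add: stable_equivalence_def)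
next
  fix \<alpha> assume "\<alpha> \<in> Arr Ho"
  then obtain f where f: "arr f" "\<alpha> = hcls f" by (rule ho_ArrE)
  define X where "X = src f"
  define Y where "Y = tgt f"
  have X: "X \<in> Obj C" "src f = X" and Y: "Y \<in> Obj C" "tgt f = Y" using f by (simp_all add: X_def Y_def)
  note cX = covK'[OF X(1)] and cY = covK'[OF Y(1)]
  obtain t where t: "cover_map (K X) (R X) (K Y) (R Y) t f" and L: "AMap (Lo P) \<alpha> = hcls t"
    using loop_AMapE[OF paths covers f(1)] f(2) X(2) Y(2) by metis
  note tD = cover_mapD[OF t]
  obtain u where u: "cover_map (\<mu> (src t)) (\<pi> (src t)) (\<mu> (tgt t)) (\<pi> (tgt t)) t u"
    "AMap (Sh \<mu> \<pi>) (scls t) = scls u" "arr u" "src u = tgt (\<pi> (src t))" "tgt u = tgt (\<pi> (tgt t))"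
    using shift_AMapE[OF happel tD(1)] by metis
  have u': "cover_map (\<mu> (src (K X))) (\<pi> (src (K X))) (\<mu> (src (K Y))) (\<pi> (src (K Y))) t u"
    using u(1) tD by simp
  have hX: "cover (\<mu> (src (K X))) (\<pi> (src (K X)))" and hY: "cover (\<mu> (src (K Y))) (\<pi> (src (K Y)))"
    using happel_cover(1)[OF happel] cX cY by simp_all
  \<comment> \<open>The sign commutes with \<open>t\<close>, so the two cover maps around the
    naturality square agree at the left end.\<close>
  have "t \<cdot> Neg (Idn C (src (K X))) = Neg (Idn C (src (K Y))) \<cdot> t"
    using tD coverD(1)[OF cX(1)] coverD(1)[OF cY(1)] by (simp add: Neg_Cmp)
  with cover_map_Cmp[OF cX(1) hX hY \<psi>[OF X(1)] u']
  have "cover_map (K X) (R X) (\<mu> (src (K Y))) (\<pi> (src (K Y))) (Neg (Idn C (src (K Y))) \<cdot> t) (u \<cdot> \<psi> X)"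
    by simp
  from cover_map_stably_equal_iff[OF cX(1) hY this cover_map_Cmp[OF cX(1) cY(1) hY t \<psi>[OF Y(1)]]]
  have "u \<cdot> \<psi> X \<simeq> \<psi> Y \<cdot> f"
    using stably_equal_refl tD coverD(1)[OF cY(1)] by simp
  then have "scls (\<psi> Y \<cdot> f) = scls (u \<cdot> \<psi> X)" by (metis stable_class_eqI)
  then show "scls (\<psi> (Tgt Ho \<alpha>)) \<cdot>\<^bsub>St\<^esub> AMap ho_stable \<alpha> =
      AMap (comp_ftr (Sh \<mu> \<pi>) (comp_ftr ho_stable (Lo P))) \<alpha> \<cdot>\<^bsub>St\<^esub> scls (\<psi> (Src Ho \<alpha>))"
    using f X Y L u tD \<psi>_simps[OF X(1)] \<psi>_simps[OF Y(1)] cX by (simp add: shift_OMap[OF happel] loop_OMap[OF paths covers])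
qed (rule ho_stable_functor)

text \<open>The lift \<open>\<delta> : \<Omega> B -> F\<close> and the connecting morphism
  \<open>w : B -> T F\<close> are the two ends of one cover map; hence the shift of
  \<open>\<delta>\<close> after \<open>\<psi> B\<close> is the class of \<open>- w\<close>, as
  \<open>conflation_triangle\<close> demands.\<close>

lemma boundary_triangle:
  assumes q: "quillen_boundary C FM P p i d"
  obtains v w \<delta> where "happel_standard C \<mu> \<pi> i v w" "d = hcls \<delta>" "arr \<delta>"
    "src \<delta> = OMap (Lo P) (tgt p)" "tgt \<delta> = src i"
    "isomorphic_triangles St (Sh \<mu> \<pi>) (scls i, scls v, scls w)
      (scls i, scls p, AMap (Sh \<mu> \<pi>) (scls \<delta>) \<cdot>\<^bsub>St\<^esub> scls (\<psi> (tgt p)))"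
    "(i, p) \<in> E"
proof -
  define B where "B = tgt p"
  define F where "F = src i"
  have "deflation E p" using q by (auto simp: quillen_boundary_def quillen_action_def)
  then have B: "B \<in> Obj C" using deflation_Arr by (simp add: B_def)
  note c = covK'[OF B]
  obtain \<delta> e where \<delta>: "d = hcls \<delta>" "arr \<delta>" "src \<delta> = src (K B)" "tgt \<delta> = src i"
    "arr e" "src e = tgt (K B)" "tgt e = tgt i" "p \<cdot> e = R B" "i \<cdot> \<delta> = e \<cdot> K B"
    "deflation E p" "is_kernel C i p"
    using quillen_boundary_lift[OF paths covers q] B_def by metis
  have ip: "(i, p) \<in> E" using kernel_conflation \<delta>(10,11) by blast
  note I = is_kernelD[OF \<delta>(11)]
  have F: "F \<in> Obj C" "src i = F" using I by (simp_all add: F_def)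
  note h = happel_cover[OF happel F(1)] and hD = coverD[OF happel_cover(1)[OF happel F(1)]]
  have inf: "inflation E i" using ip by (auto simp: inflation_def)
  obtain \<sigma> where \<sigma>: "arr \<sigma>" "src \<sigma> = tgt i" "tgt \<sigma> = tgt (\<mu> F)" "\<sigma> \<cdot> i = \<mu> F"
    using proj_inj_extend[OF hD(9) inf, of "\<mu> F"] hD h F by auto
  have 0: "(\<pi> F \<cdot> \<sigma>) \<cdot> i = Zero C (src i) (tgt (\<pi> F \<cdot> \<sigma>))"
    using \<sigma> hD(1-4) h(2) I F by simp
  obtain w where w: "arr w" "src w = tgt p" "tgt w = tgt (\<pi> F \<cdot> \<sigma>)" "w \<cdot> p = \<pi> F \<cdot> \<sigma>"
    by (rule is_cokernel_desc[OF conflation[OF ip, THEN conjunct2] _ _ 0]) (use \<sigma> hD(1-3) I in simp_all)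
  have w': "tgt w = tgt (\<pi> F)" using w(3) \<sigma> hD by simp
  obtain v w0 where vw: "happel_standard C \<mu> \<pi> i v w0"
    "isomorphic_triangles St (Sh \<mu> \<pi>) (scls i, scls v, scls w0) (scls i, scls p, scls (Neg w))"
    by (rule conflation_triangle[OF happel ip, of \<sigma> w]) (use \<sigma> w w' F in simp_all)
  \<comment> \<open>The middle morphism lifts to the total object by \<open>e\<close> and then goes
    on to the hull of F by \<open>\<sigma>\<close>.\<close>
  have cm: "cover_map (K B) (R B) (\<mu> F) (\<pi> F) \<delta> w"
  proof (rule cover_mapI[where e = "\<sigma> \<cdot> e"])
    show "(\<sigma> \<cdot> e) \<cdot> K B = \<mu> F \<cdot> \<delta>"
      using \<sigma>(1-3) \<delta>(2-7) coverD(1-3)[OF c(1)] Cmp_eq_Cmp[OF \<sigma>(4), of \<delta>] I(1) F(2) by (simp flip: \<delta>(9))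
    show "\<pi> F \<cdot> \<sigma> \<cdot> e = w \<cdot> R B"
      using \<sigma>(1-3) \<delta>(5-7) hD(1-3) w(1,2) I(2,3) Cmp_eq_Cmp[OF w(4), of e] by (simp flip: \<delta>(8))
  qed (use \<delta>(2-7) w(1,2) w' \<sigma>(1-3) h(2) F(2) c(3) B_def in simp_all)
  define V where "V = src (K B)"
  have V: "V \<in> Obj C" "src (K B) = V" using c by (simp_all add: V_def)
  note hV = happel_cover[OF happel V(1)]
  obtain t where t: "cover_map (\<mu> V) (\<pi> V) (\<mu> F) (\<pi> F) \<delta> t" "AMap (Sh \<mu> \<pi>) (scls \<delta>) = scls t"
    using shift_AMapE[OF happel \<delta>(2)] \<delta>(3,4) F(2) V(2) by metis
  note m = cover_map_Cmp[OF c(1) hV(1) h(1) \<psi>[OF B, unfolded V] t(1)]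
  \<comment> \<open>The composite through \<open>\<psi> B\<close> and the negative of
    \<open>cm\<close> now have the same left end, so their right ends are stably equal.\<close>
  have "\<delta> \<cdot> Neg (Idn C V) = Neg \<delta>" using \<delta>(2,3) V by (simp add: Neg_Cmp)
  with m have "cover_map (K B) (R B) (\<mu> F) (\<pi> F) (Neg \<delta>) (t \<cdot> \<psi> B)" by simp
  from cover_map_stably_equal_iff[OF c(1) h(1) this cover_map_Neg[OF c(1) h(1) cm]]
  have "t \<cdot> \<psi> B \<simeq> Neg w" using stably_equal_refl \<delta>(2) by simp
  then have "scls (Neg w) = scls (t \<cdot> \<psi> B)" by (metis stable_class_eqI)
  also have "\<dots> = AMap (Sh \<mu> \<pi>) (scls \<delta>) \<cdot>\<^bsub>St\<^esub> scls (\<psi> B)"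
    using cover_mapD[OF t(1)] t(2) cover_mapD[OF \<psi>[OF B, unfolded V]] by simp
  finally show thesis
    using vw \<delta>(1-4) c(2) ip by (intro that[of v w0 \<delta>]) (simp_all add: B_def)
qed

text \<open>A left triangle is isomorphic to one coming from a fibration, which
  \<open>boundary_triangle\<close> settles; naturality of \<open>\<psi>\<close> at \<open>c\<close>
  carries the last morphism along that isomorphism.\<close>

lemma left_triangle_image:
  assumes l: "(d, u, v) \<in> left_triangles C FM P"
  shows "\<exists>x y z. happel_standard C \<mu> \<pi> x y z \<and> isomorphic_triangles St (Sh \<mu> \<pi>) (scls x, scls y, scls z)
    (AMap ho_stable u, AMap ho_stable v, AMap (Sh \<mu> \<pi>) (AMap ho_stable d) \<cdot>\<^bsub>St\<^esub> scls (\<psi> (Tgt Ho v)))"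
proof -
  interpret H: category Ho by (rule ho_category)
  interpret S: category St by (rule stable_category)
  note loops = is_functorD(3-)[OF loop_functor[OF paths covers]] and shift = is_functorD(3-)[OF shift_functor[OF happel]]
    and hs = is_functorD(3-)[OF ho_stable_functor]
  define Z where "Z = Tgt Ho v"
  obtain p i d0 a b c where bd: "quillen_boundary C FM P p i d0" and
    iso: "Defs.is_iso Ho a" "Defs.is_iso Ho b" "Defs.is_iso Ho c" and
    ar: "u \<in> Arr Ho" "v \<in> Arr Ho" "Src Ho v = Tgt Ho u" "d \<in> Arr Ho" "Src Ho d = OMap (Lo P) Z" "Tgt Ho d = Src Ho u"
      "a \<in> Arr Ho" "Src Ho a = src i" "Tgt Ho a = Src Ho u" "b \<in> Arr Ho" "Src Ho b = src p" "Tgt Ho b = Tgt Ho u"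
      "c \<in> Arr Ho" "Src Ho c = tgt p" "Tgt Ho c = Z" and
    eq: "d \<cdot>\<^bsub>Ho\<^esub> AMap (Lo P) c = a \<cdot>\<^bsub>Ho\<^esub> d0" "u \<cdot>\<^bsub>Ho\<^esub> a = b \<cdot>\<^bsub>Ho\<^esub> hcls i" "v \<cdot>\<^bsub>Ho\<^esub> b = c \<cdot>\<^bsub>Ho\<^esub> hcls p"
    using l unfolding left_triangles_def Let_def mem_Collect_eq case_prod_conv mem_Hom Z_def by blast
  obtain x y \<delta> where st: "happel_standard C \<mu> \<pi> i x y" and \<delta>: "d0 = hcls \<delta>" "arr \<delta>"
    "src \<delta> = OMap (Lo P) (tgt p)" "tgt \<delta> = src i" and
    tri: "isomorphic_triangles St (Sh \<mu> \<pi>) (scls i, scls x, scls y)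
      (scls i, scls p, AMap (Sh \<mu> \<pi>) (scls \<delta>) \<cdot>\<^bsub>St\<^esub> scls (\<psi> (tgt p)))" and ip: "(i, p) \<in> E"
    using boundary_triangle[OF bd] by metis
  define B where "B = tgt p"
  note I = is_kernelD[OF conflation[OF ip, THEN conjunct1]]
  have ZB: "Z \<in> Obj C" "B \<in> Obj C" "tgt p = B" using ar H.Tgt_Obj[of v] I by (simp_all add: Z_def B_def)
  note pZ = \<psi>_simps[OF ZB(1)] and pB = \<psi>_simps[OF ZB(2)]
  have nat: "scls (\<psi> Z) \<cdot>\<^bsub>St\<^esub> AMap ho_stable c = AMap (Sh \<mu> \<pi>) (AMap ho_stable (AMap (Lo P) c)) \<cdot>\<^bsub>St\<^esub> scls (\<psi> B)"
    using natural_isoD(7)[OF \<psi>_natural, of c] ar ZB by simp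
  have dc: "AMap ho_stable d \<cdot>\<^bsub>St\<^esub> AMap ho_stable (AMap (Lo P) c) = AMap ho_stable a \<cdot>\<^bsub>St\<^esub> scls \<delta>"
    using arg_cong[OF eq(1), of "AMap ho_stable"] ar \<delta> ZB by (simp add: hs loops)
  have "isomorphic_triangles St (Sh \<mu> \<pi>) (scls i, scls p, AMap (Sh \<mu> \<pi>) (scls \<delta>) \<cdot>\<^bsub>St\<^esub> scls (\<psi> B))
    (AMap ho_stable u, AMap ho_stable v, AMap (Sh \<mu> \<pi>) (AMap ho_stable d) \<cdot>\<^bsub>St\<^esub> scls (\<psi> Z))"
    unfolding isomorphic_triangles_def case_prod_conv
  proof (intro conjI exI)
    show "is_triangle St (Sh \<mu> \<pi>) (scls i) (scls p) (AMap (Sh \<mu> \<pi>) (scls \<delta>) \<cdot>\<^bsub>St\<^esub> scls (\<psi> B))"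
      using I \<delta> ZB pB by (simp add: is_triangle_def mem_Hom shift)
    show "is_triangle St (Sh \<mu> \<pi>) (AMap ho_stable u) (AMap ho_stable v) (AMap (Sh \<mu> \<pi>) (AMap ho_stable d) \<cdot>\<^bsub>St\<^esub> scls (\<psi> Z))"
      using ar pZ by (simp add: is_triangle_def mem_Hom shift hs flip: Z_def)
    show "Defs.is_iso St (AMap ho_stable a)" "Defs.is_iso St (AMap ho_stable b)" "Defs.is_iso St (AMap ho_stable c)"
      using iso by (auto intro: functor_is_iso[OF ho_stable_functor])
    show "AMap ho_stable u \<cdot>\<^bsub>St\<^esub> AMap ho_stable a = AMap ho_stable b \<cdot>\<^bsub>St\<^esub> scls i"
      using arg_cong[OF eq(2), of "AMap ho_stable"] ar I by (simp add: hs)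
    show "AMap ho_stable v \<cdot>\<^bsub>St\<^esub> AMap ho_stable b = AMap ho_stable c \<cdot>\<^bsub>St\<^esub> scls p"
      using arg_cong[OF eq(3), of "AMap ho_stable"] ar I by (simp add: hs)
    have "(AMap (Sh \<mu> \<pi>) (AMap ho_stable d) \<cdot>\<^bsub>St\<^esub> scls (\<psi> Z)) \<cdot>\<^bsub>St\<^esub> AMap ho_stable c
      = AMap (Sh \<mu> \<pi>) (AMap ho_stable d \<cdot>\<^bsub>St\<^esub> AMap ho_stable (AMap (Lo P) c)) \<cdot>\<^bsub>St\<^esub> scls (\<psi> B)"
      using ar pZ pB ZB nat by (simp add: shift hs loops)
    also have "\<dots> = AMap (Sh \<mu> \<pi>) (AMap ho_stable a) \<cdot>\<^bsub>St\<^esub> (AMap (Sh \<mu> \<pi>) (scls \<delta>) \<cdot>\<^bsub>St\<^esub> scls (\<psi> B))"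
      unfolding dc using ar \<delta> pB ZB by (simp add: shift hs loops)
    finally show "(AMap (Sh \<mu> \<pi>) (AMap ho_stable d) \<cdot>\<^bsub>St\<^esub> scls (\<psi> Z)) \<cdot>\<^bsub>St\<^esub> AMap ho_stable c
      = AMap (Sh \<mu> \<pi>) (AMap ho_stable a) \<cdot>\<^bsub>St\<^esub> (AMap (Sh \<mu> \<pi>) (scls \<delta>) \<cdot>\<^bsub>St\<^esub> scls (\<psi> B))" .
  qed (use ar I ZB in \<open>simp_all add: mem_Hom hs flip: Z_def\<close>)
  with isomorphic_triangles_trans[OF shift_functor[OF happel] tri] st show ?thesis
    unfolding ZB(3) Z_def by blast
qed

lemma quillen_happel_equivalence:
  assumes q: "quasi_inverse Ho Ho (Lo P) \<Sigma> \<eta> \<epsilon>"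
  shows "\<exists>\<Phi> \<phi>. triangulated_equivalence (quillen_tricat C FM P \<Sigma> \<eta>) (happel_tricat C E \<mu> \<pi>) \<Phi> \<phi>"
proof -
  obtain \<phi> where \<phi>: "natural_iso Ho St (comp_ftr ho_stable \<Sigma>) (comp_ftr (Sh \<mu> \<pi>) ho_stable) \<phi>"
    "\<And>Z d. \<lbrakk>Z \<in> Obj Ho; d \<in> Arr Ho; Src Ho d = OMap (Lo P) Z\<rbrakk> \<Longrightarrow>
      \<phi> (Tgt Ho d) \<cdot>\<^bsub>St\<^esub> AMap ho_stable (AMap \<Sigma> d \<cdot>\<^bsub>Ho\<^esub> \<eta> Z) = AMap (Sh \<mu> \<pi>) (AMap ho_stable d) \<cdot>\<^bsub>St\<^esub> scls (\<psi> Z)"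
    using quasi_inverse_shift_comparison[OF q ho_stable_functor shift_functor[OF happel] \<psi>_natural] by metis
  interpret H: category Ho by (rule ho_category)
  have "(AMap ho_stable u, AMap ho_stable v, \<phi> (Src Ho u) \<cdot>\<^bsub>St\<^esub> AMap ho_stable w) \<in> Tri (happel_tricat C E \<mu> \<pi>)"
    if "(u, v, w) \<in> Tri (quillen_tricat C FM P \<Sigma> \<eta>)" for u v w
  proof -
    obtain d where d: "(d, u, v) \<in> left_triangles C FM P" "w = AMap \<Sigma> d \<cdot>\<^bsub>Ho\<^esub> \<eta> (Tgt Ho v)"
      using \<open>(u, v, w) \<in> _\<close> unfolding quillen_tricat_simps by blast
    have "v \<in> Arr Ho" "d \<in> Arr Ho" "Src Ho d = OMap (Lo P) (Tgt Ho v)" "Tgt Ho d = Src Ho u"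
      using d(1) unfolding left_triangles_def Let_def mem_Collect_eq case_prod_conv mem_Hom by blast+
    \<comment> \<open>The defining property of \<open>\<phi>\<close> removes \<open>\<Sigma>\<close>
      and \<open>\<eta>\<close> from the last morphism and leaves the form of
      \<open>left_triangle_image\<close>.\<close>
    then have "\<phi> (Src Ho u) \<cdot>\<^bsub>St\<^esub> AMap ho_stable w = AMap (Sh \<mu> \<pi>) (AMap ho_stable d) \<cdot>\<^bsub>St\<^esub> scls (\<psi> (Tgt Ho v))"
      using \<phi>(2)[of "Tgt Ho v" d] d(2) H.Tgt_Obj[of v] by simp
    then show ?thesis using left_triangle_image[OF d(1)] by (simp add: happel_tricat_simps)
  qed
  moreover have "is_equivalence (quillen_tricat C FM P \<Sigma> \<eta>) (happel_tricat C E \<mu> \<pi>) ho_stable"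
    using ho_stable_equivalence by (simp add: quillen_tricat_def happel_tricat_def)
  moreover have "natural_iso (quillen_tricat C FM P \<Sigma> \<eta>) (happel_tricat C E \<mu> \<pi>)
      (comp_ftr ho_stable \<Sigma>) (comp_ftr (Sh \<mu> \<pi>) ho_stable) \<phi>"
    using \<phi>(1) by (simp add: quillen_tricat_def happel_tricat_def)
  ultimately have "triangulated_equivalence (quillen_tricat C FM P \<Sigma> \<eta>) (happel_tricat C E \<mu> \<pi>) ho_stable \<phi>"
    by (simp add: triangulated_equivalence_def quillen_tricat_simps happel_tricat_simps)
  then show ?thesis by blast
qed

end

end

theorem theorem1p1:
  fixes C :: "('o, 'm) addcat" and E :: "('m \<times> 'm) set"
  assumes "frobenius_category C E"
  shows "let M = frobenius_model C E; H = ho_cat C M in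
    classical_model_structure C E M \<and>
    (\<forall>\<mu> \<pi> P. happel_choice C E \<mu> \<pi> \<and> path_object_choice C M P \<longrightarrow>
       is_equivalence H H (loop_functor C M P) \<and>
       (\<forall>\<Sigma> \<eta> \<epsilon>. quasi_inverse H H (loop_functor C M P) \<Sigma> \<eta> \<epsilon> \<longrightarrow>
          (\<exists>\<Phi> \<phi>. triangulated_equivalence
             (quillen_tricat C M P \<Sigma> \<eta>) (happel_tricat C E \<mu> \<pi>) \<Phi> \<phi>)))"
proof -
  interpret frobenius_category C E by (rule assms)
  show ?thesis
    unfolding Let_def
  proof (intro conjI allI impI; (elim conjE)?)
    show "classical_model_structure C E FM" by (rule frobenius_model_structure)
  next
    fix \<mu> \<pi> P assume paths: "path_object_choice C FM P"
    then have "\<exists>j k r. path_cover (P Z) j k r" if "Z \<in> Obj C" for Z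
      using path_cover_exists that by (metis path_object_choice_def)
    then obtain J K R where "\<forall>Z\<in>Obj C. path_cover (P Z) (J Z) (K Z) (R Z)"
      by metis
    from loop_equivalence[OF paths this] show "is_equivalence Ho Ho (Lo P)" .
  next
    fix \<mu> \<pi> P \<Sigma> \<eta> \<epsilon>
    assume choice: "happel_choice C E \<mu> \<pi>" "path_object_choice C FM P"
      and q: "quasi_inverse Ho Ho (loop_functor C FM P) \<Sigma> \<eta> \<epsilon>"
    have "\<exists>j k r. path_cover (P Z) j k r" if "Z \<in> Obj C" for Z
      using path_cover_exists that choice(2) by (metis path_object_choice_def)
    then obtain J K R where covers: "\<forall>Z\<in>Obj C. path_cover (P Z) (J Z) (K Z) (R Z)"
      by metis
    \<comment> \<open>Injectivity of the hull completes -1 on the loop object to a cover map; any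
      such choice serves as \<open>\<psi>\<close>.\<close>
    have "\<exists>t. cover_map (K Z) (R Z) (\<mu> (Src C (K Z))) (\<pi> (Src C (K Z))) (Neg (Idn C (Src C (K Z)))) t"
      if "Z \<in> Obj C" for Z
    proof -
      have c: "cover (K Z) (R Z)" "Src C (K Z) \<in> Obj C"
        using path_coverD(1) covers that coverD(1) by (blast, metis Src_Obj)
      note h = happel_cover[OF choice(1) c(2)]
      show ?thesis
        using cover_map_from_left[OF c(1) h(1), of "Neg (Idn C (Src C (K Z)))"] c(2) h(2) by (metis Idn_simps Neg_simps(1-3))
    qed
    then obtain \<psi> where "\<And>Z. Z \<in> Obj C \<Longrightarrow>
        cover_map (K Z) (R Z) (\<mu> (Src C (K Z))) (\<pi> (Src C (K Z))) (Neg (Idn C (Src C (K Z)))) (\<psi> Z)"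
      by metis
    from quillen_happel_equivalence[OF choice covers this q]
    show "\<exists>\<Phi> \<phi>. triangulated_equivalence (quillen_tricat C FM P \<Sigma> \<eta>) (happel_tricat C E \<mu> \<pi>) \<Phi> \<phi>" .
  qed
qed

end
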